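(* Let $q+r\ge 2$, let $\Delta$ be an irreducible arithmetic subgroup of $G=\mathrm{PSL}(2,\mathbb{C})^q\times\mathrm{PSL}(2,\mathbb{R})^r$, and let $\Gamma$ be a finitely generated subgroup of $\Delta$ such that $p_j(\Gamma)$ is nonelementary for some $j\in\{1,\dots,q+r\}$. Then the limit cone of $\Gamma$ consists of exactly one point of $\mathbb{RP}^{q+r-1}$ (i.e. is a single ray) if and only if $p_j(\Gamma)$ is contained in an arithmetic Fuchsian or Kleinian group.
   Context: $p_i$ is the $i$-th coordinate projection of $G$. For $g\in\mathrm{PSL}(2,\mathbb{C})$, $\ell(g)$ is its translation length if $g$ is loxodromic and $0$ otherwise. A subgroup of $\mathrm{PSL}(2,\mathbb{C})$ is nonelementary if it has no finite orbit in $\mathbb{H}^3\cup\partial\mathbb{H}^3$. The limit cone of $\Gamma$ is the smallest closed cone in $\mathbb{R}^{q+r}$ containing all vectors $(\ell(g_1),\dots,\ell(g_{q+r}))$, $g=(g_1,\dots,g_{q+r})\in\Gamma$ (equivalently, the smallest closed cone in the diagonal Cartan subspace of $\mathfrak{sl}(2,\mathbb{C})^q\times\mathfrak{sl}(2,\mathbb{R})^r$ containing $\log\lambda(\Gamma)$), identified with its image in $\mathbb{RP}^{q+r-1}$. Arithmetic groups: let $K$ be a number field with exactly $q$ pairs of complex conjugate nonreal embeddings; choose one embedding $\phi_1,\dots,\phi_q$ from each pair and distinct real embeddings $\phi_{q+1},\dots,\phi_{q+r}$. Let $A$ be a quaternion algebra over $K$ split at $\phi_{q+1},\dots,\phi_{q+r}$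 and ramified at all other real embeddings; $\mathcal{O}$ an order, $\mathcal{O}^1$ its reduced-norm-one elements; extend $\phi_i$ to embeddings of $A$ into matrix algebras. $\Gamma(A,\mathcal{O})^*$ is the image in $G$ of $\{(\phi_1(\varepsilon),\dots,\phi_{q+r}(\varepsilon)):\varepsilon\in\mathcal{O}^1\}$; an irreducible arithmetic subgroup of $G$ is a subgroup commensurable with such a group. For $(q,r)=(0,1)$ resp. $(1,0)$ the groups commensurable with such $\Gamma(A,\mathcal{O})^*$ and their conjugates are arithmetic Fuchsian resp. Kleinian groups (conjugates in $\mathrm{PSL}(2,\mathbb{C})$ of arithmetic Fuchsian groups also count). *)

theory Defs
  imports "HOL-Analysis.Analysis" "HOL-Algebra.Coset" "HOL-Algebra.Generated_Groups"
          "HOL-Computational_Algebra.Polynomial"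
begin

type_synonym mat2 = "complex^2^2"

definition real_mat :: "mat2 \<Rightarrow> bool" where
  "real_mat M \<longleftrightarrow> (\<forall>a b. Im (M$a$b) = 0)"

text \<open>Inverse of a determinant-one 2x2 matrix (the adjugate):
  [[a,b],[c,d]] goes to [[d,-b],[-c,a]].  In the index type 2, i+1 is the other index.\<close>
definition sl2_inv :: "mat2 \<Rightarrow> mat2" where
  "sl2_inv M = (\<chi> i j. if i = j then M$(i+1)$(j+1) else - M$i$j)"

definition adj2 :: "mat2 \<Rightarrow> mat2" where
  "adj2 M = (\<chi> i j. cnj (M$j$i))"

text \<open>The group SL(2,C); PSL(2,C) subgroups are represented by their (sign-saturated)
  preimages in SL(2,C).\<close>
definition SL2 :: "mat2 monoid" where
  "SL2 = \<lparr>carrier = {M. det M = 1}, mult = (\<lambda>M N. M ** N), one = mat 1\<rparr>"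

text \<open>Hyperbolic 3-space, model SL(2,C)/SU(2): positive definite Hermitian matrices of
  determinant 1, with action g.X = g X g^*, and distance cosh d(X,Y) = tr(X Y^-1)/2.\<close>
definition H3 :: "mat2 set" where
  "H3 = {X. (\<forall>a b. X$a$b = cnj (X$b$a)) \<and> det X = 1 \<and> Re (X$1$1) > 0}"

definition actH :: "mat2 \<Rightarrow> mat2 \<Rightarrow> mat2" where
  "actH g X = g ** X ** adj2 g"

definition distH :: "mat2 \<Rightarrow> mat2 \<Rightarrow> real" where
  "distH X Y = arcosh (Re (trace (X ** sl2_inv Y)) / 2)"

text \<open>Boundary sphere = complex projective line: lines through nonzero vectors in C^2.\<close>
definition cline :: "complex^2 \<Rightarrow> (complex^2) set" where
  "cline v = {c *s v | c. True}"

definition nonelementary :: "mat2 set \<Rightarrow> bool" where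
  "nonelementary \<Lambda> \<longleftrightarrow>
     \<not> (\<exists>X\<in>H3. finite ((\<lambda>g. actH g X) ` \<Lambda>)) \<and>
     \<not> (\<exists>v. v \<noteq> 0 \<and> finite ((\<lambda>g. cline (g *v v)) ` \<Lambda>))"

text \<open>Translation length = minimal displacement (equals the translation length for
  loxodromic elements and 0 for elliptic, parabolic and trivial ones).\<close>
definition tlen :: "mat2 \<Rightarrow> real" where
  "tlen g = Inf ((\<lambda>X. distH X (actH g X)) ` H3)"

text \<open>Factors are indexed by a finite type 'n; C is the set of complex factors
  (so q = card C, r = CARD('n) - card C).  Elements of the preimage of G in
  SL(2,C)^q x SL(2,R)^r are functions 'n => mat2.\<close>
definition SLG :: "'n set \<Rightarrow> ('n \<Rightarrow> mat2) monoid" where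
  "SLG C = \<lparr>carrier = {g. \<forall>i. det (g i) = 1 \<and> (i \<notin> C \<longrightarrow> real_mat (g i))},
            mult = (\<lambda>g h i. g i ** h i), one = (\<lambda>i. mat 1)\<rparr>"

definition signs :: "('n \<Rightarrow> mat2) set" where
  "signs = {g. \<forall>i. g i = mat 1 \<or> g i = - mat 1}"

text \<open>A subgroup of G, represented by its full preimage.\<close>
definition Gsubgroup :: "'n set \<Rightarrow> ('n \<Rightarrow> mat2) set \<Rightarrow> bool" where
  "Gsubgroup C H \<longleftrightarrow> subgroup H (SLG C) \<and> signs \<subseteq> H"

definition sat :: "('n \<Rightarrow> mat2) set \<Rightarrow> ('n \<Rightarrow> mat2) set" where
  "sat X = {(\<lambda>i. s i ** g i) | s g. s \<in> signs \<and> g \<in> X}"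

definition fin_gen :: "('a, 'b) monoid_scheme \<Rightarrow> 'a set \<Rightarrow> bool" where
  "fin_gen Gr H \<longleftrightarrow> (\<exists>S. finite S \<and> S \<subseteq> carrier Gr \<and> generate Gr S = H)"

definition fin_index :: "('a, 'b) monoid_scheme \<Rightarrow> 'a set \<Rightarrow> 'a set \<Rightarrow> bool" where
  "fin_index Gr H K \<longleftrightarrow> finite ((\<lambda>k. H #>\<^bsub>Gr\<^esub> k) ` K)"

definition commensurable :: "('a, 'b) monoid_scheme \<Rightarrow> 'a set \<Rightarrow> 'a set \<Rightarrow> bool" where
  "commensurable Gr H K \<longleftrightarrow> fin_index Gr (H \<inter> K) H \<and> fin_index Gr (H \<inter> K) K"

definition subfield :: "complex set \<Rightarrow> bool" where
  "subfield K \<longleftrightarrow> 0 \<in> K \<and> 1 \<in> K \<and> (\<forall>x\<in>K. \<forall>y\<in>K. x + y \<in> K \<and> x * y \<in> K) \<and>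
     (\<forall>x\<in>K. - x \<in> K \<and> inverse x \<in> K)"

definition number_field :: "complex set \<Rightarrow> bool" where
  "number_field K \<longleftrightarrow> subfield K \<and>
     (\<exists>B. finite B \<and> B \<subseteq> K \<and> (\<forall>x\<in>K. \<exists>c. x = (\<Sum>b\<in>B. of_rat (c b) * b)))"

text \<open>Field embeddings of K into C (identified when they agree on K).\<close>
definition embedding :: "complex set \<Rightarrow> (complex \<Rightarrow> complex) \<Rightarrow> bool" where
  "embedding K \<sigma> \<longleftrightarrow> \<sigma> 1 = 1 \<and> (\<forall>x\<in>K. \<forall>y\<in>K. \<sigma> (x + y) = \<sigma> x + \<sigma> y \<and> \<sigma> (x * y) = \<sigma> x * \<sigma> y)"

definition real_emb :: "complex set \<Rightarrow> (complex \<Rightarrow> complex) \<Rightarrow> bool" where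
  "real_emb K \<sigma> \<longleftrightarrow> (\<forall>x\<in>K. Im (\<sigma> x) = 0)"

definition same_emb :: "complex set \<Rightarrow> (complex \<Rightarrow> complex) \<Rightarrow> (complex \<Rightarrow> complex) \<Rightarrow> bool" where
  "same_emb K \<sigma> \<tau> \<longleftrightarrow> (\<forall>x\<in>K. \<sigma> x = \<tau> x)"

text \<open>The quaternion algebra A = (a,b)_K (basis 1, i, j, ij with i^2 = a, j^2 = b, ij = -ji);
  its elements are x0 + x1 i + x2 j + x3 ij with coordinates x$0..x$3 in K.\<close>
definition quat_alg :: "complex set \<Rightarrow> (complex^4) set" where
  "quat_alg K = {x. \<forall>t. x$t \<in> K}"

definition qmult :: "complex \<Rightarrow> complex \<Rightarrow> complex^4 \<Rightarrow> complex^4 \<Rightarrow> complex^4" where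
  "qmult a b x y = (\<chi> t.
      if t = 0 then x$0*y$0 + a*x$1*y$1 + b*x$2*y$2 - a*b*x$3*y$3
      else if t = 1 then x$0*y$1 + x$1*y$0 - b*x$2*y$3 + b*x$3*y$2
      else if t = 2 then x$0*y$2 + x$2*y$0 + a*x$1*y$3 - a*x$3*y$1
      else x$0*y$3 + x$3*y$0 + x$1*y$2 - x$2*y$1)"

definition qone :: "complex^4" where
  "qone = (\<chi> t. if t = 0 then 1 else 0)"

definition nrd :: "complex \<Rightarrow> complex \<Rightarrow> complex^4 \<Rightarrow> complex" where
  "nrd a b x = x$0^2 - a*x$1^2 - b*x$2^2 + a*b*x$3^2"

definition is_order :: "complex set \<Rightarrow> complex \<Rightarrow> complex \<Rightarrow> (complex^4) set \<Rightarrow> bool" where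
  "is_order K a b Ord \<longleftrightarrow> Ord \<subseteq> quat_alg K \<and> qone \<in> Ord \<and>
     (\<forall>x\<in>Ord. \<forall>y\<in>Ord. x + y \<in> Ord \<and> - x \<in> Ord \<and> qmult a b x y \<in> Ord) \<and>
     (\<exists>B. finite B \<and> B \<subseteq> Ord \<and>
        Ord = {(\<Sum>v\<in>B. (\<chi> t. c v * v$t)) | c. \<forall>v. c v \<in> K \<and> algebraic_int (c v)}) \<and>
     (\<forall>x\<in>quat_alg K. \<exists>B c. finite B \<and> B \<subseteq> Ord \<and> (\<forall>v. c v \<in> K) \<and>
        x = (\<Sum>v\<in>B. (\<chi> t. c v * v$t)))"

text \<open>A is split at the real embedding sigma iff A \<otimes>_sigma R embeds in (equivalently is
  isomorphic to) M_2(R), i.e. there are real matrices I, J with I^2 = sigma a,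
  J^2 = sigma b, IJ = -JI.\<close>
definition split_real :: "(complex \<Rightarrow> complex) \<Rightarrow> complex \<Rightarrow> complex \<Rightarrow> bool" where
  "split_real \<sigma> a b \<longleftrightarrow> (\<exists>I J. real_mat I \<and> real_mat J \<and> I ** I = mat (\<sigma> a) \<and>
       J ** J = mat (\<sigma> b) \<and> I ** J = - (J ** I))"

text \<open>Image in M_2 of x under the extension of phi determined by the images I, J of i, j.\<close>
definition qrep :: "(complex \<Rightarrow> complex) \<Rightarrow> mat2 \<Rightarrow> mat2 \<Rightarrow> complex^4 \<Rightarrow> mat2" where
  "qrep \<phi> I J x = mat (\<phi> (x$0)) + mat (\<phi> (x$1)) ** I + mat (\<phi> (x$2)) ** J
                   + mat (\<phi> (x$3)) ** (I ** J)"

definition arith_data ::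
  "'n set \<Rightarrow> complex set \<Rightarrow> complex \<Rightarrow> complex \<Rightarrow> (complex^4) set \<Rightarrow>
   ('n \<Rightarrow> complex \<Rightarrow> complex) \<Rightarrow> ('n \<Rightarrow> mat2) \<Rightarrow> ('n \<Rightarrow> mat2) \<Rightarrow> bool" where
  "arith_data C K a b Ord \<phi> I J \<longleftrightarrow>
     number_field K \<and> a \<in> K \<and> b \<in> K \<and> a \<noteq> 0 \<and> b \<noteq> 0 \<and>
     (\<forall>i. embedding K (\<phi> i)) \<and>
     (\<forall>i. i \<in> C \<longleftrightarrow> \<not> real_emb K (\<phi> i)) \<and>
     (\<forall>i j. i \<noteq> j \<longrightarrow> \<not> same_emb K (\<phi> i) (\<phi> j)) \<and>
     (\<forall>i\<in>C. \<forall>j\<in>C. \<not> same_emb K (\<phi> i) (cnj \<circ> \<phi> j)) \<and>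
     (\<forall>\<sigma>. embedding K \<sigma> \<and> \<not> real_emb K \<sigma> \<longrightarrow>
        (\<exists>i\<in>C. same_emb K \<sigma> (\<phi> i) \<or> same_emb K \<sigma> (cnj \<circ> \<phi> i))) \<and>
     (\<forall>i. i \<notin> C \<longrightarrow> split_real (\<phi> i) a b) \<and>
     (\<forall>\<sigma>. embedding K \<sigma> \<and> real_emb K \<sigma> \<and> (\<forall>i. i \<notin> C \<longrightarrow> \<not> same_emb K \<sigma> (\<phi> i)) \<longrightarrow>
        \<not> split_real \<sigma> a b) \<and>
     is_order K a b Ord \<and>
     (\<forall>i. I i ** I i = mat (\<phi> i a) \<and> J i ** J i = mat (\<phi> i b) \<and>
          I i ** J i = - (J i ** I i) \<and> (i \<notin> C \<longrightarrow> real_mat (I i) \<and> real_mat (J i)))"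

definition Gamma_star :: "'n set \<Rightarrow> complex \<Rightarrow> complex \<Rightarrow> (complex^4) set \<Rightarrow>
   ('n \<Rightarrow> complex \<Rightarrow> complex) \<Rightarrow> ('n \<Rightarrow> mat2) \<Rightarrow> ('n \<Rightarrow> mat2) \<Rightarrow> ('n \<Rightarrow> mat2) set" where
  "Gamma_star C a b Ord \<phi> I J = sat {(\<lambda>i. qrep (\<phi> i) (I i) (J i) x) | x. x \<in> Ord \<and> nrd a b x = 1}"

definition irr_arithmetic :: "'n set \<Rightarrow> ('n \<Rightarrow> mat2) set \<Rightarrow> bool" where
  "irr_arithmetic C \<Delta> \<longleftrightarrow> Gsubgroup C \<Delta> \<and>
     (\<exists>K a b Ord \<phi> I J. arith_data C K a b Ord \<phi> I J \<and>
        commensurable (SLG C) \<Delta> (Gamma_star C a b Ord \<phi> I J))"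

text \<open>Arithmetic Fuchsian ((q,r) = (0,1)) and Kleinian ((q,r) = (1,0)) groups, as
  sign-saturated subgroups of SL(2,C), up to conjugation in PSL(2,C).\<close>
definition arith_fuchsian_or_kleinian :: "mat2 set \<Rightarrow> bool" where
  "arith_fuchsian_or_kleinian \<Lambda> \<longleftrightarrow> subgroup \<Lambda> SL2 \<and> - mat 1 \<in> \<Lambda> \<and>
     (\<exists>(C::unit set) K a b Ord \<phi> I J h. (C = {} \<or> C = UNIV) \<and> arith_data C K a b Ord \<phi> I J \<and>
        det h = 1 \<and>
        commensurable SL2 \<Lambda> {h ** g () ** sl2_inv h | g. g \<in> Gamma_star C a b Ord \<phi> I J})"

definition limit_cone :: "('n::finite \<Rightarrow> mat2) set \<Rightarrow> (real^'n) set" where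
  "limit_cone \<Gamma> = \<Inter> {S. closed S \<and> cone S \<and> (\<lambda>g. (\<chi> i. tlen (g i))) ` \<Gamma> \<subseteq> S}"

definition single_proj_point :: "(real^'n) set \<Rightarrow> bool" where
  "single_proj_point L \<longleftrightarrow> L - {0} \<noteq> {} \<and> (\<forall>x\<in>L - {0}. \<forall>y\<in>L - {0}. \<exists>c. x = c *\<^sub>R y)"

end

theory Submission
  imports Defs "HOL-Analysis.Kronecker_Approximation_Theorem"
    "HOL-Computational_Algebra.Fundamental_Theorem_Algebra"
begin

text \<open>If the length vectors of \<open>\<Gamma>\<close> form a ray, then \<open>\<ell>(g\<^sub>i) = \<kappa>\<^sub>i \<ell>(g\<^sub>j)\<close> on \<open>\<Gamma>\<close>. Where
  \<open>\<kappa>\<^sub>i > 0\<close>, the growth of the traces of \<open>g\<^sup>n h\<close> recovers the absolute values of the matrix entries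
  of \<open>h\<close> in an eigenbasis of \<open>g\<close>, which forces \<open>\<kappa>\<^sub>i = 1\<close> and makes the two projections conjugate up
  to signs and complex conjugation. On a normal subgroup \<open>N\<close> of finite index the trace of \<open>g\<^sub>i\<close> is
  therefore \<open>tr g\<^sub>j\<close>, or its conjugate, or it lies in \<open>[-2,2]\<close>. As every embedding of the trace field
  \<open>F\<close> of \<open>p\<^sub>j(N)\<close> extends to \<open>K\<close>, where it is a place \<open>\<phi>\<^sub>i\<close>, a conjugate of one, or ramified in \<open>A\<close>, the
  algebra spanned by \<open>p\<^sub>j(N)\<close> over \<open>F\<close> has the ramification of an arithmetic Fuchsian or Kleinian
  group. The span over the integers of \<open>F\<close> is an order; its norm one group is normalized by
  \<open>p\<^sub>j(\<Gamma>)\<close>, and adjoining \<open>p\<^sub>j(\<Gamma>)\<close> only enlarges it by a finite index.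

  Conversely, if \<open>p\<^sub>j(\<Gamma>)\<close> lies in an arithmetic Fuchsian or Kleinian group with field \<open>L\<close>, the place
  \<open>\<phi>\<^sub>i\<close> induces on the traces of a power of \<open>g\<^sub>j\<close> an embedding which extends to \<open>L\<close> and hence is the
  identity, the conjugation or ramified. So all \<open>\<kappa>\<^sub>i\<close> are 0 or 1.\<close>

subsection \<open>Translation lengths and traces\<close>

text \<open>Lengths determine traces only up to a bounded error and only in absolute value, so a
  single element says little. Multiplying by high powers of a loxodromic element makes the error
  negligible, and an isometry argument in the plane turns equal absolute values into equality up to
  conjugation. Working in SL instead of PSL leaves a sign for each element, which disappears on a
  subgroup of index at most 2 for each coordinate.

  Two demands of the definition of an arithmetic group shape the second half. An order must be
  finitely generated over the integers of \<open>F\<close>: here the finite generation of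
  \<open>\<Gamma>\<close> enters, through Schreier generators of \<open>N\<close> and a rewriting of
  words by the Cayley-Hamilton identity. And all of \<open>p_j(\<Gamma>)\<close>, not just a
  subgroup of finite index, has to lie in the arithmetic group: hence the normal core. Elsewhere
  powers and subgroups of finite index are harmless, since lengths are multiplied by
  \<open>n\<close> under \<open>n\<close>-th powers and being nonelementary passes to finite
  index.\<close>

definition mk :: "complex \<Rightarrow> complex \<Rightarrow> complex \<Rightarrow> complex \<Rightarrow> mat2" where
  "mk a b c d = (\<chi> i k. if i = 1 then if k = 1 then a else b else if k = 1 then c else d)"

lemma mk_nth [simp]:
  "mk a b c d $ 1 $ 1 = a" "mk a b c d $ 1 $ 2 = b" "mk a b c d $ 2 $ 1 = c" "mk a b c d $ 2 $ 2 = d"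
  by (simp_all add: mk_def)

lemma mat2_eq_iff:
  "(M :: mat2) = N \<longleftrightarrow> M$1$1 = N$1$1 \<and> M$1$2 = N$1$2 \<and> M$2$1 = N$2$1 \<and> M$2$2 = N$2$2"
  by (auto simp: vec_eq_iff forall_2)

lemma mk_cases: obtains a b c d where "M = mk a b c d"
  by (rule that[of "M$1$1" "M$1$2" "M$2$1" "M$2$2"]) (simp add: mat2_eq_iff)

lemma mk_eq_iff [simp]: "mk a b c d = mk a' b' c' d' \<longleftrightarrow> a = a' \<and> b = b' \<and> c = c' \<and> d = d'"
  by (simp add: mat2_eq_iff)

lemma mk_mult [simp]:
  "mk a b c d ** mk a' b' c' d' = mk (a*a' + b*c') (a*b' + b*d') (c*a' + d*c') (c*b' + d*d')"
  by (simp add: mat2_eq_iff matrix_matrix_mult_def sum_2)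

lemma mat_mk: "mat x = mk x 0 0 x"
  by (simp add: mat2_eq_iff mat_def)

lemma det_mk [simp]: "det (mk a b c d) = a * d - b * c"
  by (simp add: det_2)

lemma trace_mk [simp]: "trace (mk a b c d) = a + d"
  by (simp add: trace_def sum_2)

lemma mk_arith [simp]:
  "mk a b c d + mk a' b' c' d' = mk (a + a') (b + b') (c + c') (d + d')"
  "mk a b c d - mk a' b' c' d' = mk (a - a') (b - b') (c - c') (d - d')"
  "- mk a b c d = mk (-a) (-b) (-c) (-d)"
  by (simp_all add: mat2_eq_iff)

text \<open>The index \<open>i+1\<close> in \<open>sl2_inv\<close> makes the numeral 3 out of 2; it
  wraps round modulo 2.\<close>

lemma three_eq_one: "(3 :: 2) = 1"
  by simp_all

lemma sl2_inv_mk [simp]: "sl2_inv (mk a b c d) = mk d (-b) (-c) a"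
  by (simp add: mat2_eq_iff sl2_inv_def three_eq_one)

lemma adj2_mk [simp]: "adj2 (mk a b c d) = mk (cnj a) (cnj c) (cnj b) (cnj d)"
  by (simp add: mat2_eq_iff adj2_def)

lemma det_adj2: "det (adj2 M) = cnj (det M)"
  by (cases M rule: mk_cases) simp

lemma mk_mulv [simp]: "mk a b c d *v v = (\<chi> i. if i = 1 then a * v$1 + b * v$2 else c * v$1 + d * v$2)"
  by (simp add: vec_eq_iff forall_2 matrix_vector_mult_def sum_2)

lemma mk_zero: "0 = mk 0 0 0 0"
  by (simp add: mat2_eq_iff)

lemma sl2_inv_left: "det M = 1 \<Longrightarrow> sl2_inv M ** M = mat 1"
  by (cases M rule: mk_cases) (simp add: mat_mk algebra_simps)

lemma sl2_inv_right: "det M = 1 \<Longrightarrow> M ** sl2_inv M = mat 1"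
  by (cases M rule: mk_cases) (simp add: mat_mk algebra_simps)

lemma det_sl2_inv [simp]: "det (sl2_inv M) = det M"
  by (cases M rule: mk_cases) simp

lemma trace_sl2_inv [simp]: "trace (sl2_inv M) = trace M"
  by (cases M rule: mk_cases) simp

lemma sl2_inv_mult: "sl2_inv (M ** N) = sl2_inv N ** sl2_inv M"
  by (cases M rule: mk_cases, cases N rule: mk_cases) simp

lemma sl2_inv_inv [simp]: "sl2_inv (sl2_inv M) = M"
  by (cases M rule: mk_cases) simp

lemma adj2_mult: "adj2 (M ** N) = adj2 N ** adj2 M"
  by (cases M rule: mk_cases, cases N rule: mk_cases) (simp add: algebra_simps)

lemma trace_comm: "trace ((M :: mat2) ** N) = trace (N ** M)"
  by (cases M rule: mk_cases, cases N rule: mk_cases) (simp add: algebra_simps)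

lemma trace_conj: "det p = 1 \<Longrightarrow> trace (p ** M ** sl2_inv p) = trace M"
  by (metis trace_comm matrix_mul_assoc sl2_inv_left matrix_mul_lid)

lemma actH_mult: "actH (M ** N) X = actH M (actH N X)"
  by (simp add: actH_def adj2_mult matrix_mul_assoc)

lemma distH_actH:
  assumes "det p = 1"
  shows "distH (actH p X) (actH p Y) = distH X Y"
proof -
  have "det (adj2 p) = 1"
    using assms by (simp add: det_adj2)
  then have e: "adj2 p ** sl2_inv (adj2 p) = mat 1" by (rule sl2_inv_right)
  have "actH p X ** sl2_inv (actH p Y) = p ** (X ** (adj2 p ** sl2_inv (adj2 p)) ** sl2_inv Y) ** sl2_inv p"
    by (simp add: actH_def sl2_inv_mult matrix_mul_assoc)
  also have "\<dots> = p ** (X ** sl2_inv Y) ** sl2_inv p" by (simp add: e)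
  finally show ?thesis using assms by (simp add: distH_def trace_conj)
qed

lemma H3_iff: "mk x z w y \<in> H3 \<longleftrightarrow> Im x = 0 \<and> Im y = 0 \<and> w = cnj z \<and> x * y - z * cnj z = 1 \<and> Re x > 0"
  by (auto simp: H3_def forall_2 complex_eq_iff)

lemma H3_cases:
  assumes "X \<in> H3"
  obtains x y :: real and z where "X = mk (of_real x) z (cnj z) (of_real y)" "x > 0" "y > 0" "x * y - (cmod z)\<^sup>2 = 1"
proof -
  obtain a b c d where M: "X = mk a b c d" by (rule mk_cases)
  have h: "Im a = 0" "Im d = 0" "c = cnj b" "a * d - b * cnj b = 1" "Re a > 0"
    using assms unfolding M H3_iff by auto
  have a: "a = of_real (Re a)" and d: "d = of_real (Re d)"
    using h by (auto simp: complex_eq_iff)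
  have "of_real (Re a * Re d - (cmod b)\<^sup>2) = (of_real 1 :: complex)"
    using h(4) a d by (metis complex_norm_square of_real_1 of_real_diff of_real_mult)
  then have e: "Re a * Re d - (cmod b)\<^sup>2 = 1" by (simp only: of_real_eq_iff)
  then have "Re a * Re d > 0" by (smt (verit) zero_le_power2)
  then have "Re d > 0" using h(5) by (simp add: zero_less_mult_iff)
  then show ?thesis using that[of "Re a" b "Re d"] M a d h e by auto
qed

lemma H3_I:
  assumes "x > 0" "x * y - (cmod z)\<^sup>2 = 1"
  shows "mk (of_real x) z (cnj z) (of_real y) \<in> H3"
proof -
  have "complex_of_real (x * y - (cmod z)\<^sup>2) = 1" using assms by simp
  then have "of_real x * of_real y - z * cnj z = 1"
    by (metis complex_norm_square of_real_diff of_real_mult)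
  then show ?thesis using assms by (simp add: H3_iff)
qed

lemma actH_in_H3:
  assumes "det p = 1" "X \<in> H3"
  shows "actH p X \<in> H3"
proof -
  obtain x y z where X: "X = mk (of_real x) z (cnj z) (of_real y)" "x > 0" "y > 0" "x * y - (cmod z)\<^sup>2 = 1"
    using assms(2) by (rule H3_cases)
  obtain a b c d where p: "p = mk a b c d" by (rule mk_cases)
  have dp: "a * d - b * c = 1" using assms p by simp
  \<comment> \<open>\<open>q\<close> is the upper left entry of \<open>actH p X\<close>. Completing
    the square in \<open>x * q\<close> leaves two squares that cannot both vanish, as
    \<open>det p = 1\<close>.\<close>
  define q where "q = (cmod a)\<^sup>2 * x + 2 * Re (a * z * cnj b) + (cmod b)\<^sup>2 * y"
  have "x * q = (cmod (a * of_real x + b * cnj z))\<^sup>2 + (cmod b)\<^sup>2 * (x * y - (cmod z)\<^sup>2)"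
    unfolding q_def cmod_power2 by (simp add: power2_eq_square algebra_simps cmod_power2[unfolded power2_eq_square])
  then have xq: "x * q = (cmod (a * of_real x + b * cnj z))\<^sup>2 + (cmod b)\<^sup>2"
    using X(4) by simp
  have "x * q > 0"
  proof (cases "b = 0")
    case True
    then have "a \<noteq> 0" using dp by auto
    then show ?thesis using True X xq by simp
  next
    case False
    then show ?thesis unfolding xq by (simp add: add_nonneg_pos)
  qed
  then have q: "q > 0" using X by (simp add: zero_less_mult_iff)
  have r: "det (actH p X) = 1"
  proof -
    have "det (adj2 p) = 1"
      using assms(1) by (simp add: det_adj2)
    moreover have "det X = 1" using assms(2) by (simp add: H3_def)
    ultimately show ?thesis using assms(1) by (simp add: actH_def det_mul)
  qed
  have "Re (actH p X $ 1 $ 1) = q"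
    unfolding X p actH_def q_def cmod_power2 by (simp add: algebra_simps power2_eq_square)
  moreover have "adj2 (actH p X) = actH p X"
    unfolding X p actH_def by (simp add: algebra_simps)
  then have "\<forall>u v. actH p X $ u $ v = cnj (actH p X $ v $ u)"
    by (metis (no_types) adj2_def vec_lambda_beta)
  ultimately show ?thesis unfolding H3_def mem_Collect_eq using q r by metis
qed

lemma tlen_conj:
  assumes p: "det p = 1"
  shows "tlen (p ** g ** sl2_inv p) = tlen g"
proof -
  have 1: "(\<lambda>X. distH X (actH (p ** g ** sl2_inv p) X)) ` H3 \<subseteq> (\<lambda>X. distH X (actH g X)) ` H3"
    if p: "det p = 1" for p g
  proof clarify
    fix X assume "X \<in> H3"
    define Y where "Y = actH (sl2_inv p) X"
    have "Y \<in> H3" using \<open>X \<in> H3\<close> p actH_in_H3 by (simp add: Y_def)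
    moreover have X: "X = actH p Y"
      using p by (simp add: Y_def sl2_inv_right flip: actH_mult) (simp add: actH_def adj2_def mat_mk mat2_eq_iff
         matrix_matrix_mult_def sum_2)
    have "distH X (actH (p ** g ** sl2_inv p) X) = distH (actH p Y) (actH p (actH g Y))"
      unfolding X by (metis actH_mult matrix_mul_assoc matrix_mul_rid sl2_inv_left p)
    then have "distH X (actH (p ** g ** sl2_inv p) X) = distH Y (actH g Y)"
      using p by (simp add: distH_actH)
    ultimately show "distH X (actH (p ** g ** sl2_inv p) X) \<in> (\<lambda>X. distH X (actH g X)) ` H3"
      by blast
  qed
  have e: "sl2_inv p ** (p ** g ** sl2_inv p) ** sl2_inv (sl2_inv p) = g"
    by (metis matrix_mul_assoc matrix_mul_lid matrix_mul_rid p sl2_inv_inv sl2_inv_left)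
  show ?thesis
    unfolding tlen_def using 1[OF p, of g] 1[of "sl2_inv p" "p ** g ** sl2_inv p"] p
    unfolding e by simp
qed

text \<open>This trace is twice the hyperbolic cosine of the displacement. Only the last square
  depends on the point, so the infimum of the displacement can be read off.\<close>

lemma disp_upper:
  assumes "of_real x * of_real y - z * cnj z = 1"
  shows "trace (mk (of_real x) z (cnj z) (of_real y) **
            sl2_inv (actH (mk l b 0 m) (mk (of_real x) z (cnj z) (of_real y))))
     = of_real ((cmod l)\<^sup>2 + (cmod m)\<^sup>2 + (cmod ((l - m) * z + b * of_real y))\<^sup>2)"
proof -
  \<comment> \<open>Adding a multiple of the determinant relation of the point makes this a
    polynomial identity without side conditions.\<close>
  have "trace (mk (of_real x) z (cnj z) (of_real y) **
            sl2_inv (actH (mk l b 0 m) (mk (of_real x) z (cnj z) (of_real y))))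
     = l * cnj l + m * cnj m + ((l - m) * z + b * of_real y) * cnj ((l - m) * z + b * of_real y)
       + (of_real x * of_real y - z * cnj z - 1) * (l * cnj l + m * cnj m)"
    unfolding actH_def mk_mult adj2_mk sl2_inv_mk trace_mk complex_cnj_add complex_cnj_mult complex_cnj_diff
      complex_cnj_complex_of_real complex_cnj_zero complex_cnj_cnj
    by algebra
  then show ?thesis
    unfolding of_real_add complex_norm_square using assms by simp
qed

lemma arcosh_real_mono: "1 \<le> (a::real) \<Longrightarrow> a \<le> b \<Longrightarrow> arcosh a \<le> arcosh b"
  by (metis arcosh_real_strict_mono order_le_less)

lemma tlen_upper:
  assumes lm: "l * m = 1"
  shows "tlen (mk l b 0 m) = arcosh (((cmod l)\<^sup>2 + (cmod m)\<^sup>2) / 2)"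
proof -
  define v where "v = ((cmod l)\<^sup>2 + (cmod m)\<^sup>2) / 2"
  have v1: "v \<ge> 1"
  proof -
    have "cmod l * cmod m = 1" using lm by (metis norm_mult norm_one)
    moreover have "(cmod l - cmod m)\<^sup>2 \<ge> 0" by simp
    ultimately show ?thesis by (simp add: v_def power2_eq_square algebra_simps)
  qed
  have D: "distH X (actH (mk l b 0 m) X) = arcosh (v + (cmod ((l - m) * z + b * of_real y))\<^sup>2 / 2)"
    if X: "X = mk (of_real x) z (cnj z) (of_real y)" and e: "x * y - (cmod z)\<^sup>2 = 1" for X x y z
  proof -
    have "complex_of_real (x * y - (cmod z)\<^sup>2) = 1" using e by simp
    then have e': "of_real x * of_real y - z * cnj z = 1"
      by (metis complex_norm_square of_real_diff of_real_mult)
    show ?thesis unfolding distH_def X disp_upper[OF e'] by (simp add: v_def add_divide_distrib)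
  qed
  show ?thesis unfolding v_def[symmetric] tlen_def
  proof (rule cInf_eq_non_empty)
    show "(\<lambda>X. distH X (actH (mk l b 0 m) X)) ` H3 \<noteq> {}"
      using H3_I[of 1 1 0] by auto
  next
    fix t assume "t \<in> (\<lambda>X. distH X (actH (mk l b 0 m) X)) ` H3"
    then obtain X where X: "X \<in> H3" "t = distH X (actH (mk l b 0 m) X)" by auto
    from X(1) show "arcosh v \<le> t"
      by (rule H3_cases) (use v1 in \<open>auto simp: X(2) D intro!: arcosh_real_mono\<close>)
  next
    fix t assume t: "\<And>s. s \<in> (\<lambda>X. distH X (actH (mk l b 0 m) X)) ` H3 \<Longrightarrow> t \<le> s"
    show "t \<le> arcosh v"
    proof (rule field_le_epsilon)
      fix e :: real assume e: "e > 0"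
      have "v = cosh (arcosh v)" using v1 by simp
      also have "\<dots> < cosh (arcosh v + e)" using e v1 arcosh_nonneg_real[OF v1] by (subst cosh_real_nonneg_less_iff) auto
      finally have lt: "v < cosh (arcosh v + e)" .
      define k where "k = cosh (arcosh v + e) - v"
      have k: "k > 0" using lt by (simp add: k_def)
      \<comment> \<open>The points diag(1/y, y) approach the fixed boundary point as
        \<open>y\<close> tends to 0, which shrinks the remaining square; the infimum need not be
        attained. This \<open>y\<close> gives \<open>cmod b * y \<le> sqrt k\<close>, and the
        summand 1 covers \<open>b = 0\<close>.\<close>
      define y where "y = sqrt k / (1 + cmod b)"
      have y: "y > 0" using k by (simp add: y_def add_pos_nonneg)
      have "cmod b * y \<le> sqrt k" unfolding y_def using k
        by (simp add: field_simps add_pos_nonneg)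
      then have "(cmod b * y)\<^sup>2 \<le> k"
        using k y power_mono[of "cmod b * y" "sqrt k" 2] by simp
      then have b: "v + (cmod (b * of_real y))\<^sup>2 / 2 \<le> cosh (arcosh v + e)"
        using k y by (simp add: k_def norm_mult)
      have "mk (of_real (1/y)) 0 (cnj 0) (of_real y) \<in> H3" using y by (intro H3_I) auto
      then have "t \<le> distH (mk (of_real (1/y)) 0 (cnj 0) (of_real y)) (actH (mk l b 0 m) (mk (of_real (1/y)) 0 (cnj 0) (of_real y)))"
        by (intro t) blast
      also have "\<dots> = arcosh (v + (cmod (b * of_real y))\<^sup>2 / 2)"
        by (subst D[OF refl]) (use y in auto)
      also have "\<dots> \<le> arcosh (cosh (arcosh v + e))"
      proof -
        have "v + (cmod (b * of_real y))\<^sup>2 / 2 \<ge> 1" using v1 by (simp add: add_increasing2)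
        then show ?thesis using b by (metis arcosh_real_strict_mono order_le_less)
      qed
      also have "\<dots> = arcosh v + e" using e v1 by (simp add: arcosh_cosh_real)
      finally show "t \<le> arcosh v + e" .
    qed
  qed
qed

text \<open>The disjunction is needed because a matrix that is already triangular is left alone,
  with its eigenvalues in either order.\<close>

lemma exists_triangular:
  assumes "det M = 1" "trace M = l + m" "l * m = 1"
  obtains p b where "det p = 1" "sl2_inv p ** M ** p = mk l b 0 m \<or> sl2_inv p ** M ** p = mk m b 0 l"
proof -
  obtain a b c d where M: "M = mk a b c d" by (rule mk_cases)
  have h: "a * d - b * c = 1" "a + d = l + m" using assms by (auto simp: M)
  show ?thesis
  proof (cases "c = 0")
    case True
    have "(a - l) * (a - m) = 0" using h assms(3) True by algebra
    then have "(a = l \<and> d = m) \<or> (a = m \<and> d = l)" using h by auto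
    then show ?thesis
      by (intro that[of "mat 1" b]) (use True in \<open>auto simp: M mat_mk\<close>)
  next
    case False
    \<comment> \<open>The first column \<open>(l - d, c)\<close> is an eigenvector for
      \<open>l\<close>; the second one only makes the determinant 1.\<close>
    define p where "p = mk (l - d) (-1/c) c 0"
    have e: "(l - d) * a + b * c = l * (l - d)" using h assms(3) by algebra
    have "det p = 1" using False by (simp add: p_def)
    moreover have "sl2_inv p ** M ** p = mk l (-1/c) 0 m"
      using False h assms(3) e unfolding p_def M
      apply (simp add: field_simps)
      apply (intro conjI; algebra)
      done
    ultimately show ?thesis by (intro that) auto
  qed
qed

theorem tlen_eq:
  assumes "det M = 1" "trace M = l + m" "l * m = 1"
  shows "tlen M = arcosh (((cmod l)\<^sup>2 + (cmod m)\<^sup>2) / 2)"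
proof -
  obtain p b where p: "det p = 1" "sl2_inv p ** M ** p = mk l b 0 m \<or> sl2_inv p ** M ** p = mk m b 0 l"
    using exists_triangular[OF assms] .
  have "M = p ** (sl2_inv p ** M ** p) ** sl2_inv p"
    by (metis matrix_mul_assoc matrix_mul_lid matrix_mul_rid p(1) sl2_inv_right)
  then have "tlen M = tlen (sl2_inv p ** M ** p)" using tlen_conj[OF p(1)] by metis
  moreover have "m * l = 1" using assms(3) by (simp add: mult.commute)
  ultimately show ?thesis using p(2) tlen_upper[OF assms(3), of b] tlen_upper[of m l b]
    by (auto simp: add.commute)
qed

lemma exists_eigenvalues:
  obtains l m :: complex where "t = l + m" "l * m = 1" "cmod l \<ge> 1"
proof -
  define s where "s = csqrt (t\<^sup>2 / 4 - 1)"
  have s: "s\<^sup>2 = t\<^sup>2 / 4 - 1" by (simp add: s_def)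
  have p: "(t / 2 + s) * (t / 2 - s) = 1" using s by (simp add: algebra_simps power2_eq_square)
  have n: "cmod (t / 2 + s) * cmod (t / 2 - s) = 1" using p by (metis norm_mult norm_one)
  show ?thesis
  proof (cases "cmod (t / 2 + s) \<ge> 1")
    case True
    then show ?thesis by (intro that[of "t / 2 + s" "t / 2 - s"]) (use p in auto)
  next
    case False
    have "cmod (t / 2 - s) \<ge> 1"
    proof (rule ccontr)
      assume "\<not> cmod (t / 2 - s) \<ge> 1"
      then have "cmod (t / 2 + s) * cmod (t / 2 - s) < 1 * 1"
        using False by (intro mult_strict_mono') auto
      then show False using n by simp
    qed
    then show ?thesis by (intro that[of "t / 2 - s" "t / 2 + s"]) (use p in \<open>auto simp: mult.commute\<close>)
  qed
qed

lemma tlen_eq_ln: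
  assumes "det M = 1" "trace M = l + m" "l * m = 1" "cmod l \<ge> 1"
  shows "tlen M = 2 * ln (cmod l)"
proof -
  have l0: "cmod l > 0" using assms(4) by linarith
  have "cmod m = inverse (cmod l)"
    using assms(3) l0 by (metis inverse_unique norm_mult norm_one)
  moreover have "exp (2 * ln (cmod l)) = (cmod l)\<^sup>2"
    using l0 by (metis exp_ln ln_realpow of_nat_numeral zero_less_power)
  ultimately have "((cmod l)\<^sup>2 + (cmod m)\<^sup>2) / 2 = cosh (2 * ln (cmod l))"
    by (simp add: cosh_def exp_minus power_inverse)
  then show ?thesis
    using tlen_eq[OF assms(1-3)] assms(4) by (simp add: arcosh_cosh_real)
qed

lemma tlen_nonneg: "det M = 1 \<Longrightarrow> tlen M \<ge> 0"
  by (metis exists_eigenvalues tlen_eq_ln ln_ge_zero mult_nonneg_nonneg zero_le_numeral)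

text \<open>A sign or a conjugation applied to the trace acts in the same way on the eigenvalues and
  keeps their absolute values.\<close>

lemma tlen_cong:
  assumes "det M = 1" "det N = 1" "s = 1 \<or> s = -1" "trace N = s * trace M \<or> trace N = s * cnj (trace M)"
  shows "tlen N = tlen M"
proof -
  obtain l m where lm: "trace M = l + m" "l * m = 1" "cmod l \<ge> 1" by (rule exists_eigenvalues)
  have "tlen M = 2 * ln (cmod l)" using assms(1) lm by (rule tlen_eq_ln)
  moreover have "tlen N = 2 * ln (cmod (s * l))" if "trace N = s * trace M"
    by (rule tlen_eq_ln[where m = "s * m"]) (use assms lm that in \<open>auto simp: algebra_simps\<close>)
  moreover have "tlen N = 2 * ln (cmod (s * cnj l))" if "trace N = s * cnj (trace M)"
    by (rule tlen_eq_ln[where m = "s * cnj m"])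
      (use assms lm that in \<open>auto simp: algebra_simps simp flip: complex_cnj_mult\<close>)
  ultimately show ?thesis using assms(3,4) by (auto simp: norm_mult)
qed

text \<open>The larger eigenvalue has absolute value \<open>exp (tlen M / 2)\<close>, the other one
  at most 1. This converts asymptotics of lengths into asymptotics of traces.\<close>

lemma trace_near_exp_tlen:
  assumes "det M = 1"
  shows "\<bar>exp (tlen M / 2) - cmod (trace M)\<bar> \<le> 1"
proof -
  obtain l m where lm: "trace M = l + m" "l * m = 1" "cmod l \<ge> 1" by (rule exists_eigenvalues)
  have "cmod l > 0" using lm(3) by linarith
  then have t: "exp (tlen M / 2) = cmod l" using tlen_eq_ln[OF assms lm] by simp
  have "cmod m \<le> 1" using lm(2,3)
    by (smt (verit) mult_cancel_right1 mult_left_le norm_ge_zero norm_mult norm_one mult_less_cancel_left2)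
  moreover have "cmod l - cmod m \<le> cmod (l + m)" "cmod (l + m) \<le> cmod l + cmod m"
    using norm_diff_ineq norm_triangle_ineq by blast+
  ultimately show ?thesis using t lm(1) by simp
qed

text \<open>Length 0 means that the eigenvalues lie on the unit circle and are conjugate to each
  other. This is the link between ramified real places and vanishing lengths.\<close>

lemma tlen_eq_0_iff:
  assumes "det M = 1"
  shows "tlen M = 0 \<longleftrightarrow> Im (trace M) = 0 \<and> \<bar>Re (trace M)\<bar> \<le> 2"
proof -
  obtain l m where lm: "trace M = l + m" "l * m = 1" "cmod l \<ge> 1" by (rule exists_eigenvalues)
  have t: "tlen M = 2 * ln (cmod l)" using tlen_eq_ln[OF assms lm] .
  show ?thesis
  proof
    assume "tlen M = 0"
    then have "ln (cmod l) = 0" using t by simp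
    then have n: "cmod l = 1" using lm(3) by (metis ln_eq_zero_iff order_less_le_trans zero_less_one)
    then have "l * cnj l = 1" by (simp add: complex_norm_square[symmetric])
    then have "m = cnj l" using lm(2) by (metis mult_cancel_left mult_zero_left zero_neq_one)
    moreover have "\<bar>Re l\<bar> \<le> 1" using n abs_Re_le_cmod by metis
    ultimately show "Im (trace M) = 0 \<and> \<bar>Re (trace M)\<bar> \<le> 2" using lm(1) by simp
  next
    assume tr: "Im (trace M) = 0 \<and> \<bar>Re (trace M)\<bar> \<le> 2"
    define x where "x = Re (trace M) / 2"
    have x: "x\<^sup>2 \<le> 1" using tr by (simp add: x_def abs_square_le_1)
    define l' where "l' = Complex x (sqrt (1 - x\<^sup>2))"
    have n: "cmod l' = 1" using x by (simp add: l'_def cmod_def)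
    have "tlen M = 2 * ln (cmod l')"
    proof (rule tlen_eq_ln[OF assms, where m = "cnj l'"])
      show "trace M = l' + cnj l'" using tr by (simp add: l'_def complex_eq_iff x_def)
      show "l' * cnj l' = 1" using n by (simp add: complex_norm_square[symmetric])
    qed (use n in auto)
    then show "tlen M = 0" by (simp add: n)
  qed
qed

section \<open>Powers and diagonalization\<close>

primrec mpow :: "mat2 \<Rightarrow> nat \<Rightarrow> mat2" where
  "mpow M 0 = mat 1"
| "mpow M (Suc n) = M ** mpow M n"

lemma det_mpow: "det M = 1 \<Longrightarrow> det (mpow M n) = 1"
  by (induction n) (simp_all add: det_mul)

lemma trace_mult_sq:
  assumes "det (M :: mat2) = 1"
  shows "trace (M ** (M ** N)) = trace M * trace (M ** N) - trace N"
proof -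
  obtain a b c d where M: "M = mk a b c d" by (rule mk_cases)
  obtain a' b' c' d' where N: "N = mk a' b' c' d'" by (rule mk_cases)
  have "trace (M ** (M ** N)) = trace M * trace (M ** N) - det M * trace N"
    unfolding M N by (simp add: algebra_simps)
  then show ?thesis using assms by simp
qed

lemma trace_mpow:
  assumes "det M = 1" "trace M = l + m" "l * m = 1"
  shows "trace (mpow M n) = l ^ n + m ^ n"
proof (induction n rule: less_induct)
  case (less n)
  consider "n = 0" | "n = 1" | k where "n = Suc (Suc k)"
    by (metis One_nat_def not0_implies_Suc)
  then show ?case
  proof cases
    case 1
    then show ?thesis by (simp add: mat_mk)
  next
    case 2
    then show ?thesis using assms by simp
  next
    case 3
    have "trace (mpow M n) = trace M * trace (mpow M (Suc k)) - trace (mpow M k)"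
      unfolding 3 using trace_mult_sq[OF assms(1)] by simp
    also have "\<dots> = (l + m) * (l ^ Suc k + m ^ Suc k) - (l ^ k + m ^ k) * (l * m)"
      using less.IH[of "Suc k"] less.IH[of k] 3 assms(2,3) by (simp del: mpow.simps)
    finally show ?thesis by (simp add: 3 algebra_simps)
  qed
qed

lemma tlen_mpow:
  assumes "det M = 1"
  shows "tlen (mpow M n) = n * tlen M"
proof -
  obtain l m where lm: "trace M = l + m" "l * m = 1" "cmod l \<ge> 1" by (rule exists_eigenvalues)
  have "tlen (mpow M n) = 2 * ln (cmod (l ^ n))"
    by (rule tlen_eq_ln[where m = "m ^ n"])
      (use assms lm in \<open>auto simp: det_mpow trace_mpow norm_power simp flip: power_mult_distrib\<close>)
  moreover have "cmod l > 0" using lm(3) by linarith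
  ultimately show ?thesis using tlen_eq_ln[OF assms lm] by (simp add: norm_power ln_realpow)
qed

lemma exists_diagonal:
  assumes "det M = 1" "trace M = l + m" "l * m = 1" "l \<noteq> m"
  obtains p where "det p = 1" "sl2_inv p ** M ** p = mk l 0 0 m"
proof -
  obtain p b where p: "det p = 1" "sl2_inv p ** M ** p = mk l b 0 m \<or> sl2_inv p ** M ** p = mk m b 0 l"
    using exists_triangular[OF assms(1-3)] .
  have C: "sl2_inv (p ** q) ** M ** (p ** q) = sl2_inv q ** (sl2_inv p ** M ** p) ** q" for q
    by (simp add: sl2_inv_mult matrix_mul_assoc)
  from p(2) show ?thesis
  proof
    assume e: "sl2_inv p ** M ** p = mk l b 0 m"
    define q where "q = mk 1 (b / (m - l)) 0 1"
    show ?thesis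
    proof (rule that)
      show "det (p ** q) = 1" using p(1) by (simp add: det_mul q_def)
      show "sl2_inv (p ** q) ** M ** (p ** q) = mk l 0 0 m"
        unfolding C e using assms(4) by (simp add: q_def field_simps)
    qed
  next
    assume e: "sl2_inv p ** M ** p = mk m b 0 l"
    \<comment> \<open>The columns are eigenvectors for \<open>l\<close> and \<open>m\<close> in this
      order, so the diagonal entries also change places.\<close>
    define q where "q = mk (b / (l - m)) (-1) 1 0"
    show ?thesis
    proof (rule that)
      show "det (p ** q) = 1" using p(1) by (simp add: det_mul q_def)
      show "sl2_inv (p ** q) ** M ** (p ** q) = mk l 0 0 m"
        unfolding C e using assms(4) by (simp add: q_def field_simps)
    qed
  qed
qed

subsection \<open>Nonelementary groups contain loxodromic elements\<close>

definition mgrp :: "mat2 set \<Rightarrow> bool" where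
  "mgrp P \<longleftrightarrow> mat 1 \<in> P \<and> (\<forall>g\<in>P. det g = 1 \<and> sl2_inv g \<in> P) \<and> (\<forall>g\<in>P. \<forall>h\<in>P. g ** h \<in> P)"

lemma cline_scale: "k \<noteq> 0 \<Longrightarrow> cline (k *s v) = cline v"
  unfolding cline_def
  apply (auto simp: vector_smult_assoc)
  by (metis divide_self_if nonzero_mult_div_cancel_right times_divide_eq_left vector_smult_assoc mult.commute)

lemma cline_mulv: "cline (M *v v) = (\<lambda>w. M *v w) ` cline v" for M :: mat2
  unfolding cline_def by (auto simp: vector_scalar_commute image_iff) (metis vector_scalar_commute)

abbreviation e1 :: "complex^2" where "e1 \<equiv> (\<chi> i. if i = 1 then 1 else 0)"
abbreviation e2 :: "complex^2" where "e2 \<equiv> (\<chi> i. if i = 1 then 0 else 1)"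

lemma mulv_nonzero:
  assumes "det (M :: mat2) = 1" "v \<noteq> 0"
  shows "M *v v \<noteq> 0"
  by (metis assms matrix_vector_mul_assoc matrix_vector_mul_lid matrix_vector_mult_0_right sl2_inv_left)

text \<open>Otherwise every image of the line through \<open>Q *v v\<close> would be one of the two
  lines through \<open>Q *v e1\<close> and \<open>Q *v e2\<close>, a finite orbit on the
  boundary.\<close>

lemma nonelementary_conj_entry:
  assumes P: "nonelementary P" and G: "mgrp P" and Q: "det Q = 1" and v: "v = e1 \<or> v = e2"
  obtains h where "h \<in> P" "((sl2_inv Q ** h ** Q) *v v) $ 1 \<noteq> 0" "((sl2_inv Q ** h ** Q) *v v) $ 2 \<noteq> 0"
proof (rule ccontr)
  assume "\<not> thesis"
  with that have A: "((sl2_inv Q ** h ** Q) *v v) $ 1 = 0 \<or> ((sl2_inv Q ** h ** Q) *v v) $ 2 = 0"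
    if "h \<in> P" for h using that by blast
  have v0: "v \<noteq> 0" using v by (auto simp: vec_eq_iff forall_2)
  have "cline (h *v (Q *v v)) \<in> {cline (Q *v e1), cline (Q *v e2)}" if h: "h \<in> P" for h
  proof -
    define w where "w = (sl2_inv Q ** h ** Q) *v v"
    have w: "Q *v w = h *v (Q *v v)"
      unfolding w_def by (metis Q matrix_mul_assoc matrix_mul_lid matrix_vector_mul_assoc sl2_inv_right)
    have "det h = 1" using G h by (simp add: mgrp_def)
    then have w0: "w \<noteq> 0" unfolding w_def using Q v0 by (intro mulv_nonzero) (auto simp: det_mul)
      have "w = (w$1) *s e1 \<or> w = (w$2) *s e2"
        using A[OF h] unfolding w_def[symmetric] by (auto simp: vec_eq_iff forall_2)
      then have "(w$1 \<noteq> 0 \<and> w = (w$1) *s e1) \<or> (w$2 \<noteq> 0 \<and> w = (w$2) *s e2)"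
        using w0 by (metis vector_smult_lzero)
      then have "cline w = cline e1 \<or> cline w = cline e2" using cline_scale by metis
      then show ?thesis unfolding w[symmetric] cline_mulv by auto
  qed
  then have "(\<lambda>h. cline (h *v (Q *v v))) ` P \<subseteq> {cline (Q *v e1), cline (Q *v e2)}" by blast
  then have "finite ((\<lambda>h. cline (h *v (Q *v v))) ` P)" by (rule finite_subset) auto
  moreover have "Q *v v \<noteq> 0" using Q v0 by (rule mulv_nonzero)
  ultimately show False using P unfolding nonelementary_def by blast
qed

lemma conj_mgrp:
  assumes "mgrp P" "det Q = 1"
  shows "mgrp ((\<lambda>h. sl2_inv Q ** h ** Q) ` P)"
proof -
  have "sl2_inv Q ** g ** Q ** (sl2_inv Q ** h ** Q) = sl2_inv Q ** (g ** h) ** Q" for g h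
    by (metis assms(2) matrix_mul_assoc matrix_mul_rid sl2_inv_right)
  moreover have "sl2_inv (sl2_inv Q ** g ** Q) = sl2_inv Q ** sl2_inv g ** Q" for g
    by (simp add: sl2_inv_mult matrix_mul_assoc)
  moreover have "mat 1 \<in> (\<lambda>h. sl2_inv Q ** h ** Q) ` P"
    by (rule image_eqI[where x = "mat 1"]) (use assms in \<open>auto simp: sl2_inv_left mgrp_def\<close>)
  ultimately show ?thesis using assms unfolding mgrp_def
    by (auto simp: det_mul)
qed

text \<open>One element has a first column without zeros, another one a second column without zeros.
  One of the two, the inverse of the second or their product has the required entries.\<close>

lemma nonelementary_generic:
  assumes P: "nonelementary P" and G: "mgrp P" and Q: "det Q = 1"
  obtains h a b c d where "h \<in> P" "sl2_inv Q ** h ** Q = mk a b c d" "a \<noteq> 0" "b \<noteq> 0" "c \<noteq> 0"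
proof -
  obtain h where h: "h \<in> P" "((sl2_inv Q ** h ** Q) *v e1) $ 1 \<noteq> 0" "((sl2_inv Q ** h ** Q) *v e1) $ 2 \<noteq> 0"
    using nonelementary_conj_entry[OF P G Q] by blast
  obtain k where k: "k \<in> P" "((sl2_inv Q ** k ** Q) *v e2) $ 1 \<noteq> 0" "((sl2_inv Q ** k ** Q) *v e2) $ 2 \<noteq> 0"
    using nonelementary_conj_entry[OF P G Q] by blast
  obtain a b c d where H: "sl2_inv Q ** h ** Q = mk a b c d" by (rule mk_cases)
  obtain a' b' c' d' where K: "sl2_inv Q ** k ** Q = mk a' b' c' d'" by (rule mk_cases)
  have ac: "a \<noteq> 0" "c \<noteq> 0" using h H by auto
  have bd: "b' \<noteq> 0" "d' \<noteq> 0" using k K by auto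
  show ?thesis
  proof (cases "b = 0")
    case False
    then show ?thesis using that h H ac by blast
  next
    case b: True
    show ?thesis
    proof (cases "c' = 0")
      case True
      have "sl2_inv Q ** (h ** k) ** Q = (sl2_inv Q ** h ** Q) ** (sl2_inv Q ** k ** Q)"
        by (metis Q matrix_mul_assoc matrix_mul_rid sl2_inv_right)
      then have "sl2_inv Q ** (h ** k) ** Q = mk (a*a') (a*b') (c*a') (c*b' + d*d')"
        using H K b True by simp
      moreover have "a' \<noteq> 0"
      proof -
        have "det (sl2_inv Q ** k ** Q) = 1" using Q G k by (simp add: det_mul mgrp_def)
        then show ?thesis using True K by auto
      qed
      moreover have "h ** k \<in> P" using G h k by (simp add: mgrp_def)
      ultimately show ?thesis using that ac bd by (metis mult_eq_0_iff)
    next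
      case c': False
      show ?thesis
      proof (cases "a' = 0")
        case False
        then show ?thesis using that k K bd c' by blast
      next
        case True
        have "sl2_inv Q ** sl2_inv k ** Q = sl2_inv (sl2_inv Q ** k ** Q)"
          by (simp add: sl2_inv_mult matrix_mul_assoc)
        then have "sl2_inv Q ** sl2_inv k ** Q = mk d' (-b') (-c') a'" using K by simp
        moreover have "sl2_inv k \<in> P" using G k by (simp add: mgrp_def)
        ultimately show ?thesis using that bd c' by (metis neg_equal_0_iff_equal)
      qed
    qed
  qed
qed

lemma fixed_point_elementary:
  assumes "det Q = 1" "X \<in> H3" "\<And>h. h \<in> P \<Longrightarrow> actH (sl2_inv Q ** h ** Q) X = X"
  shows "\<not> nonelementary P"
proof -
  have "actH h (actH Q X) = actH Q X" if "h \<in> P" for h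
  proof -
    have "actH h (actH Q X) = actH Q (actH (sl2_inv Q ** h ** Q) X)"
      unfolding actH_mult[symmetric] by (metis assms(1) matrix_mul_assoc matrix_mul_lid sl2_inv_right)
    then show ?thesis using assms(3) that by simp
  qed
  then have "(\<lambda>h. actH h (actH Q X)) ` P \<subseteq> {actH Q X}" by auto
  then have "finite ((\<lambda>h. actH h (actH Q X)) ` P)" by (rule finite_subset) simp
  moreover have "actH Q X \<in> H3" using assms actH_in_H3 by blast
  ultimately show ?thesis unfolding nonelementary_def by blast
qed

text \<open>Without loxodromic elements all traces lie in [-2, 2]. If some element is elliptic,
  reality of traces confines the group, after conjugation, to the unitary group of a Hermitian form:
  a definite form yields a fixed point, an indefinite one a commutator of trace above 2. If all
  traces are 2 or -2, a parabolic element forces a common fixed point on the boundary.\<close>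

theorem nonelementary_loxodromic:
  assumes P: "nonelementary P" and G: "mgrp P"
  obtains g where "g \<in> P" "tlen g > 0"
proof (rule ccontr)
  assume "\<not> thesis"
  with that have "\<not> tlen g > 0" if "g \<in> P" for g using that by blast
  then have T: "Im (trace g) = 0" "\<bar>Re (trace g)\<bar> \<le> 2" if "g \<in> P" for g
    using that tlen_nonneg[of g] tlen_eq_0_iff[of g] G by (auto simp: mgrp_def less_le)
  show False
  proof (cases "\<exists>g\<in>P. \<bar>Re (trace g)\<bar> < 2")
    case True
    then obtain g where g: "g \<in> P" "\<bar>Re (trace g)\<bar> < 2" by blast
    define x where "x = Re (trace g) / 2"
    define y where "y = sqrt (1 - x\<^sup>2)"
    have "x\<^sup>2 < 1" using g(2) by (simp add: x_def abs_square_less_1)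
    then have y: "y > 0" "x\<^sup>2 + y\<^sup>2 = 1" by (auto simp: y_def)
    define l where "l = Complex x y"
    have dg: "det g = 1" using G g by (simp add: mgrp_def)
    obtain Q where Q: "det Q = 1" "sl2_inv Q ** g ** Q = mk l 0 0 (cnj l)"
    proof (rule exists_diagonal[OF dg])
      show "trace g = l + cnj l" using T(1)[OF g(1)] by (simp add: l_def complex_eq_iff x_def)
      show "l * cnj l = 1" using y by (simp add: l_def complex_eq_iff power2_eq_square)
      show "l \<noteq> cnj l" using y by (simp add: l_def complex_eq_iff)
    qed
    define P' where "P' = (\<lambda>h. sl2_inv Q ** h ** Q) ` P"
    have G': "mgrp P'" unfolding P'_def by (rule conj_mgrp[OF G Q(1)])
    have mult: "\<And>h k. h \<in> P' \<Longrightarrow> k \<in> P' \<Longrightarrow> h ** k \<in> P'" and inv: "\<And>h. h \<in> P' \<Longrightarrow> sl2_inv h \<in> P'"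
      and dt: "\<And>h. h \<in> P' \<Longrightarrow> det h = 1" using G' by (auto simp: mgrp_def)
    have T': "Im (trace h) = 0" "\<bar>Re (trace h)\<bar> \<le> 2" if h: "h \<in> P'" for h
    proof -
      obtain k where "k \<in> P" "h = sl2_inv Q ** k ** Q" using h by (auto simp: P'_def)
      moreover have "trace h = trace k"
        using trace_conj[of "sl2_inv Q" k] Q(1) calculation by simp
      ultimately show "Im (trace h) = 0" "\<bar>Re (trace h)\<bar> \<le> 2" using T by auto
    qed
    have gP: "mk l 0 0 (cnj l) \<in> P'" using g Q by (force simp: P'_def)
    \<comment> \<open>The traces of \<open>h\<close> and of its product with the elliptic element
      are both real; since \<open>y \<noteq> 0\<close> these two equations determine
      \<open>d\<close>.\<close>
    have D: "d = cnj a" if h: "mk a b c d \<in> P'" for a b c d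
    proof -
      have 1: "Im (a + d) = 0" using T'(1)[OF h] by simp
      have "Im (l * a + cnj l * d) = 0" using T'(1)[OF mult[OF gP h]] by simp
      then have "x * (Im a + Im d) + y * (Re a - Re d) = 0" by (simp add: l_def algebra_simps)
      then have "Re a = Re d" using 1 y by simp
      then show ?thesis using 1 by (simp add: complex_eq_iff)
    qed
    obtain h0 a0 b0 c0 d0 where h0: "h0 \<in> P" "sl2_inv Q ** h0 ** Q = mk a0 b0 c0 d0" "a0 \<noteq> 0" "b0 \<noteq> 0" "c0 \<noteq> 0"
      using nonelementary_generic[OF P G Q(1)] by blast
    have h0': "mk a0 b0 c0 d0 \<in> P'" using h0 by (force simp: P'_def)
    \<comment> \<open>This is \<open>D\<close> for the product of the given element with
      \<open>h0\<close>.\<close>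
    have BC: "cnj (b * c0) = c * b0" if h: "mk a b c d \<in> P'" for a b c d
    proof -
      have "c * b0 + d * d0 = cnj (a * a0 + b * c0)"
        using D[of "a * a0 + b * c0" _ _ "c * b0 + d * d0"] mult[OF h h0'] by simp
      then show ?thesis using D[OF h] D[OF h0'] by simp
    qed
    have bc0: "b0 * c0 = of_real (Re (b0 * c0))" using BC[OF h0'] by (simp add: complex_eq_iff algebra_simps)
    \<comment> \<open>The common real ratio of \<open>c\<close> to \<open>cnj b\<close>. Its sign
      tells whether the preserved Hermitian form is indefinite or definite.\<close>
    define \<kappa> where "\<kappa> = Re (b0 * c0) / (cmod b0)\<^sup>2"
    have \<kappa>b: "of_real \<kappa> * b0 = cnj c0"
    proof -
      have "of_real \<kappa> * b0 * cnj b0 = cnj c0 * cnj b0"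
      proof -
        have "of_real \<kappa> * b0 * cnj b0 = of_real (\<kappa> * (cmod b0)\<^sup>2)"
          by (simp add: complex_norm_square[symmetric] mult.assoc)
        also have "\<kappa> * (cmod b0)\<^sup>2 = Re (b0 * c0)" using h0(4) by (simp add: \<kappa>_def)
        finally have "of_real \<kappa> * b0 * cnj b0 = b0 * c0" using bc0 by (simp only:)
        then show ?thesis using BC[OF h0'] by (metis complex_cnj_mult mult.commute)
      qed
      then show ?thesis using h0(4) by simp
    qed
    have \<kappa>0: "\<kappa> \<noteq> 0" using \<kappa>b h0(5) by auto
    have C: "c = of_real \<kappa> * cnj b" if h: "mk a b c d \<in> P'" for a b c d
    proof -
      have "c * b0 = cnj b * of_real \<kappa> * b0" using BC[OF h] \<kappa>b by (simp add: mult.assoc)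
      then show ?thesis using h0(4) by simp
    qed
    show False
    proof (cases "\<kappa> > 0")
      case True
      \<comment> \<open>The commutator of the elliptic element with \<open>h0\<close>; its trace
        exceeds 2 by \<open>4 * y\<^sup>2\<close> times the positive number
        \<open>b0 * c0\<close>.\<close>
      define u where "u = mk l 0 0 (cnj l) ** mk a0 b0 c0 d0 ** sl2_inv (mk l 0 0 (cnj l)) ** sl2_inv (mk a0 b0 c0 d0)"
      have uP: "u \<in> P'" unfolding u_def by (intro mult inv gP h0')
      have dd: "a0 * d0 - b0 * c0 = 1" using dt[OF h0'] by simp
      have ll: "l * cnj l = 1" using y by (simp add: l_def complex_eq_iff power2_eq_square)
      have "trace u = l * cnj l * 2 * (a0 * d0) - b0 * c0 * (l * l + cnj l * cnj l)"
        unfolding u_def by (simp add: algebra_simps)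
      also have "\<dots> = 2 + b0 * c0 * (2 - (l * l + cnj l * cnj l))" using ll dd by algebra
      also have "2 - (l * l + cnj l * cnj l) = of_real (4 * y\<^sup>2)"
        using y by (simp add: l_def complex_eq_iff power2_eq_square)
      finally have "trace u = 2 + b0 * c0 * of_real (4 * y\<^sup>2)" .
      then have "Re (trace u) = 2 + Re (b0 * c0) * (4 * y\<^sup>2)" by simp
      moreover have "Re (b0 * c0) > 0" using True h0(4) by (simp add: \<kappa>_def zero_less_divide_iff)
      ultimately have "Re (trace u) > 2" using y(1) by simp
      then show False using T'(2)[OF uP] by simp
    next
      case False
      then have neg: "\<kappa> < 0" using \<kappa>0 by simp
      define p where "p = sqrt (- \<kappa>)"
      have p: "p > 0" "p * p = - \<kappa>" using neg by (auto simp: p_def)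
      \<comment> \<open>The point of hyperbolic space belonging to the definite form, fixed by the
        whole conjugated group.\<close>
      define X where "X = mk (of_real (1 / p)) 0 (cnj 0) (of_real p)"
      have "\<not> nonelementary P"
      proof (rule fixed_point_elementary[OF Q(1)])
        show "X \<in> H3" unfolding X_def using p by (intro H3_I) auto
        fix h assume "h \<in> P"
        then have hP: "sl2_inv Q ** h ** Q \<in> P'" by (auto simp: P'_def)
        obtain a b c d where H: "sl2_inv Q ** h ** Q = mk a b c d" by (rule mk_cases)
        have h: "mk a b c d \<in> P'" using hP H by simp
        have d: "d = cnj a" and c: "c = of_real \<kappa> * cnj b" using D[OF h] C[OF h] by auto
        have k: "of_real \<kappa> = - (of_real p * of_real p :: complex)" using p(2) by (metis minus_minus of_real_minus of_real_mult)
        have e: "a * cnj a + of_real p * of_real p * b * cnj b = 1" using dt[OF h] d c k by (simp add: algebra_simps)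
        have xp: "of_real (1 / p) * of_real p = (1 :: complex)" using p by (simp flip: of_real_mult)
        show "actH (sl2_inv Q ** h ** Q) X = X"
          unfolding H X_def actH_def d c k
          unfolding mk_mult adj2_mk mk_eq_iff complex_cnj_minus complex_cnj_mult complex_cnj_complex_of_real complex_cnj_cnj complex_cnj_zero
          using xp e by (intro conjI; algebra)
      qed
      then show False using P by simp
    qed
  next
    case False
    then have T2: "trace g = 2 \<or> trace g = -2" if "g \<in> P" for g
    proof -
      have "\<bar>Re (trace g)\<bar> = 2" using T(2)[OF that] False that by force
      then have "Re (trace g) = 2 \<or> Re (trace g) = -2" by linarith
      then show ?thesis using T(1)[OF that] by (auto simp: complex_eq_iff)
    qed
    have "\<exists>g\<in>P. g \<noteq> mat 1 \<and> g \<noteq> - mat 1"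
    proof (rule ccontr)
      assume n: "\<not> (\<exists>g\<in>P. g \<noteq> mat 1 \<and> g \<noteq> - mat 1)"
      have "actH (sl2_inv (mat 1) ** h ** mat 1) (mk 1 0 0 1) = mk 1 0 0 1" if "h \<in> P" for h
      proof -
        have "h = mk 1 0 0 1 \<or> h = mk (-1) 0 0 (-1)" using n that by (auto simp: mat_mk)
        then show ?thesis by (auto simp: mat_mk actH_def)
      qed
      moreover have "mk 1 0 0 1 \<in> H3" by (simp add: H3_iff)
      ultimately show False using fixed_point_elementary[of "mat 1" "mk 1 0 0 1" P] P by (simp add: mat_mk)
    qed
    then obtain g where g: "g \<in> P" "g \<noteq> mat 1" "g \<noteq> - mat 1" by blast
    define \<epsilon> where "\<epsilon> = trace g / 2"
    have \<epsilon>: "\<epsilon> = 1 \<or> \<epsilon> = -1" using T2[OF g(1)] by (auto simp: \<epsilon>_def)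
    have dg: "det g = 1" using G g by (simp add: mgrp_def)
    obtain Q b where Q: "det Q = 1" "sl2_inv Q ** g ** Q = mk \<epsilon> b 0 \<epsilon>"
      by (rule exists_triangular[OF dg, of \<epsilon> \<epsilon>]) (use \<epsilon> in \<open>auto simp: \<epsilon>_def\<close>)
    have b0: "b \<noteq> 0"
    proof
      assume "b = 0"
      then have e: "sl2_inv Q ** g ** Q = mat \<epsilon>" using Q by (simp add: mat_mk)
      have c: "Q ** mat \<epsilon> = mat \<epsilon> ** Q" by (cases Q rule: mk_cases) (simp add: mat_mk mult.commute)
      have "g = (Q ** sl2_inv Q) ** g ** (Q ** sl2_inv Q)" using Q(1) by (simp add: sl2_inv_right)
      also have "\<dots> = Q ** (sl2_inv Q ** g ** Q) ** sl2_inv Q" by (simp add: matrix_mul_assoc)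
      also have "\<dots> = mat \<epsilon> ** (Q ** sl2_inv Q)" unfolding e c by (simp add: matrix_mul_assoc)
      finally have "g = mat \<epsilon>" using Q(1) by (simp add: sl2_inv_right)
      then show False using \<epsilon> g by (auto simp: mat_mk)
    qed
    define P' where "P' = (\<lambda>h. sl2_inv Q ** h ** Q) ` P"
    have G': "mgrp P'" unfolding P'_def by (rule conj_mgrp[OF G Q(1)])
    have mult: "\<And>h k. h \<in> P' \<Longrightarrow> k \<in> P' \<Longrightarrow> h ** k \<in> P'" using G' by (auto simp: mgrp_def)
    have T': "trace h = 2 \<or> trace h = -2" if h: "h \<in> P'" for h
    proof -
      obtain k where "k \<in> P" "h = sl2_inv Q ** k ** Q" using h by (auto simp: P'_def)
      then show ?thesis using T2[of k] trace_conj[of "sl2_inv Q" k] Q(1) by simp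
    qed
    have gP: "mk \<epsilon> b 0 \<epsilon> \<in> P'" using g Q by (force simp: P'_def)
    obtain h a' b' c' d' where h: "h \<in> P" "sl2_inv Q ** h ** Q = mk a' b' c' d'" "c' \<noteq> 0"
      by (rule nonelementary_generic[OF P G Q(1)])
    have hP: "mk a' b' c' d' \<in> P'" using h by (force simp: P'_def)
    \<comment> \<open>Even powers of the parabolic element remove the sign
      \<open>\<epsilon>\<close>. The traces for the exponents 0, 2, 4 are in arithmetic progression
      with values 2 or -2, hence constant, so \<open>u = 0\<close>.\<close>
    have hP2: "mk \<epsilon> b 0 \<epsilon> ** (mk \<epsilon> b 0 \<epsilon> ** mk a' b' c' d') \<in> P'" by (intro mult gP hP)
    have hP4: "mk \<epsilon> b 0 \<epsilon> ** (mk \<epsilon> b 0 \<epsilon> ** (mk \<epsilon> b 0 \<epsilon> ** (mk \<epsilon> b 0 \<epsilon> ** mk a' b' c' d'))) \<in> P'" by (intro mult gP hP)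
    define u where "u = 2 * \<epsilon> * b * c'"
    have "\<epsilon> * \<epsilon> = 1" using \<epsilon> by auto
    have t0: "a' + d' = 2 \<or> a' + d' = -2" using T'[OF hP] by simp
    have t2: "a' + d' + u = 2 \<or> a' + d' + u = -2"
    proof -
      have "trace (mk \<epsilon> b 0 \<epsilon> ** (mk \<epsilon> b 0 \<epsilon> ** mk a' b' c' d')) = \<epsilon> * \<epsilon> * (a' + d') + u"
        by (simp add: u_def algebra_simps)
      then show ?thesis using T'[OF hP2] \<open>\<epsilon> * \<epsilon> = 1\<close> by simp
    qed
    have t4: "a' + d' + 2 * u = 2 \<or> a' + d' + 2 * u = -2"
    proof -
      have "trace (mk \<epsilon> b 0 \<epsilon> ** (mk \<epsilon> b 0 \<epsilon> ** (mk \<epsilon> b 0 \<epsilon> ** (mk \<epsilon> b 0 \<epsilon> ** mk a' b' c' d'))))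
        = (\<epsilon> * \<epsilon>) * (\<epsilon> * \<epsilon>) * (a' + d') + (\<epsilon> * \<epsilon>) * (2 * u)"
        by (simp add: u_def algebra_simps)
      then show ?thesis using T'[OF hP4] \<open>\<epsilon> * \<epsilon> = 1\<close> by simp
    qed
    have "u = 0"     proof -
      define s0 s2 s4 where s: "s0 = a' + d'" "s2 = a' + d' + u" "s4 = a' + d' + 2 * u"
      have "s4 = 2 * s2 - s0" by (simp add: s)
      moreover have "s0 = 2 \<or> s0 = -2" "s2 = 2 \<or> s2 = -2" "s4 = 2 \<or> s4 = -2"
        unfolding s by (fact t0 t2 t4)+
      ultimately have "s2 = s0" by (elim disjE) simp_all
      then show ?thesis by (simp add: s)
    qed
    then show False using \<epsilon> b0 h(3) by (auto simp: u_def)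
  qed
qed

subsection \<open>Rigidity of proportional length spectra\<close>

text \<open>Dirichlet approximation with bound 6 brings the argument of some power within pi/3 of 0
  modulo 2 pi. It is applied to \<open>w ^ N\<close> to make the exponent at least
  \<open>N\<close>.\<close>

lemma unit_power_recurrence:
  assumes "cmod w = 1" "N > 0"
  obtains n where "n \<ge> N" "Re (w ^ n) \<ge> 1 / 2"
proof -
  define \<theta> where "\<theta> = Arg (w ^ N) / (2 * pi)"
  obtain h k where hk: "0 < k" "k \<le> int 6" "\<bar>of_int k * \<theta> - of_int h\<bar> < 1 / real 6"
    by (rule Dirichlet_approx[of 6 \<theta>]) auto
  define n where "n = nat k"
  have k: "k = int n" "n > 0" using hk by (auto simp: n_def)
  have "w ^ N = cis (2 * pi * \<theta>)"
  proof -
    have "w ^ N \<noteq> 0" using assms by auto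
    then show ?thesis using assms Arg_eq[of "w ^ N"] by (simp add: \<theta>_def norm_power cis_conv_exp)
  qed
  then have "w ^ (N * n) = cis (2 * pi * (n * \<theta>))"
    using Complex.DeMoivre[of "2 * pi * \<theta>" n] by (simp add: power_mult mult_ac)
  then have "Re (w ^ (N * n)) = cos (2 * pi * (n * \<theta>))" by simp
  also have "\<dots> = cos (2 * pi * (n * \<theta>) - 2 * pi * of_int h)"
    by (simp add: cos_diff)
  also have "\<dots> = cos \<bar>2 * pi * (n * \<theta> - of_int h)\<bar>" by (simp add: algebra_simps)
  also have "\<dots> \<ge> cos (pi / 3)"
  proof (rule cos_monotone_0_pi_le)
    have "2 * pi * \<bar>n * \<theta> - of_int h\<bar> \<le> 2 * pi * (1 / 6)" using hk(3) k by (intro mult_left_mono) auto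
    then show "\<bar>2 * pi * (n * \<theta> - of_int h)\<bar> \<le> pi / 3" by (simp add: abs_mult)
  qed auto
  finally have "Re (w ^ (N * n)) \<ge> 1 / 2" by (simp add: cos_60)
  moreover have "N * n \<ge> N" using k by simp
  ultimately show ?thesis using that by blast
qed

lemma powr_pow: "0 < (x :: real) \<Longrightarrow> (x powr k) ^ n = (x ^ n) powr k"
  by (simp flip: powr_realpow add: powr_powr mult.commute)

text \<open>Along the powers of \<open>\<mu>\<close> that are nearly positive, \<open>\<bar>1 - \<mu>\<^sup>n\<bar>\<close> drops below 1 at the rate
  \<open>\<bar>\<mu>\<bar>\<^sup>n\<close>, which for an exponent above 1 is too much for \<open>\<bar>1 - \<nu>\<^sup>n\<bar>\<close>.\<close>
lemma exponent_le_1: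
  assumes \<mu>: "0 < cmod \<mu>" "cmod \<mu> < 1" and \<nu>: "cmod \<nu> = cmod \<mu> powr \<kappa>" and \<kappa>0: "\<kappa> > 0"
    and eq: "\<And>n. cmod (1 - \<nu> ^ n) = cmod (1 - \<mu> ^ n) powr \<kappa>"
  shows "\<kappa> \<le> 1"
proof (rule ccontr)
  assume "\<not> \<kappa> \<le> 1"
  then have \<kappa>: "\<kappa> > 1" by simp
  define \<rho> where "\<rho> = cmod \<mu>"
  have "(\<lambda>n. \<rho> ^ n) \<longlonglongrightarrow> 0" using \<mu> by (intro LIMSEQ_realpow_zero) (auto simp: \<rho>_def)
  moreover have "(\<lambda>n. (\<rho> powr (\<kappa> - 1)) ^ n) \<longlonglongrightarrow> 0"
  proof (intro LIMSEQ_realpow_zero)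
    have "\<rho> powr (\<kappa> - 1) < 1 powr (\<kappa> - 1)" using \<mu> \<kappa> by (intro powr_less_mono2) (auto simp: \<rho>_def)
    then show "\<rho> powr (\<kappa> - 1) < 1" by simp
  qed auto
  \<comment> \<open>The first bound turns \<open>1 - r + r\<^sup>2\<close> into at most
    \<open>(1 - r / 4)\<^sup>2\<close>; the second one is what the final inequality
    \<open>1 / 4 \<le> r powr (\<kappa> - 1)\<close> contradicts.\<close>
  ultimately have "\<forall>\<^sub>F n in sequentially. \<rho> ^ n < 1 / 4 \<and> (\<rho> powr (\<kappa> - 1)) ^ n < 1 / 4"
    by (intro eventually_conj order_tendstoD(2)[where a = "1 / 4"]) auto
  then obtain N0 where N0: "\<And>n. n \<ge> N0 \<Longrightarrow> \<rho> ^ n < 1 / 4 \<and> (\<rho> powr (\<kappa> - 1)) ^ n < 1 / 4"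
    by (auto simp: eventually_sequentially)
  define w where "w = \<mu> / of_real \<rho>"
  have \<rho>: "\<rho> > 0" using \<mu> by (simp add: \<rho>_def)
  have "cmod w = 1" using \<mu> by (simp add: w_def \<rho>_def norm_divide)
  then obtain n where n: "n \<ge> Suc N0" "Re (w ^ n) \<ge> 1 / 2"
    by (rule unit_power_recurrence[of w "Suc N0"]) auto
  define r where "r = \<rho> ^ n"
  have r: "0 < r" "r < 1 / 4" "(\<rho> powr (\<kappa> - 1)) ^ n < 1 / 4" using N0[of n] n \<rho> by (auto simp: r_def)
  have rk1: "(\<rho> powr (\<kappa> - 1)) ^ n = r powr (\<kappa> - 1)"
    using \<rho> by (simp add: r_def powr_pow)
  have rk: "r powr \<kappa> = r * r powr (\<kappa> - 1)" using r by (simp add: powr_diff)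
  have "\<mu> ^ n = of_real r * w ^ n" using \<rho> by (simp add: w_def r_def power_divide)
  then have "Re (\<mu> ^ n) = r * Re (w ^ n)" by simp
  then have re: "Re (\<mu> ^ n) \<ge> r / 2" using n(2) r(1) mult_left_mono[of "1/2" "Re (w ^ n)" r] by simp
  have cm: "cmod (\<mu> ^ n) = r" by (simp add: norm_power r_def \<rho>_def)
  have sq: "(cmod (1 - \<mu> ^ n))\<^sup>2 \<le> 1 - r + r\<^sup>2"
  proof -
    have "(cmod (1 - \<mu> ^ n))\<^sup>2 = 1 - 2 * Re (\<mu> ^ n) + (cmod (\<mu> ^ n))\<^sup>2"
      unfolding cmod_power2 by (simp add: power2_eq_square algebra_simps)
    then show ?thesis using re cm by simp
  qed
  have "(cmod (1 - \<mu> ^ n))\<^sup>2 \<le> (1 - r / 4)\<^sup>2"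
  proof -
    have "r * r \<le> r * (1/4)" using r by (intro mult_left_mono) auto
    moreover have "(1 - r / 4)\<^sup>2 = 1 - r / 2 + r * r / 16" by (simp add: power2_eq_square algebra_simps)
    ultimately show ?thesis using sq r(1) unfolding power2_eq_square[of r] by linarith
  qed
  then have le: "cmod (1 - \<mu> ^ n) \<le> 1 - r / 4" by (rule power2_le_imp_le) (use r(2) in simp)
  have "cmod (1 - \<mu> ^ n) powr \<kappa> \<le> (1 - r / 4) powr \<kappa>" using le \<kappa>0 by (intro powr_mono2) auto
  also have "\<dots> \<le> (1 - r / 4) powr 1" using r \<kappa> by (intro powr_mono') auto
  finally have up: "cmod (1 - \<nu> ^ n) \<le> 1 - r / 4" using r by (simp add: eq)
  have "cmod (\<nu> ^ n) = r powr \<kappa>"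
    using \<rho> by (simp add: norm_power \<nu> r_def \<rho>_def[symmetric] powr_pow)
  then have "1 - r powr \<kappa> \<le> cmod (1 - \<nu> ^ n)" by (metis norm_one norm_triangle_ineq2)
  then have "r * (1 / 4) \<le> r * r powr (\<kappa> - 1)" using up rk by simp
  then have "1 / 4 \<le> r powr (\<kappa> - 1)" using r(1) by (simp only: mult_le_cancel_left_pos)
  then show False using r rk1 by simp
qed

text \<open>Circles about 0 and 1 meet in a pair of conjugate points.\<close>

lemma eq_or_cnj:
  assumes "cmod X = cmod x" "cmod (X - 1) = cmod (x - 1)"
  shows "X = x \<or> X = cnj x"
proof -
  have 1: "(cmod X)\<^sup>2 = (cmod x)\<^sup>2" "(cmod (X - 1))\<^sup>2 = (cmod (x - 1))\<^sup>2" using assms by simp_all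
  then have "Re X = Re x" unfolding cmod_power2 by (simp add: power2_eq_square algebra_simps)
  moreover from this have "(Im X)\<^sup>2 = (Im x)\<^sup>2" using 1(1) by (simp add: cmod_power2)
  then have "Im X = Im x \<or> Im X = - Im x" by (simp add: power2_eq_iff)
  ultimately show ?thesis by (auto simp: complex_eq_iff)
qed

definition cnjm :: "mat2 \<Rightarrow> mat2" where
  "cnjm M = (\<chi> i k. cnj (M$i$k))"

lemma cnjm_mk [simp]: "cnjm (mk a b c d) = mk (cnj a) (cnj b) (cnj c) (cnj d)"
  by (simp add: mat2_eq_iff cnjm_def)

text \<open>Subgroups of SL(2,C) x SL(2,C), applied to the image of a group under two of its
  coordinate projections.\<close>

definition mgrp2 :: "(mat2 \<times> mat2) set \<Rightarrow> bool" where
  "mgrp2 S \<longleftrightarrow> (mat 1, mat 1) \<in> S \<and>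
     (\<forall>(x,y)\<in>S. det x = 1 \<and> det y = 1 \<and> (sl2_inv x, sl2_inv y) \<in> S) \<and>
     (\<forall>(x,y)\<in>S. \<forall>(x',y')\<in>S. (x ** x', y ** y') \<in> S)"

lemma mgrp2D:
  assumes "mgrp2 S"
  shows "(mat 1, mat 1) \<in> S" "(x,y) \<in> S \<Longrightarrow> det x = 1" "(x,y) \<in> S \<Longrightarrow> det y = 1"
    "(x,y) \<in> S \<Longrightarrow> (sl2_inv x, sl2_inv y) \<in> S"
    "(x,y) \<in> S \<Longrightarrow> (x',y') \<in> S \<Longrightarrow> (x ** x', y ** y') \<in> S"
  using assms unfolding mgrp2_def by blast+

lemma norm_inverse_ratio:
  fixes l m :: complex
  assumes "l * m = 1" "cmod l > 1"
  shows "cmod (m / l) = inverse ((cmod l)\<^sup>2)" "cmod (m / l) < 1" "m / l \<noteq> 0"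
proof -
  have l0: "l \<noteq> 0" using assms by auto
  then have "m = inverse l" using assms by (simp add: field_simps)
  then show 1: "cmod (m / l) = inverse ((cmod l)\<^sup>2)"
    by (simp add: norm_divide norm_inverse norm_mult divide_inverse power2_eq_square)
  have "(cmod l)\<^sup>2 > 1" using assms(2) by (simp add: one_less_power)
  then show "cmod (m / l) < 1" unfolding 1 by (rule inverse_less_1_iff[THEN iffD2, OF disjI2])
  show "m / l \<noteq> 0" using assms l0 by auto
qed

lemma mgrp2_image:
  assumes S: "mgrp2 S"
    and "f (mat 1) = mat 1" "\<And>x y. f (x ** y) = f x ** f y" "\<And>x. f (sl2_inv x) = sl2_inv (f x)" "\<And>x. det x = 1 \<Longrightarrow> det (f x) = 1"
    and "h (mat 1) = mat 1" "\<And>x y. h (x ** y) = h x ** h y" "\<And>x. h (sl2_inv x) = sl2_inv (h x)" "\<And>x. det x = 1 \<Longrightarrow> det (h x) = 1"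
  shows "mgrp2 ((\<lambda>(x, y). (f x, h y)) ` S)"
proof -
  define T where "T = (\<lambda>(x, y). (f x, h y)) ` S"
  have I: "(f x, h y) \<in> T" if "(x, y) \<in> S" for x y using that by (force simp: T_def)
  have E: "\<exists>u v. (u, v) \<in> S \<and> x = f u \<and> y = h v" if "(x, y) \<in> T" for x y using that by (auto simp: T_def)
  have "(mat 1, mat 1) \<in> T" using I[OF mgrp2D(1)[OF S]] assms by simp
  moreover have "det x = 1 \<and> det y = 1 \<and> (sl2_inv x, sl2_inv y) \<in> T" if xy: "(x, y) \<in> T" for x y
  proof -
    obtain u v where uv: "(u, v) \<in> S" "x = f u" "y = h v" using E[OF xy] by blast
    show ?thesis using mgrp2D(2-3)[OF S uv(1)] I[OF mgrp2D(4)[OF S uv(1)]] assms by (simp add: uv(2,3))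
  qed
  moreover have "(x ** x', y ** y') \<in> T" if xy: "(x, y) \<in> T" "(x', y') \<in> T" for x y x' y'
  proof -
    obtain u v where uv: "(u, v) \<in> S" "x = f u" "y = h v" using E[OF xy(1)] by blast
    obtain u' v' where uv': "(u', v') \<in> S" "x' = f u'" "y' = h v'" using E[OF xy(2)] by blast
    show ?thesis using I[OF mgrp2D(5)[OF S uv(1) uv'(1)]] assms(3,7) by (simp add: uv(2,3) uv'(2,3))
  qed
  ultimately have "mgrp2 T" unfolding mgrp2_def by auto
  then show ?thesis by (simp add: T_def)
qed

text \<open>The term \<open>l ^ n * a\<close> dominates the trace, and the error of at most 1
  between trace and exponentiated length vanishes after division by
  \<open>cmod l ^ n\<close>.\<close>

lemma exp_tlen_asymptotics:
  assumes "l * m = 1" "cmod l > 1" "\<And>n. det (M n) = 1" "\<And>n. trace (M n) = l ^ n * a + m ^ n * d"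
  shows "(\<lambda>n. exp (tlen (M n) / 2) / cmod l ^ n) \<longlonglongrightarrow> cmod a"
proof -
  have l0: "l \<noteq> 0" using assms(2) by auto
  note ml = norm_inverse_ratio(2)[OF assms(1,2)]
  have "(\<lambda>n. cmod (a + (m / l) ^ n * d)) \<longlonglongrightarrow> cmod (a + 0 * d)"
    using ml by (intro tendsto_norm tendsto_add tendsto_mult tendsto_const LIMSEQ_power_zero) auto
  then have 1: "(\<lambda>n. cmod (trace (M n)) / cmod l ^ n) \<longlonglongrightarrow> cmod a"
  proof -
    have "cmod (a + (m / l) ^ n * d) = cmod (trace (M n)) / cmod l ^ n" for n
    proof -
      have "a + (m / l) ^ n * d = trace (M n) / l ^ n"
        using l0 by (simp add: assms(4) field_simps)
      then show ?thesis by (simp add: norm_divide norm_power)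
    qed
    then show ?thesis using \<open>_ \<longlonglongrightarrow> cmod (a + 0 * d)\<close> by simp
  qed
  have "(\<lambda>n. 1 / cmod l ^ n) \<longlonglongrightarrow> 0"
    using LIMSEQ_inverse_realpow_zero[OF assms(2)] by (simp add: divide_inverse)
  then have 2: "(\<lambda>n. exp (tlen (M n) / 2) / cmod l ^ n - cmod (trace (M n)) / cmod l ^ n) \<longlonglongrightarrow> 0"
  proof (rule Lim_null_comparison[rotated])
    show "\<forall>\<^sub>F n in sequentially. norm (exp (tlen (M n) / 2) / cmod l ^ n - cmod (trace (M n)) / cmod l ^ n) \<le> 1 / cmod l ^ n"
      using trace_near_exp_tlen[OF assms(3)] l0
      by (intro always_eventually allI) (simp add: diff_divide_distrib[symmetric] divide_right_mono)
  qed
  show ?thesis using tendsto_add[OF 2 1] by simp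
qed

text \<open>The two coordinates are conjugated separately, so that one pair of loxodromic elements
  is diagonal in both.\<close>

locale length_pair =
  fixes S :: "(mat2 \<times> mat2) set" and \<kappa> :: real and l m l' m' :: complex
  assumes S: "mgrp2 S" and \<kappa>: "\<kappa> > 0"
    and len: "\<And>x y. (x, y) \<in> S \<Longrightarrow> tlen y = \<kappa> * tlen x"
    and lm: "l * m = 1" "l' * m' = 1" and l: "cmod l > 1" "cmod l' > 1"
    and g: "(mk l 0 0 m, mk l' 0 0 m') \<in> S"
begin

lemma g_pow: "(mk (l ^ n) 0 0 (m ^ n), mk (l' ^ n) 0 0 (m' ^ n)) \<in> S"
proof (induction n)
  case 0
  then show ?case using mgrp2D(1)[OF S] by (simp add: mat_mk)
next
  case (Suc n)
  then show ?case using mgrp2D(5)[OF S g Suc] by simp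
qed

lemma norm_l': "cmod l' = cmod l powr \<kappa>"
proof -
  have "tlen (mk l 0 0 m) = 2 * ln (cmod l)" "tlen (mk l' 0 0 m') = 2 * ln (cmod l')"
    by (rule tlen_eq_ln; use lm l in simp)+
  then have "ln (cmod l') = \<kappa> * ln (cmod l)" using len[OF g] by simp
  then show ?thesis using l by (simp add: powr_def)
    (metis exp_ln less_trans mult.commute zero_less_one zero_less_norm_iff norm_eq_zero)
qed

lemma norm_l'_pow: "cmod l' ^ n = (cmod l ^ n) powr \<kappa>"
  unfolding norm_l' using l by (intro powr_pow) linarith

text \<open>The lengths of \<open>g ^ n h\<close> reveal the absolute value of the upper left entry
  of \<open>h\<close> in the limit; proportional lengths become a power law with exponent
  \<open>\<kappa>\<close>.\<close>

lemma entry_a: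
  assumes h: "(mk a b c d, mk A B C D) \<in> S"
  shows "cmod A = cmod a powr \<kappa>"
proof -
  define x where "x n = exp (tlen (mk (l ^ n) 0 0 (m ^ n) ** mk a b c d) / 2) / cmod l ^ n" for n
  define y where "y n = exp (tlen (mk (l' ^ n) 0 0 (m' ^ n) ** mk A B C D) / 2) / cmod l' ^ n" for n
  have in_S: "(mk (l ^ n) 0 0 (m ^ n) ** mk a b c d, mk (l' ^ n) 0 0 (m' ^ n) ** mk A B C D) \<in> S" for n
    by (rule mgrp2D(5)[OF S g_pow h])
  have x: "x \<longlonglongrightarrow> cmod a" unfolding x_def
    by (rule exp_tlen_asymptotics[OF lm(1) l(1)]) (use mgrp2D(2)[OF S in_S] in auto)
  have y: "y \<longlonglongrightarrow> cmod A" unfolding y_def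
    by (rule exp_tlen_asymptotics[OF lm(2) l(2)]) (use mgrp2D(3)[OF S in_S] in auto)
  have x0: "x n \<ge> 0" for n by (simp add: x_def)
  have "y n = x n powr \<kappa>" for n
    unfolding x_def y_def len[OF in_S] norm_l'_pow by (simp add: powr_divide exp_powr_real mult_ac)
  moreover have "(\<lambda>n. x n powr \<kappa>) \<longlonglongrightarrow> cmod a powr \<kappa>"
    by (rule tendsto_powr'[OF x tendsto_const]) (use x0 \<kappa> in auto)
  ultimately have "y \<longlonglongrightarrow> cmod a powr \<kappa>" by presburger
  then show ?thesis using y LIMSEQ_unique by blast
qed

text \<open>By \<open>entry_a\<close> for \<open>h\<close>, the inverse of \<open>g ^ n\<close> and
  \<open>k\<close> multiplied in this order: in the upper left entry
  \<open>m ^ n * (a * a') + l ^ n * (b * c')\<close> the second term wins. Only a product of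
  off-diagonal entries can be seen, since diagonal conjugation rescales the factors.\<close>

lemma entry_bc:
  assumes h: "(mk a b c d, mk A B C D) \<in> S" and k: "(mk a' b' c' d', mk A' B' C' D') \<in> S"
  shows "cmod (B * C') = cmod (b * c') powr \<kappa>"
proof -
  have inv: "(mk (m ^ n) 0 0 (l ^ n), mk (m' ^ n) 0 0 (l' ^ n)) \<in> S" for n
    using mgrp2D(4)[OF S g_pow[of n]] by simp
  have 1: "cmod (m' ^ n * (A * A') + l' ^ n * (B * C')) = cmod (m ^ n * (a * a') + l ^ n * (b * c')) powr \<kappa>" for n
    using entry_a[of "m ^ n * (a * a') + l ^ n * (b * c')" _ _ _ "m' ^ n * (A * A') + l' ^ n * (B * C')"]
      mgrp2D(5)[OF S mgrp2D(5)[OF S h inv[of n]] k] by (simp add: mult_ac)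
  have lim: "(\<lambda>n. cmod (m ^ n * u + l ^ n * v) / cmod l ^ n) \<longlonglongrightarrow> cmod v"
    if "l * m = 1" "cmod l > 1" for l m u v :: complex
  proof -
    have l0: "l \<noteq> 0" using that by auto
    note ml = norm_inverse_ratio(2)[OF that]
    have "(\<lambda>n. cmod ((m / l) ^ n * u + v)) \<longlonglongrightarrow> cmod (0 * u + v)"
      using ml by (intro tendsto_norm tendsto_add tendsto_mult tendsto_const LIMSEQ_power_zero) auto
    moreover have "cmod ((m / l) ^ n * u + v) = cmod (m ^ n * u + l ^ n * v) / cmod l ^ n" for n
    proof -
      have "(m / l) ^ n * u + v = (m ^ n * u + l ^ n * v) / l ^ n" using l0 by (simp add: field_simps)
      then show ?thesis by (simp add: norm_divide norm_power)
    qed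
    ultimately show ?thesis by simp
  qed
  have x: "(\<lambda>n. cmod (m ^ n * (a * a') + l ^ n * (b * c')) / cmod l ^ n) \<longlonglongrightarrow> cmod (b * c')"
    by (rule lim[OF lm(1) l(1)])
  have "(\<lambda>n. (cmod (m ^ n * (a * a') + l ^ n * (b * c')) / cmod l ^ n) powr \<kappa>) \<longlonglongrightarrow> cmod (b * c') powr \<kappa>"
    by (rule tendsto_powr'[OF x tendsto_const]) (use \<kappa> in auto)
  moreover have "(cmod (m ^ n * (a * a') + l ^ n * (b * c')) / cmod l ^ n) powr \<kappa>
    = cmod (m' ^ n * (A * A') + l' ^ n * (B * C')) / cmod l' ^ n" for n
    unfolding 1 norm_l'_pow by (simp add: powr_divide)
  ultimately show ?thesis using lim[OF lm(2) l(2), of "A * A'" "B * C'"] LIMSEQ_unique by simp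
qed

text \<open>The conjugate of \<open>g ^ n\<close> by \<open>h\<close> has upper right entry
  \<open>- l ^ n * (1 - \<mu> ^ n) * a * b\<close>. Pairing it with the entry \<open>c\<close> of
  \<open>h\<close> in \<open>entry_bc\<close> and cancelling gives the hypothesis of
  \<open>exponent_le_1\<close>.\<close>

lemma exponent_le:
  assumes h: "(mk a b c d, mk A B C D) \<in> S" "a \<noteq> 0" "b \<noteq> 0" "c \<noteq> 0"
  shows "\<kappa> \<le> 1"
proof -
  have l0: "l \<noteq> 0" "l' \<noteq> 0" using l by auto
  have m: "m = inverse l" "m' = inverse l'" using lm l0 by (simp_all add: field_simps)
  have A: "cmod A = cmod a powr \<kappa>" by (rule entry_a[OF h(1)])
  have BC: "cmod (B * C) = cmod (b * c) powr \<kappa>" by (rule entry_bc[OF h(1) h(1)])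
  define \<mu> where "\<mu> = m / l"
  define \<nu> where "\<nu> = m' / l'"
  have eq: "cmod (1 - \<nu> ^ n) = cmod (1 - \<mu> ^ n) powr \<kappa>" for n
  proof -
    have "\<exists>x y z X Y Z. (mk x (- (l ^ n * (1 - \<mu> ^ n) * a * b)) y z, mk X (- (l' ^ n * (1 - \<nu> ^ n) * A * B)) Y Z) \<in> S"
      using mgrp2D(5)[OF S mgrp2D(5)[OF S h(1) g_pow[of n]] mgrp2D(4)[OF S h(1)]] l0
      by (simp add: \<mu>_def \<nu>_def power_divide algebra_simps) metis
    then have "cmod (- (l' ^ n * (1 - \<nu> ^ n) * A * B) * C) = cmod (- (l ^ n * (1 - \<mu> ^ n) * a * b) * c) powr \<kappa>"
      using entry_bc[OF _ h(1)] by blast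
    then have "cmod l' ^ n * cmod (1 - \<nu> ^ n) * cmod A * cmod (B * C)
       = (cmod l ^ n * cmod (1 - \<mu> ^ n) * cmod a * cmod (b * c)) powr \<kappa>"
      by (simp add: norm_mult norm_power mult_ac)
    also have "\<dots> = cmod l' ^ n * cmod (1 - \<mu> ^ n) powr \<kappa> * cmod A * cmod (B * C)"
      unfolding A BC norm_l'_pow by (simp add: powr_mult)
    finally show ?thesis using l0 h A BC by (simp add: powr_mult)
  qed
  note ml = norm_inverse_ratio[OF lm(1) l(1)] and ml' = norm_inverse_ratio[OF lm(2) l(2)]
  have "cmod l > 0" using l by linarith
  then have "cmod \<nu> = cmod \<mu> powr \<kappa>"
    unfolding \<mu>_def \<nu>_def ml ml' norm_l' by (simp add: powr_pow inverse_powr)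
  moreover have "0 < cmod \<mu>" "cmod \<mu> < 1"
    using ml by (auto simp: \<mu>_def)
  ultimately show ?thesis using exponent_le_1 \<kappa> eq by blast
qed

lemma swap: "length_pair ((\<lambda>(x,y). (y,x)) ` S) (1 / \<kappa>) l' m' l m"
proof
  show "mgrp2 ((\<lambda>(x,y). (y,x)) ` S)" using S unfolding mgrp2_def by fastforce
  show "(mk l' 0 0 m', mk l 0 0 m) \<in> (\<lambda>(x,y). (y,x)) ` S" using g by force
  show "\<And>x y. (x, y) \<in> (\<lambda>(x,y). (y,x)) ` S \<Longrightarrow> tlen y = 1 / \<kappa> * tlen x" using len \<kappa> by auto
qed (use \<kappa> lm l in auto)

text \<open>Exchanging the coordinates replaces \<open>\<kappa>\<close> by its inverse, so both are
  at most 1.\<close>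

lemma exponent_eq_1:
  assumes h: "(mk a b c d, mk A B C D) \<in> S" "a \<noteq> 0" "b \<noteq> 0" "c \<noteq> 0"
  shows "\<kappa> = 1"
proof -
  have "A \<noteq> 0" using entry_a[OF h(1)] h by auto
  moreover have "B * C \<noteq> 0" using entry_bc[OF h(1) h(1)] h by auto
  moreover have "(mk A B C D, mk a b c d) \<in> (\<lambda>(x,y). (y,x)) ` S" using h by force
  ultimately have "1 / \<kappa> \<le> 1" using length_pair.exponent_le[OF swap] by auto
  then show ?thesis using exponent_le[OF h] \<kappa> by (simp add: field_simps)
qed

end

text \<open>A projective transformation is determined by three points, here the rows (1, 0), (1, 1)
  and (1, \<open>\<mu>\<close>). Equality of the two images leaves a scalar, and determinant 1 makes
  it 1 or -1.\<close>

lemma proportional_rows: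
  fixes a b c d :: complex
  assumes k: "a * d - b * c = 1" and K: "A * D - B * C = 1" and \<mu>: "\<mu> \<noteq> 0" "\<mu> \<noteq> 1"
    and 1: "A = u1 * a" "B = u1 * b"
    and 2: "A + C = u2 * (a + c)" "B + D = u2 * (b + d)"
    and 3: "A + \<mu> * C = u3 * (a + \<mu> * c)" "B + \<mu> * D = u3 * (b + \<mu> * d)"
  shows "mk A B C D = mk a b c d \<or> mk A B C D = - mk a b c d"
proof -
  have ind: "p = 0 \<and> q = 0" if "p * a + q * c = 0" "p * b + q * d = 0" for p q
  proof
    have "p = p * (a * d - b * c)" using k by simp
    also have "\<dots> = d * (p * a + q * c) - c * (p * b + q * d)" by (simp add: algebra_simps)
    finally show "p = 0" using that by simp
    have "q = q * (a * d - b * c)" using k by simp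
    also have "\<dots> = a * (p * b + q * d) - b * (p * a + q * c)" by (simp add: algebra_simps)
    finally show "q = 0" using that by simp
  qed
  have C: "C = (u2 - u1) * a + u2 * c" using 1 2 by (simp add: algebra_simps)
  have D: "D = (u2 - u1) * b + u2 * d" using 1 2 by (simp add: algebra_simps)
  have "u1 + \<mu> * (u2 - u1) - u3 = 0 \<and> \<mu> * (u2 - u3) = 0"
    by (rule ind) (use 1 3 C D in \<open>simp_all add: algebra_simps\<close>)
  then have "u2 = u3" "(1 - \<mu>) * (u1 - u2) = 0" using \<mu> by (auto simp: algebra_simps)
  then have e: "u1 = u2" using \<mu> by simp
  have "u1 * u1 = u1 * u1 * (a * d - b * c)" using k by simp
  also have "\<dots> = A * D - B * C" using 1 C D e by (simp add: algebra_simps)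
  finally have "(u1 - 1) * (u1 + 1) = 0" using K by (simp add: algebra_simps)
  then have "u1 = 1 \<or> u1 = -1" by (auto simp: add_eq_0_iff2)
  then show ?thesis using 1 C D e by auto
qed

text \<open>The first rows of the elements of \<open>S\<close> form an orbit in the projective line. If both
  coordinates of \<open>S\<close> have the same orbit, they act in the same way on three points.\<close>
lemma same_rows_eq:
  assumes S: "mgrp2 S" and lm: "l * m = 1" "l * l \<noteq> 1" and g: "(mk l 0 0 m, mk l' 0 0 m') \<in> S" and lm': "l' * m' = 1"
    and h: "(mk a0 a0 c0 d0, mk A0 A0 C0 D0) \<in> S" "a0 \<noteq> 0" "A0 \<noteq> 0"
    and zero: "\<And>a b c d A B C D. (mk a b c d, mk A B C D) \<in> S \<Longrightarrow> a = 0 \<longleftrightarrow> A = 0"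
    and row: "\<And>a b c d A B C D. (mk a b c d, mk A B C D) \<in> S \<Longrightarrow> B * a = b * A"
    and k: "(x, y) \<in> S"
  shows "y = x \<or> y = - x"
proof -
  obtain a b c d where x: "x = mk a b c d" by (rule mk_cases)
  obtain A B C D where y: "y = mk A B C D" by (rule mk_cases)
  note k' = k[unfolded x y]
  have scal: "\<exists>e. A = e * a \<and> B = e * b" if "(mk a b c d, mk A B C D) \<in> S" for a b c d A B C D
  proof (cases "a = 0")
    case True
    then have "A = 0" using zero[OF that] by simp
    have "b \<noteq> 0" using True mgrp2D(2)[OF S that] by auto
    then show ?thesis using True \<open>A = 0\<close> by (intro exI[of _ "B / b"]) auto
  next
    case False
    then show ?thesis using row[OF that] by (intro exI[of _ "A / a"]) (auto simp: field_simps)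
  qed
  have l0: "l \<noteq> 0" "m \<noteq> 0" "l' \<noteq> 0" using lm lm' by auto
  define \<mu> where "\<mu> = m / l"
  have \<mu>: "\<mu> \<noteq> 0" "\<mu> \<noteq> 1" using l0 lm by (auto simp: \<mu>_def)
  \<comment> \<open>The rows (1, 0), (1, 1) and (1, \<open>\<mu>\<close>) are, up to scalars, first
    rows of the identity, \<open>h\<close> and \<open>h g\<close>. The last pair also shows that
    \<open>\<mu>\<close> is the ratio of \<open>m'\<close> to \<open>l'\<close>.\<close>
  have hg: "(mk (a0 * l) (a0 * m) (c0 * l) (d0 * m), mk (A0 * l') (A0 * m') (C0 * l') (D0 * m')) \<in> S"
    using mgrp2D(5)[OF S h(1) g] by simp
  have \<mu>': "m' = \<mu> * l'"
    using row[OF hg] h l0 by (simp add: \<mu>_def field_simps)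
  obtain u1 where u1: "A = u1 * a" "B = u1 * b" using scal[OF k'] by blast
  obtain u2 where u2: "A0 * A + A0 * C = u2 * (a0 * a + a0 * c)" "A0 * B + A0 * D = u2 * (a0 * b + a0 * d)"
    using scal mgrp2D(5)[OF S h(1) k'] by simp blast
  obtain u3 where u3: "A0 * l' * A + A0 * m' * C = u3 * (a0 * l * a + a0 * m * c)"
      "A0 * l' * B + A0 * m' * D = u3 * (a0 * l * b + a0 * m * d)"
    using scal mgrp2D(5)[OF S hg k'] by simp blast
  have m: "m = \<mu> * l" using l0 by (simp add: \<mu>_def)
  have "mk A B C D = mk a b c d \<or> mk A B C D = - mk a b c d"
  proof (rule proportional_rows[OF _ _ \<mu> u1])
    show "a * d - b * c = 1" "A * D - B * C = 1" using mgrp2D(2,3)[OF S k'] by simp_all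
    show "A + C = (u2 * a0 / A0) * (a + c)" "B + D = (u2 * a0 / A0) * (b + d)"
      using u2 h by (simp_all add: field_simps)
    have "A0 * l' * (A + \<mu> * C) = u3 * a0 * l * (a + \<mu> * c)" "A0 * l' * (B + \<mu> * D) = u3 * a0 * l * (b + \<mu> * d)"
      using u3 unfolding m \<mu>' by (simp_all add: algebra_simps)
    then show "A + \<mu> * C = (u3 * a0 * l / (A0 * l')) * (a + \<mu> * c)" "B + \<mu> * D = (u3 * a0 * l / (A0 * l')) * (b + \<mu> * d)"
      using h l0 by (simp_all add: eq_divide_eq mult.commute mult.left_commute)
  qed
  then show ?thesis using x y by simp
qed

lemma cnjm_cnjm [simp]: "cnjm (cnjm M) = M"
  by (simp add: cnjm_def mat2_eq_iff)

lemma cnjm_mult: "cnjm (M ** N) = cnjm M ** cnjm N"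
  by (cases M rule: mk_cases, cases N rule: mk_cases) simp

lemma det_cnjm: "det (cnjm M) = cnj (det M)"
  by (cases M rule: mk_cases) simp

lemma trace_cnjm: "trace (cnjm M) = cnj (trace M)"
  by (cases M rule: mk_cases) simp

lemma sl2_inv_cnjm: "sl2_inv (cnjm M) = cnjm (sl2_inv M)"
  by (cases M rule: mk_cases) simp

lemma mgrp2_cnjm:
  assumes "mgrp2 S"
  shows "mgrp2 ((\<lambda>(x, y). (cnjm x, y)) ` S)"
  by (rule mgrp2_image[OF assms]) (simp_all add: mat_mk det_cnjm sl2_inv_cnjm cnjm_mult)

text \<open>Equal first two entries in \<open>h\<close> make the absolute value of each single
  \<open>b\<close> visible, not only of products. Applied to \<open>x\<close> times the inverse of
  \<open>x'\<close>, this says that the slopes \<open>b / a\<close> of the first rows are moved by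
  an isometry. It fixes 0 and 1, the slopes of the identity and of \<open>h\<close>, so it is the
  identity or the conjugation.\<close>

lemma (in length_pair) normalized_rigidity:
  assumes h: "(mk a0 a0 c0 d0, mk A0 A0 C0 D0) \<in> S" "a0 \<noteq> 0" "c0 \<noteq> 0"
  shows "(\<forall>(x,y)\<in>S. y = x \<or> y = - x) \<or> (\<forall>(x,y)\<in>S. y = cnjm x \<or> y = - cnjm x)"
proof -
  have k1: "\<kappa> = 1" using exponent_eq_1[OF h(1,2,2,3)] .
  have a: "cmod A = cmod a" if "(mk a b c d, mk A B C D) \<in> S" for a b c d A B C D
    using entry_a[OF that] by (simp add: k1)
  have bc: "cmod (B * C') = cmod (b * c')"
    if "(mk a b c d, mk A B C D) \<in> S" "(mk a' b' c' d', mk A' B' C' D') \<in> S" for a b c d A B C D a' b' c' d' A' B' C' D'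
    using entry_bc[OF that] by (simp add: k1)
  have A0: "A0 \<noteq> 0" "cmod A0 = cmod a0" using a[OF h(1)] h by auto
  have "cmod C0 = cmod c0" using bc[OF h(1) h(1)] A0 h(2) by (simp add: norm_mult)
  then have b: "cmod B = cmod b" if "(mk a b c d, mk A B C D) \<in> S" for a b c d A B C D
    using bc[OF that h(1)] h by (auto simp: norm_mult)
  have diff: "cmod (B * A' - A * B') = cmod (b * a' - a * b')"
    if "(mk a b c d, mk A B C D) \<in> S" "(mk a' b' c' d', mk A' B' C' D') \<in> S" for a b c d A B C D a' b' c' d' A' B' C' D'
    using b[of _ "- (a * b') + b * a'" _ _ _ "- (A * B') + B * A'"] mgrp2D(5)[OF S that(1) mgrp2D(4)[OF S that(2)]] by simp
  define slope where "slope M = M $ 1 $ 2 / M $ 1 $ 1" for M :: mat2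
  have sd: "cmod (slope y - slope y') = cmod (slope x - slope x')"
    if xy: "(x, y) \<in> S" "(x', y') \<in> S" and nz: "x$1$1 \<noteq> 0" "x'$1$1 \<noteq> 0" for x y x' y'
  proof -
    obtain a b c d where x: "x = mk a b c d" by (rule mk_cases)
    obtain A B C D where y: "y = mk A B C D" by (rule mk_cases)
    obtain a' b' c' d' where x': "x' = mk a' b' c' d'" by (rule mk_cases)
    obtain A' B' C' D' where y': "y' = mk A' B' C' D'" by (rule mk_cases)
    have n: "cmod A = cmod a" "cmod A' = cmod a'" using a xy x y x' y' by auto
    have nz': "a \<noteq> 0" "a' \<noteq> 0" "A \<noteq> 0" "A' \<noteq> 0" using nz n x x' by auto
    have "slope y - slope y' = (B * A' - A * B') / (A * A')" "slope x - slope x' = (b * a' - a * b') / (a * a')"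
      using nz' by (simp_all add: slope_def x y x' y' field_simps)
    then show ?thesis using diff[of a b c d A B C D a' b' c' d' A' B' C' D'] xy n x y x' y'
      by (simp add: norm_divide norm_mult)
  qed
  have s01: "slope (mat 1) = 0" "slope (mk a0 a0 c0 d0) = 1" "slope (mk A0 A0 C0 D0) = 1"
    using h A0 by (simp_all add: slope_def mat_mk)
  have one: "slope y = slope x \<or> slope y = cnj (slope x)" if "(x, y) \<in> S" "x$1$1 \<noteq> 0" for x y
  proof (rule eq_or_cnj)
    show "cmod (slope y) = cmod (slope x)"
      using sd[OF that(1) mgrp2D(1)[OF S] that(2)] s01(1) by (simp add: mat_mk)
    show "cmod (slope y - 1) = cmod (slope x - 1)"
      using sd[OF that(1) h(1) that(2)] s01 h by simp
  qed
  have l2: "l * l \<noteq> 1"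
  proof
    assume "l * l = 1"
    then have "cmod l * cmod l = 1" by (metis norm_mult norm_one)
    then show False using one_less_power[OF l(1), of 2] by (simp add: power2_eq_square)
  qed
  \<comment> \<open>Each slope is kept or conjugated. If one is only kept and another only
    conjugated, their distance changes, as its square would differ by
    \<open>4 * Im (slope x) * Im (slope x')\<close>.\<close>
  have all: "(\<forall>x y. (x,y)\<in>S \<longrightarrow> x$1$1 \<noteq> 0 \<longrightarrow> slope y = slope x) \<or>
      (\<forall>x y. (x,y)\<in>S \<longrightarrow> x$1$1 \<noteq> 0 \<longrightarrow> slope y = cnj (slope x))"
  proof (rule ccontr)
    assume "\<not> ?thesis"
    then obtain x y x' y' where xy: "(x, y) \<in> S" "x$1$1 \<noteq> 0" "slope y \<noteq> slope x"
      and xy': "(x', y') \<in> S" "x'$1$1 \<noteq> 0" "slope y' \<noteq> cnj (slope x')" by auto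
    have e: "slope y = cnj (slope x)" "slope y' = slope x'" using one xy xy' by blast+
    have "(cmod (slope y - slope y'))\<^sup>2 = (cmod (slope x - slope x'))\<^sup>2"
      using sd[OF xy(1) xy'(1) xy(2) xy'(2)] by simp
    then have "Im (slope x) * Im (slope x') = 0"
      unfolding e cmod_power2 by (simp add: power2_eq_square algebra_simps)
    then have "slope y = slope x \<or> slope y' = cnj (slope x')" unfolding e by (auto simp: complex_eq_iff)
    then show False using xy xy' by blast
  qed
  have zero: "a = 0 \<longleftrightarrow> A = 0" if "(mk a b c d, mk A B C D) \<in> S" for a b c d A B C D
    using a[OF that] by (metis norm_eq_zero)
  from all show ?thesis
  proof
    assume E: "\<forall>x y. (x,y)\<in>S \<longrightarrow> x$1$1 \<noteq> 0 \<longrightarrow> slope y = slope x"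
    have row: "B * a = b * A" if "(mk a b c d, mk A B C D) \<in> S" for a b c d A B C D
      using E[rule_format, OF that] zero[OF that] by (cases "a = 0") (auto simp: slope_def frac_eq_eq)
    have "y = x \<or> y = - x" if "(x, y) \<in> S" for x y
      by (rule same_rows_eq[OF S lm(1) l2 g lm(2) h(1,2) A0(1) zero row that])
    then show ?thesis by blast
  next
    assume E: "\<forall>x y. (x,y)\<in>S \<longrightarrow> x$1$1 \<noteq> 0 \<longrightarrow> slope y = cnj (slope x)"
    \<comment> \<open>Conjugating the first coordinate reduces this case to the previous
      one.\<close>
    define S' where "S' = (\<lambda>(x, y). (cnjm x, y)) ` S"
    have S': "mgrp2 S'" unfolding S'_def by (rule mgrp2_cnjm[OF S])
    have in_S: "(mk (cnj a) (cnj b) (cnj c) (cnj d), mk A B C D) \<in> S" if xy: "(mk a b c d, mk A B C D) \<in> S'" for a b c d A B C D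
    proof -
      obtain p where p: "(mk a b c d, mk A B C D) = (\<lambda>(x, y). (cnjm x, y)) p" "p \<in> S"
        using xy unfolding S'_def by (rule imageE)
      obtain x y where [simp]: "p = (x, y)" by (cases p)
      have e: "mk a b c d = cnjm x" "mk A B C D = y" using p(1) by simp_all
      have "cnjm (mk a b c d) = x" unfolding e(1) by (rule cnjm_cnjm)
      then show ?thesis using p(2) e(2) by simp
    qed
    have to_S': "(cnjm x, y) \<in> S'" if "(x, y) \<in> S" for x y using that by (force simp: S'_def)
    have g': "(mk (cnj l) 0 0 (cnj m), mk l' 0 0 m') \<in> S'" using to_S'[OF g] by simp
    have h': "(mk (cnj a0) (cnj a0) (cnj c0) (cnj d0), mk A0 A0 C0 D0) \<in> S'" using to_S'[OF h(1)] by simp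
    have zero': "a = 0 \<longleftrightarrow> A = 0" if "(mk a b c d, mk A B C D) \<in> S'" for a b c d A B C D
      using zero[OF in_S[OF that]] by simp
    have row: "B * a = b * A" if "(mk a b c d, mk A B C D) \<in> S'" for a b c d A B C D
      using E[rule_format, OF in_S[OF that]] zero'[OF that] by (cases "a = 0") (auto simp: slope_def frac_eq_eq)
    have lm': "cnj l * cnj m = 1" "cnj l * cnj l \<noteq> 1"
      using lm(1) l2 by (metis complex_cnj_mult complex_cnj_one complex_cnj_cnj)+
    have "y = cnjm x \<or> y = - cnjm x" if "(x, y) \<in> S" for x y
      by (rule same_rows_eq[OF S' lm' g' lm(2) h' _ A0(1) zero' row to_S'[OF that]]) (use h in auto)
    then show ?thesis by blast
  qed
qed

lemma conj_mgrp2: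
  assumes "mgrp2 S" "det Q = 1" "det R = 1"
  shows "mgrp2 ((\<lambda>(x, y). (sl2_inv Q ** x ** Q, sl2_inv R ** y ** R)) ` S)"
proof -
  have m: "sl2_inv Q ** g ** Q ** (sl2_inv Q ** h ** Q) = sl2_inv Q ** (g ** h) ** Q" if "det Q = 1" for g h Q :: mat2
    by (metis that matrix_mul_assoc matrix_mul_rid sl2_inv_right)
  have i: "sl2_inv (sl2_inv Q ** g ** Q) = sl2_inv Q ** sl2_inv g ** Q" for g Q
    by (simp add: sl2_inv_mult matrix_mul_assoc)
  show ?thesis using assms(2,3) by (intro mgrp2_image[OF assms(1)]) (auto simp: det_mul i m sl2_inv_left)
qed

text \<open>As \<open>\<kappa> > 0\<close>, the partner of a loxodromic element is loxodromic too,
  so both can be diagonalized. A generic pair has nonzero entries on both sides by the power laws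
  and can then be normalized.\<close>

theorem length_rigidity:
  assumes S: "mgrp2 S" and \<kappa>: "\<kappa> > 0" and len: "\<And>x y. (x, y) \<in> S \<Longrightarrow> tlen y = \<kappa> * tlen x"
    and ne: "nonelementary (fst ` S)"
  obtains Q R f where "det Q = 1" "det R = 1" "f = id \<or> f = cnjm"
    "\<And>x y. (x, y) \<in> S \<Longrightarrow> sl2_inv R ** y ** R = f (sl2_inv Q ** x ** Q) \<or> sl2_inv R ** y ** R = - f (sl2_inv Q ** x ** Q)"
proof -
  have G: "mgrp (fst ` S)"
  proof -
    have E: "\<exists>y. (x, y) \<in> S" if "x \<in> fst ` S" for x using that by auto
    have I: "x \<in> fst ` S" if "(x, y) \<in> S" for x y using image_eqI[of x fst "(x, y)"] that by simp
    have "mat 1 \<in> fst ` S" by (rule I[OF mgrp2D(1)[OF S]])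
    moreover have "det x = 1 \<and> sl2_inv x \<in> fst ` S" if "x \<in> fst ` S" for x
      using E[OF that] I mgrp2D(2,4)[OF S] by blast
    moreover have "x ** x' \<in> fst ` S" if "x \<in> fst ` S" "x' \<in> fst ` S" for x x'
      using E[OF that(1)] E[OF that(2)] I mgrp2D(5)[OF S] by blast
    ultimately show ?thesis unfolding mgrp_def by blast
  qed
  obtain g where g: "g \<in> fst ` S" "tlen g > 0" by (rule nonelementary_loxodromic[OF ne G])
  then obtain g' where gg: "(g, g') \<in> S" by force
  have dt: "det g = 1" "det g' = 1" using mgrp2D(2,3)[OF S gg] by auto
  obtain l m where lm: "trace g = l + m" "l * m = 1" "cmod l \<ge> 1" by (rule exists_eigenvalues)
  obtain l' m' where lm': "trace g' = l' + m'" "l' * m' = 1" "cmod l' \<ge> 1" by (rule exists_eigenvalues)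
  have "tlen g' > 0" using len[OF gg] g \<kappa> by simp
  then have l1: "cmod l > 1" "cmod l' > 1"
    using g(2) tlen_eq_ln[OF dt(1) lm] tlen_eq_ln[OF dt(2) lm'] lm(3) lm'(3)
    by (auto simp: less_le)
  have neq: "l \<noteq> m" if "l * m = 1" "cmod l > 1" for l m :: complex
    using norm_inverse_ratio(2,3)[OF that] by auto
  obtain Q where Q: "det Q = 1" "sl2_inv Q ** g ** Q = mk l 0 0 m"
    using exists_diagonal[OF dt(1) lm(1,2) neq[OF lm(2) l1(1)]] by blast
  obtain R where R: "det R = 1" "sl2_inv R ** g' ** R = mk l' 0 0 m'"
    using exists_diagonal[OF dt(2) lm'(1,2) neq[OF lm'(2) l1(2)]] by blast
  have pair: "length_pair ((\<lambda>(x, y). (sl2_inv Q ** x ** Q, sl2_inv R ** y ** R)) ` S) \<kappa> l m l' m'"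
    if Q: "det Q = 1" "sl2_inv Q ** g ** Q = mk l 0 0 m" and R: "det R = 1" "sl2_inv R ** g' ** R = mk l' 0 0 m'" for Q R
  proof
    show "mgrp2 ((\<lambda>(x, y). (sl2_inv Q ** x ** Q, sl2_inv R ** y ** R)) ` S)"
      by (rule conj_mgrp2[OF S Q(1) R(1)])
    show "(mk l 0 0 m, mk l' 0 0 m') \<in> (\<lambda>(x, y). (sl2_inv Q ** x ** Q, sl2_inv R ** y ** R)) ` S"
      using gg Q R by force
    fix x y assume "(x, y) \<in> (\<lambda>(x, y). (sl2_inv Q ** x ** Q, sl2_inv R ** y ** R)) ` S"
    then obtain u v where "(u, v) \<in> S" "x = sl2_inv Q ** u ** Q" "y = sl2_inv R ** v ** R" by auto
    then show "tlen y = \<kappa> * tlen x"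
      using len tlen_conj[of "sl2_inv Q" u] tlen_conj[of "sl2_inv R" v] Q R by simp
  qed (use \<kappa> lm lm' l1 in auto)
  interpret P: length_pair "(\<lambda>(x, y). (sl2_inv Q ** x ** Q, sl2_inv R ** y ** R)) ` S" \<kappa> l m l' m'
    by (rule pair[OF Q R])
  obtain h a b c d where h: "h \<in> fst ` S" "sl2_inv Q ** h ** Q = mk a b c d" "a \<noteq> 0" "b \<noteq> 0" "c \<noteq> 0"
    by (rule nonelementary_generic[OF ne G Q(1)])
  then obtain h' where hh: "(h, h') \<in> S" by force
  obtain A B C D where h': "sl2_inv R ** h' ** R = mk A B C D" by (rule mk_cases)
  have in_im: "(mk a b c d, mk A B C D) \<in> (\<lambda>(x, y). (sl2_inv Q ** x ** Q, sl2_inv R ** y ** R)) ` S"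
    using hh h h' by force
  have nz: "A \<noteq> 0" "B \<noteq> 0" using P.entry_a[OF in_im] P.entry_bc[OF in_im in_im] h by auto
  \<comment> \<open>Conjugation by diag(s, 1/s) keeps \<open>g\<close> diagonal and divides
    \<open>b\<close> by \<open>s * s = b / a\<close>, so that the first row becomes
    \<open>(a, a)\<close>.\<close>
  have scale: "\<exists>Q'. det Q' = 1 \<and> sl2_inv Q' ** g ** Q' = mk l 0 0 m \<and> sl2_inv Q' ** h ** Q' = mk a a (b * c / a) d"
    if "det Q = 1" "sl2_inv Q ** g ** Q = mk l 0 0 m" "sl2_inv Q ** h ** Q = mk a b c d" "a \<noteq> 0" "b \<noteq> 0"
    for Q g h l m a b c d
  proof -
    define s where "s = csqrt (b / a)"
    have s: "s * s = b / a" "s \<noteq> 0" using that by (auto simp: s_def simp flip: power2_eq_square)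
    define q where "q = mk s 0 0 (1 / s)"
    have C: "sl2_inv (Q ** q) ** M ** (Q ** q) = sl2_inv q ** (sl2_inv Q ** M ** Q) ** q" for M
      by (simp add: sl2_inv_mult matrix_mul_assoc)
    have b: "b = s * s * a" using s that by simp
    have e: "sl2_inv Q ** h ** Q = mk a (s * s * a) c d" using that(3) b by simp
    have "det (Q ** q) = 1" using that(1) s(2) by (simp add: det_mul q_def)
    moreover have "sl2_inv (Q ** q) ** g ** (Q ** q) = mk l 0 0 m"
      unfolding C that(2) using s(2) by (simp add: q_def)
    moreover have "sl2_inv (Q ** q) ** h ** (Q ** q) = mk a a (b * c / a) d"
      unfolding C e b using s(2) that(4) by (simp add: q_def)
    ultimately show ?thesis by blast
  qed
  obtain Q' where Q': "det Q' = 1" "sl2_inv Q' ** g ** Q' = mk l 0 0 m" "sl2_inv Q' ** h ** Q' = mk a a (b * c / a) d"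
    using scale[OF Q h(2-4)] by blast
  obtain R' where R': "det R' = 1" "sl2_inv R' ** g' ** R' = mk l' 0 0 m'" "sl2_inv R' ** h' ** R' = mk A A (B * C / A) D"
    using scale[OF R h' nz] by blast
  interpret P': length_pair "(\<lambda>(x, y). (sl2_inv Q' ** x ** Q', sl2_inv R' ** y ** R')) ` S" \<kappa> l m l' m'
    by (rule pair[OF Q'(1,2) R'(1,2)])
  have "(mk a a (b * c / a) d, mk A A (B * C / A) D) \<in> (\<lambda>(x, y). (sl2_inv Q' ** x ** Q', sl2_inv R' ** y ** R')) ` S"
    using hh Q' R' by force
  moreover have "b * c / a \<noteq> 0" using h by simp
  ultimately
  have "(\<forall>(x,y)\<in>S. sl2_inv R' ** y ** R' = id (sl2_inv Q' ** x ** Q') \<or> sl2_inv R' ** y ** R' = - id (sl2_inv Q' ** x ** Q'))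
    \<or> (\<forall>(x,y)\<in>S. sl2_inv R' ** y ** R' = cnjm (sl2_inv Q' ** x ** Q') \<or> sl2_inv R' ** y ** R' = - cnjm (sl2_inv Q' ** x ** Q'))"
    using P'.normalized_rigidity h(3) by (simp only: ball_simps split_def fst_conv snd_conv id_apply)
  then show ?thesis using that[OF Q'(1) R'(1)] by blast
qed

subsection \<open>Algebraic integers and embeddings of number fields\<close>

definition subring :: "complex set \<Rightarrow> bool" where
  "subring R \<longleftrightarrow> 0 \<in> R \<and> 1 \<in> R \<and> (\<forall>x\<in>R. \<forall>y\<in>R. x + y \<in> R \<and> x * y \<in> R) \<and> (\<forall>x\<in>R. - x \<in> R)"

lemma subringD:
  assumes "subring R"
  shows "0 \<in> R" "1 \<in> R" "x \<in> R \<Longrightarrow> y \<in> R \<Longrightarrow> x + y \<in> R" "x \<in> R \<Longrightarrow> y \<in> R \<Longrightarrow> x * y \<in> R"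
    "x \<in> R \<Longrightarrow> - x \<in> R" "x \<in> R \<Longrightarrow> y \<in> R \<Longrightarrow> x - y \<in> R"
proof -
  show "x - y \<in> R" if "x \<in> R" "y \<in> R"
    using that assms unfolding subring_def by (metis add_uminus_conv_diff)
qed (use assms in \<open>auto simp: subring_def\<close>)

lemma subring_sum: "subring R \<Longrightarrow> (\<And>i. i \<in> A \<Longrightarrow> f i \<in> R) \<Longrightarrow> sum f A \<in> R"
  by (induction A rule: infinite_finite_induct) (auto simp: subringD)

lemma subring_power: "subring R \<Longrightarrow> x \<in> R \<Longrightarrow> x ^ n \<in> R"
  by (induction n) (auto simp: subringD)

lemma subring_Ints: "subring \<int>"
  by (auto simp: subring_def)

lemma subring_Rats: "subring \<rat>"
  by (auto simp: subring_def)

lemma subfield_subring: "subfield K \<Longrightarrow> subring K"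
  by (auto simp: subfield_def subring_def)

definition coeffs_in :: "complex set \<Rightarrow> complex poly \<Rightarrow> bool" where
  "coeffs_in R p \<longleftrightarrow> (\<forall>i. coeff p i \<in> R)"

lemma coeffs_in_arith:
  assumes "subring R"
  shows "coeffs_in R p \<Longrightarrow> coeffs_in R q \<Longrightarrow> coeffs_in R (p + q)"
    "coeffs_in R p \<Longrightarrow> coeffs_in R q \<Longrightarrow> coeffs_in R (p - q)"
    "coeffs_in R p \<Longrightarrow> coeffs_in R q \<Longrightarrow> coeffs_in R (p * q)"
    "a \<in> R \<Longrightarrow> coeffs_in R p \<Longrightarrow> coeffs_in R (pCons a p)"
    "coeffs_in R 0" "a \<in> R \<Longrightarrow> coeffs_in R (monom a n)"
  using assms unfolding coeffs_in_def
  by (auto simp: subringD coeff_mult coeff_pCons coeff_monom intro!: subring_sum split: nat.split)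

lemma poly_in_subring:
  assumes "subring R" "coeffs_in R p" "x \<in> R"
  shows "poly p x \<in> R"
  using assms unfolding poly_altdef coeffs_in_def
  by (intro subring_sum) (auto intro: subringD subring_power)

definition integral_over :: "complex set \<Rightarrow> complex \<Rightarrow> bool" where
  "integral_over R x \<longleftrightarrow> (\<exists>p. lead_coeff p = 1 \<and> coeffs_in R p \<and> poly p x = 0)"

text \<open>Elimination without determinants: the system \<open>M(x) w = 0\<close> keeps its shape, a monic
  diagonal dominating the degrees of the other entries, when one unknown is removed.\<close>
lemma monic_elimination:
  fixes x z :: complex and F :: "complex set"
  assumes R: "subring R" and "finite F" "z \<notin> F" "z \<noteq> 0" "d > 0"
    and "\<And>v. v \<in> insert z F \<Longrightarrow> (\<Sum>w\<in>insert z F. poly (M v w) x * w) = 0"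
    and "\<And>v w. v \<in> insert z F \<Longrightarrow> w \<in> insert z F \<Longrightarrow> coeffs_in R (M v w)"
    and "\<And>v. v \<in> insert z F \<Longrightarrow> degree (M v v) = d \<and> lead_coeff (M v v) = 1"
    and "\<And>v w. v \<in> insert z F \<Longrightarrow> w \<in> insert z F \<Longrightarrow> v \<noteq> w \<Longrightarrow> degree (M v w) < d"
  shows "integral_over R x"
  using assms(2-)
proof (induction F arbitrary: M d rule: finite_induct)
  case empty
  then show ?case unfolding integral_over_def by (intro exI[of _ "M z z"]) auto
next
  case (insert u F)
  \<comment> \<open>Row \<open>v\<close> times the pivot minus row \<open>u\<close> times
    \<open>M v u\<close>. The products \<open>M v v * M u u\<close> are monic of degree
    \<open>2 d\<close>, and all other terms have smaller degree.\<close>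
  define N where "N v w = M v w * M u u - M v u * M u w" for v w
  have nu: "u \<noteq> z" "u \<notin> insert z F" using insert by auto
  have rel: "(\<Sum>w\<in>insert z F. poly (M v w) x * w) = - poly (M v u) x * u" if "v \<in> insert z (insert u F)" for v
  proof -
    have "(\<Sum>w\<in>insert u (insert z F). poly (M v w) x * w) = 0"
      using insert.prems(4)[OF that] by (simp add: insert_commute)
    then show ?thesis using nu insert.hyps by (subst (asm) sum.insert) (auto simp: add_eq_0_iff)
  qed
  have big: "coeff (M v v * M u u) (d + d) = 1" "degree (M v v * M u u) \<le> d + d" if "v \<in> insert z F" for v
  proof -
    have v: "degree (M v v) = d" "lead_coeff (M v v) = 1" "degree (M u u) = d" "lead_coeff (M u u) = 1"
      using insert.prems(6) that by auto
    then show "coeff (M v v * M u u) (d + d) = 1" using coeff_mult_degree_sum[of "M v v" "M u u"] by simp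
    show "degree (M v v * M u u) \<le> d + d" using degree_mult_le[of "M v v" "M u u"] v by simp
  qed
  have small: "degree (M v u * M u w) < d + d" if "v \<in> insert z F" "w \<in> insert z F" for v w
  proof -
    have "degree (M v u) < d" "degree (M u w) < d" using insert.prems(7) that nu by auto
    then show ?thesis using degree_mult_le[of "M v u" "M u w"] by linarith
  qed
  show ?case
  proof (rule insert.IH[of "d + d" N])
    fix v assume v: "v \<in> insert z F"
    have "(\<Sum>w\<in>insert z F. poly (N v w) x * w)
        = poly (M u u) x * (\<Sum>w\<in>insert z F. poly (M v w) x * w) - poly (M v u) x * (\<Sum>w\<in>insert z F. poly (M u w) x * w)"
      by (simp add: N_def sum_subtractf sum_distrib_left algebra_simps)
    moreover show "(\<Sum>w\<in>insert z F. poly (N v w) x * w) = 0"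
    proof -
      have "(\<Sum>w\<in>insert z F. poly (M v w) x * w) = - poly (M v u) x * u"
          "(\<Sum>w\<in>insert z F. poly (M u w) x * w) = - poly (M u u) x * u"
        by (rule rel; use v in auto)+
      then show ?thesis using calculation by (simp add: algebra_simps)
    qed
    show "degree (N v v) = d + d \<and> lead_coeff (N v v) = 1"
    proof -
      have c: "coeff (N v v) (d + d) = 1"
        using big[OF v] coeff_eq_0[OF small[OF v v]] by (simp add: N_def)
      moreover have "degree (N v v) \<le> d + d" unfolding N_def
        using big[OF v] small[OF v v] by (intro degree_diff_le) auto
      ultimately show ?thesis by (metis le_antisym le_degree zero_neq_one)
    qed
  next
    fix v w assume vw: "v \<in> insert z F" "w \<in> insert z F"
    show "coeffs_in R (N v w)"
      unfolding N_def using insert.prems(5) vw by (intro coeffs_in_arith[OF R]) auto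
    assume ne: "v \<noteq> w"
    have "degree (M v w) < d" "degree (M u u) = d" using insert.prems(6,7) vw ne by auto
    then have "degree (M v w * M u u) < d + d" using degree_mult_le[of "M v w" "M u u"] by linarith
    then show "degree (N v w) < d + d" unfolding N_def using small[OF vw] by (intro degree_diff_less)
  qed (use insert in auto)
qed

text \<open>The scalars are a set \<open>R\<close> rather than a type, so that the integers, the
  algebraic integers, a field and its ring of integers can all act on the same vectors.\<close>

locale rmod =
  fixes R :: "complex set" and sc :: "complex \<Rightarrow> 'b::ab_group_add \<Rightarrow> 'b"
  assumes R: "subring R"
    and sc_add_left: "sc (r + s) v = sc r v + sc s v" and sc_add_right: "sc r (v + w) = sc r v + sc r w"
    and sc_sc: "sc r (sc s v) = sc (r * s) v" and sc_one: "sc 1 v = v"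
begin

inductive_set rspan :: "'b set \<Rightarrow> 'b set" for V where
  zero: "0 \<in> rspan V"
| step: "r \<in> R \<Longrightarrow> v \<in> V \<Longrightarrow> u \<in> rspan V \<Longrightarrow> sc r v + u \<in> rspan V"

lemma sc_zero [simp]: "sc 0 v = 0" "sc r 0 = 0"
  using sc_add_left[of 0 0 v] sc_add_right[of r 0 0] by simp_all

lemma sc_minus: "sc (- r) v = - sc r v"
  using sc_add_left[of r "- r" v] by (simp add: add_eq_0_iff)

lemma rspan_base: "v \<in> V \<Longrightarrow> v \<in> rspan V"
  using step[of 1 v V 0] zero subringD[OF R] by (simp add: sc_one)

lemma rspan_add: "u \<in> rspan V \<Longrightarrow> w \<in> rspan V \<Longrightarrow> u + w \<in> rspan V"
  by (induction rule: rspan.induct) (auto simp: add.assoc intro: step)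

lemma rspan_scale:
  assumes "r \<in> R" "u \<in> rspan V"
  shows "sc r u \<in> rspan V"
  using assms(2) by (induction rule: rspan.induct)
    (use assms(1) in \<open>auto simp: sc_add_right sc_sc subringD[OF R] intro: zero step\<close>)

lemma rspan_minus: "u \<in> rspan V \<Longrightarrow> - u \<in> rspan V"
  using rspan_scale[of "- 1" u V] subringD[OF R] by (simp add: sc_minus sc_one)

lemma rspan_diff: "u \<in> rspan V \<Longrightarrow> w \<in> rspan V \<Longrightarrow> u - w \<in> rspan V"
  using rspan_add[of u V "- w"] rspan_minus by simp

lemma rspan_hom:
  assumes "u \<in> rspan V" "\<And>v. v \<in> V \<Longrightarrow> f v \<in> rspan W"
    and "\<And>v w. f (v + w) = f v + f w" "\<And>r v. r \<in> R \<Longrightarrow> f (sc r v) = sc r (f v)"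
  shows "f u \<in> rspan W"
  using assms(1)
proof (induction rule: rspan.induct)
  case zero
  have "f 0 = 0" using assms(3)[of 0 0] by simp
  then show ?case by (simp add: rspan.zero)
next
  case (step r v u)
  then show ?case using assms(2-) by (simp add: rspan_add rspan_scale)
qed

lemma rspan_subset: "V \<subseteq> rspan W \<Longrightarrow> rspan V \<subseteq> rspan W"
  using rspan_hom[of _ V id W] by auto

lemma rspan_sum: "(\<And>i. i \<in> A \<Longrightarrow> f i \<in> rspan V) \<Longrightarrow> sum f A \<in> rspan V"
  by (induction A rule: infinite_finite_induct) (auto simp: zero rspan_add)

lemma rspan_finite:
  assumes "finite V"
  shows "u \<in> rspan V \<longleftrightarrow> (\<exists>c. (\<forall>v. c v \<in> R) \<and> u = (\<Sum>v\<in>V. sc (c v) v))"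
proof
  assume "u \<in> rspan V"
  then show "\<exists>c. (\<forall>v. c v \<in> R) \<and> u = (\<Sum>v\<in>V. sc (c v) v)"
  proof (induction rule: rspan.induct)
    case zero
    show ?case by (intro exI[of _ "\<lambda>_. 0"]) (simp add: subringD[OF R])
  next
    case (step r v u)
    then obtain c where c: "\<forall>v. c v \<in> R" "u = (\<Sum>v\<in>V. sc (c v) v)" by blast
    have "sc r v + u = (\<Sum>w\<in>V. sc ((c(v := r + c v)) w) w)"
      using assms step(2) unfolding c(2) by (subst (1 2) sum.remove[of V v]) (auto simp: sc_add_left add.assoc)
    then show ?case using c(1) step(1) by (intro exI[of _ "c(v := r + c v)"]) (auto simp: subringD[OF R])
  qed
next
  assume "\<exists>c. (\<forall>v. c v \<in> R) \<and> u = (\<Sum>v\<in>V. sc (c v) v)"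
  then show "u \<in> rspan V" by (auto intro!: rspan_sum intro: rspan_scale rspan_base)
qed

end

lemma rmod_mult: "subring R \<Longrightarrow> rmod R (*)"
  by unfold_locales (auto simp: algebra_simps)

text \<open>The classical determinant trick: multiplication by \<open>x\<close> is a matrix over
  \<open>R\<close> on the generators, and \<open>x\<close> minus this matrix annihilates the vector
  of generators. \<open>monic_elimination\<close> replaces the characteristic polynomial.\<close>

lemma integral_over_span:
  assumes R: "subring R" and V: "finite V" "z \<in> V" "z \<noteq> 0"
    and x: "\<And>v. v \<in> V \<Longrightarrow> x * v \<in> rmod.rspan R (*) V"
  shows "integral_over R x"
proof -
  interpret rmod R "(*)" by (rule rmod_mult[OF R])
  have "\<forall>v. \<exists>c. v \<in> V \<longrightarrow> (\<forall>w. c w \<in> R) \<and> x * v = (\<Sum>w\<in>V. c w * w)"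
    using x unfolding rspan_finite[OF V(1)] by blast
  from choice[OF this] obtain c where c: "\<And>v. v \<in> V \<Longrightarrow> (\<forall>w. c v w \<in> R) \<and> x * v = (\<Sum>w\<in>V. c v w * w)"
    by blast
  define M where "M v w = (if v = w then [:- c v w, 1:] else [:- c v w:])" for v w
  have Vz: "insert z (V - {z}) = V" using V by blast
  show ?thesis
  proof (rule monic_elimination[OF R, of "V - {z}" z 1 M])
    fix v assume "v \<in> insert z (V - {z})"
    then have v: "v \<in> V" unfolding Vz .
    have "(\<Sum>w\<in>V. poly (M v w) x * w) = (\<Sum>w\<in>V. (if v = w then x * w else 0) - c v w * w)"
      by (intro sum.cong) (auto simp: M_def algebra_simps)
    also have "\<dots> = x * v - (\<Sum>w\<in>V. c v w * w)" using V v by (simp add: sum_subtractf)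
    finally show "(\<Sum>w\<in>insert z (V - {z}). poly (M v w) x * w) = 0" using c[OF v] unfolding Vz by simp
    show "degree (M v v) = 1 \<and> lead_coeff (M v v) = 1" by (simp add: M_def)
    fix w assume "w \<in> insert z (V - {z})"
    show "coeffs_in R (M v w)" unfolding M_def
      using c[OF v] subringD[OF R] by (auto intro!: coeffs_in_arith[OF R])
    assume "v \<noteq> w"
    then show "degree (M v w) < 1" by (simp add: M_def)
  qed (use V in auto)
qed

lemma algebraic_int_iff_integral: "algebraic_int x \<longleftrightarrow> integral_over \<int> x"
  by (auto simp: integral_over_def coeffs_in_def algebraic_int.simps)

lemma algebraic_int_power_reduce:
  assumes "algebraic_int (\<alpha> :: complex)"
  obtains d c where "d > 0" "\<alpha> ^ d = (\<Sum>k<d. c k * \<alpha> ^ k)" "\<And>k. c k \<in> \<int>"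
proof -
  obtain p where p: "lead_coeff p = 1" "coeffs_in \<int> p" "poly p \<alpha> = 0"
    using assms unfolding algebraic_int_iff_integral integral_over_def by blast
  have "degree p > 0"
  proof (rule ccontr)
    assume "\<not> degree p > 0"
    then obtain a where "p = [:a:]" by (meson degree_eq_zeroE not_gr_zero)
    then show False using p by auto
  qed
  moreover have "0 = (\<Sum>k<degree p. coeff p k * \<alpha> ^ k) + \<alpha> ^ degree p"
    using p by (simp add: poly_altdef lessThan_Suc_atMost[symmetric])
  then have "\<alpha> ^ degree p = (\<Sum>k<degree p. - coeff p k * \<alpha> ^ k)"
    unfolding mult_minus_left sum_negf by (metis add.commute eq_neg_iff_add_eq_0)
  ultimately show ?thesis using that[of "degree p" "\<lambda>k. - coeff p k"] p(2) by (auto simp: coeffs_in_def)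
qed

interpretation zmod: rmod \<int> "(*)"
  by (rule rmod_mult[OF subring_Ints])

text \<open>Each new element \<open>\<alpha>\<close> contributes the factors
  \<open>\<alpha> ^ k\<close> with \<open>k\<close> below the degree of a monic equation, which
  rewrites \<open>\<alpha> ^ d\<close>.\<close>

lemma finite_integral_module:
  assumes "finite S" "\<And>s. s \<in> S \<Longrightarrow> algebraic_int s"
  obtains P where "finite P" "1 \<in> P" "\<And>s p. s \<in> S \<Longrightarrow> p \<in> P \<Longrightarrow> s * p \<in> zmod.rspan P"
proof -
  have "\<exists>P. finite P \<and> 1 \<in> P \<and> (\<forall>s\<in>S. \<forall>p\<in>P. s * p \<in> zmod.rspan P)"
    using assms
  proof (induction rule: finite_induct)
    case empty
    show ?case by (intro exI[of _ "{1}"]) auto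
  next
    case (insert \<alpha> S)
    obtain P where P: "finite P" "1 \<in> P" "\<And>s p. s \<in> S \<Longrightarrow> p \<in> P \<Longrightarrow> s * p \<in> zmod.rspan P"
      using insert by auto
    obtain d c where d: "d > 0" "\<alpha> ^ d = (\<Sum>k<d. c k * \<alpha> ^ k)" "\<And>k. c k \<in> \<int>"
      using algebraic_int_power_reduce insert.prems by blast
    define Q where "Q = (\<lambda>(p, k). p * \<alpha> ^ k) ` (P \<times> {..<d})"
    have QI: "p * \<alpha> ^ k \<in> Q" if "p \<in> P" "k < d" for p k using that by (force simp: Q_def)
    have "s * q \<in> zmod.rspan Q" if "s \<in> insert \<alpha> S" "q \<in> Q" for s q
    proof -
      obtain p k where pk: "p \<in> P" "k < d" "q = p * \<alpha> ^ k" using \<open>q \<in> Q\<close> by (auto simp: Q_def)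
      show ?thesis
      proof (cases "s \<in> S")
        case True
        have "(s * p) * \<alpha> ^ k \<in> zmod.rspan Q"
          by (rule zmod.rspan_hom[OF P(3)[OF True pk(1)], where f = "\<lambda>u. u * \<alpha> ^ k"])
            (use pk in \<open>auto simp: algebra_simps intro: zmod.rspan_base QI\<close>)
        then show ?thesis using pk by (simp add: mult.assoc)
      next
        case False
        then have s: "s = \<alpha>" using that by simp
        show ?thesis
        proof (cases "Suc k < d")
          case True
          then have "p * \<alpha> ^ Suc k \<in> zmod.rspan Q" using QI[OF pk(1)] zmod.rspan_base by blast
          then show ?thesis using pk s by (simp add: algebra_simps)
        next
          case False
          then have "Suc k = d" using pk by simp
          then have "\<alpha> * q = p * \<alpha> ^ d" using pk by (auto simp: algebra_simps)
          also have "\<dots> = (\<Sum>k<d. c k * (p * \<alpha> ^ k))" by (simp add: d(2) sum_distrib_left algebra_simps)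
          also have "\<dots> \<in> zmod.rspan Q"
            using QI[OF pk(1)] d(3) by (intro zmod.rspan_sum zmod.rspan_scale zmod.rspan_base) auto
          finally show ?thesis using s by simp
        qed
      qed
    qed
    moreover have "finite Q" using P by (simp add: Q_def)
    moreover have "1 \<in> Q" using QI[OF P(2) d(1)] by simp
    ultimately show ?case by blast
  qed
  then show ?thesis using that by blast
qed

lemma zspan_mult_closed:
  assumes "\<And>p. p \<in> P \<Longrightarrow> (s :: complex) * p \<in> zmod.rspan P" "u \<in> zmod.rspan P"
  shows "s * u \<in> zmod.rspan P"
  by (rule zmod.rspan_hom[OF assms(2), where f = "(*) s"]) (use assms in \<open>auto simp: algebra_simps\<close>)

lemma subring_algebraic_int: "subring {x. algebraic_int x}"
proof -
  have "algebraic_int (x + y) \<and> algebraic_int (x * y)" if xy: "algebraic_int x" "algebraic_int y" for x y :: complex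
  proof -
    obtain P where P: "finite P" "1 \<in> P" "\<And>s p. s \<in> {x, y} \<Longrightarrow> p \<in> P \<Longrightarrow> s * p \<in> zmod.rspan P"
      by (rule finite_integral_module[of "{x, y}"]) (use xy in auto)
    have "(x + y) * p \<in> zmod.rspan P" if "p \<in> P" for p
      using P(3) that by (simp add: distrib_right zmod.rspan_add)
    moreover have "x * y * p \<in> zmod.rspan P" if "p \<in> P" for p
      using zspan_mult_closed[OF P(3) P(3), of x y p] that by (simp add: mult.assoc)
    ultimately show ?thesis
      unfolding algebraic_int_iff_integral
      using integral_over_span[OF subring_Ints P(1,2) one_neq_zero] by blast
  qed
  then show ?thesis unfolding subring_def by (auto simp: int_imp_algebraic_int)
qed

text \<open>Transitivity of integrality: the finitely many coefficients stabilize the integer span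
  of some finite \<open>P\<close>, so the products of \<open>P\<close> and \<open>V\<close> span a
  group stable under \<open>x\<close>.\<close>

lemma algebraic_int_span:
  assumes V: "finite V" "z \<in> V" "z \<noteq> 0"
    and x: "\<And>v. v \<in> V \<Longrightarrow> x * v \<in> rmod.rspan {x. algebraic_int x} (*) V"
  shows "algebraic_int x"
proof -
  interpret amod: rmod "{x. algebraic_int x}" "(*)" by (rule rmod_mult[OF subring_algebraic_int])
  have "\<forall>v. \<exists>c. v \<in> V \<longrightarrow> (\<forall>w. algebraic_int (c w)) \<and> x * v = (\<Sum>w\<in>V. c w * w)"
    using x unfolding amod.rspan_finite[OF V(1)] mem_Collect_eq by blast
  from choice[OF this] obtain c where c: "\<And>v. v \<in> V \<Longrightarrow> (\<forall>w. algebraic_int (c v w)) \<and> x * v = (\<Sum>w\<in>V. c v w * w)"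
    by blast
  define S where "S = (\<lambda>(v, w). c v w) ` (V \<times> V)"
  obtain P where P: "finite P" "1 \<in> P" "\<And>s p. s \<in> S \<Longrightarrow> p \<in> P \<Longrightarrow> s * p \<in> zmod.rspan P"
    by (rule finite_integral_module[of S]) (use V c in \<open>auto simp: S_def\<close>)
  define W where "W = (\<lambda>(p, v). p * v) ` (P \<times> V)"
  have WI: "p * v \<in> W" if "p \<in> P" "v \<in> V" for p v using that by (force simp: W_def)
  show ?thesis unfolding algebraic_int_iff_integral
  proof (rule integral_over_span[OF subring_Ints])
    show "finite W" using P V by (simp add: W_def)
    show "z \<in> W" using WI[OF P(2) V(2)] by simp
    fix q assume "q \<in> W"
    then obtain p v where pv: "p \<in> P" "v \<in> V" "q = p * v" by (auto simp: W_def)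
    have "x * q = p * (x * v)" by (simp add: pv)
    also have "\<dots> = (\<Sum>w\<in>V. (c v w * p) * w)" using c[OF pv(2)] by (simp add: sum_distrib_left algebra_simps)
    also have "\<dots> \<in> zmod.rspan W"
    proof (rule zmod.rspan_sum)
      fix w assume w: "w \<in> V"
      have "c v w * p \<in> zmod.rspan P" using P(3)[of "c v w" p] pv w by (force simp: S_def)
      then show "c v w * p * w \<in> zmod.rspan W"
        by (rule zmod.rspan_hom[where f = "\<lambda>u. u * w"]) (use w in \<open>auto simp: algebra_simps intro: zmod.rspan_base WI\<close>)
    qed
    finally show "x * q \<in> zmod.rspan W" .
  qed (use V in auto)
qed

section \<open>Embeddings of subfields and their extension\<close>

lemma embeddingD:
  assumes "embedding K \<sigma>"
  shows "\<sigma> 1 = 1" "x \<in> K \<Longrightarrow> y \<in> K \<Longrightarrow> \<sigma> (x + y) = \<sigma> x + \<sigma> y" "x \<in> K \<Longrightarrow> y \<in> K \<Longrightarrow> \<sigma> (x * y) = \<sigma> x * \<sigma> y"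
  using assms by (auto simp: embedding_def)

lemma subfieldD:
  assumes "subfield K"
  shows "0 \<in> K" "1 \<in> K" "x \<in> K \<Longrightarrow> y \<in> K \<Longrightarrow> x + y \<in> K" "x \<in> K \<Longrightarrow> y \<in> K \<Longrightarrow> x * y \<in> K"
    "x \<in> K \<Longrightarrow> - x \<in> K" "x \<in> K \<Longrightarrow> inverse x \<in> K" "x \<in> K \<Longrightarrow> y \<in> K \<Longrightarrow> x - y \<in> K" "x \<in> K \<Longrightarrow> y \<in> K \<Longrightarrow> x / y \<in> K"
proof -
  show "x \<in> K \<Longrightarrow> y \<in> K \<Longrightarrow> x - y \<in> K" using subringD(6)[OF subfield_subring[OF assms]] .
  show "x \<in> K \<Longrightarrow> y \<in> K \<Longrightarrow> x / y \<in> K" using assms by (auto simp: subfield_def divide_inverse)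
qed (use assms in \<open>auto simp: subfield_def\<close>)

locale emb =
  fixes K :: "complex set" and \<sigma> :: "complex \<Rightarrow> complex"
  assumes K: "subfield K" and emb: "embedding K \<sigma>"
begin

lemmas emb_one = embeddingD(1)[OF emb] and emb_add = embeddingD(2)[OF emb] and emb_mult = embeddingD(3)[OF emb]

lemma emb_zero: "\<sigma> 0 = 0"
  using emb_add[of 0 0] subfieldD[OF K] by simp

lemma emb_minus: "x \<in> K \<Longrightarrow> \<sigma> (- x) = - \<sigma> x"
  using emb_add[of x "- x"] subfieldD[OF K] emb_zero by (simp add: add_eq_0_iff)

lemma emb_diff: "x \<in> K \<Longrightarrow> y \<in> K \<Longrightarrow> \<sigma> (x - y) = \<sigma> x - \<sigma> y"
  using emb_add[of x "- y"] emb_minus subfieldD[OF K] by simp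

lemma emb_inverse: "x \<in> K \<Longrightarrow> \<sigma> (inverse x) = inverse (\<sigma> x)"
proof (cases "x = 0")
  case False
  assume x: "x \<in> K"
  then have "\<sigma> x * \<sigma> (inverse x) = 1"
    using emb_mult[of x "inverse x"] False emb_one subfieldD[OF K] by simp
  then show ?thesis by (metis inverse_unique)
qed (simp add: emb_zero)

lemma emb_eq_iff: "x \<in> K \<Longrightarrow> y \<in> K \<Longrightarrow> \<sigma> x = \<sigma> y \<longleftrightarrow> x = y"
proof
  assume h: "x \<in> K" "y \<in> K" "\<sigma> x = \<sigma> y"
  show "x = y"
  proof (rule ccontr)
    assume "x \<noteq> y"
    then have "\<sigma> (x - y) * \<sigma> (inverse (x - y)) = 1"
      using emb_mult[of "x - y" "inverse (x - y)"] h emb_one subfieldD[OF K] by simp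
    then show False using h emb_diff by simp
  qed
qed simp

lemma emb_eq_0_iff: "x \<in> K \<Longrightarrow> \<sigma> x = 0 \<longleftrightarrow> x = 0"
  using emb_eq_iff[of x 0] subfieldD[OF K] emb_zero by simp

lemma emb_sum: "(\<And>i. i \<in> A \<Longrightarrow> f i \<in> K) \<Longrightarrow> \<sigma> (sum f A) = (\<Sum>i\<in>A. \<sigma> (f i))"
proof (induction A rule: infinite_finite_induct)
  case (insert a A)
  then show ?case using emb_add[of "f a" "sum f A"] subring_sum[OF subfield_subring[OF K], of A f] by simp
qed (simp_all add: emb_zero)

lemma emb_power: "x \<in> K \<Longrightarrow> \<sigma> (x ^ n) = \<sigma> x ^ n"
  by (induction n) (auto simp: emb_one emb_mult subring_power subfield_subring K)

lemma emb_of_nat: "of_nat n \<in> K \<and> \<sigma> (of_nat n) = of_nat n"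
  by (induction n) (auto simp: emb_zero emb_one emb_add subfieldD[OF K])

lemma emb_of_int: "of_int n \<in> K \<and> \<sigma> (of_int n) = of_int n"
  by (cases n) (use emb_of_nat emb_minus subfieldD[OF K] in \<open>auto simp del: of_nat_Suc\<close>)

lemma emb_of_rat: "of_rat r \<in> K \<and> \<sigma> (of_rat r) = of_rat r"
proof -
  obtain a b where r: "r = of_int a / of_int b" by (metis Fract_of_int_quotient Rat_cases)
  have "of_rat r = of_int a * inverse (of_int b :: complex)" unfolding r of_rat_divide by (simp add: divide_inverse)
  then show ?thesis using emb_of_int subfieldD[OF K] emb_mult emb_inverse by simp
qed

lemma map_poly_arith:
  assumes "coeffs_in K p" "coeffs_in K q"
  shows "map_poly \<sigma> (p + q) = map_poly \<sigma> p + map_poly \<sigma> q" "map_poly \<sigma> (p - q) = map_poly \<sigma> p - map_poly \<sigma> q"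
    "map_poly \<sigma> (p * q) = map_poly \<sigma> p * map_poly \<sigma> q"
proof -
  have "\<sigma> (\<Sum>i\<le>n. coeff p i * coeff q (n - i)) = (\<Sum>i\<le>n. \<sigma> (coeff p i) * \<sigma> (coeff q (n - i)))" for n
    using assms by (subst emb_sum) (auto simp: coeffs_in_def emb_mult subfieldD[OF K])
  then show "map_poly \<sigma> (p * q) = map_poly \<sigma> p * map_poly \<sigma> q"
    by (intro poly_eqI) (simp add: coeff_map_poly emb_zero coeff_mult)
qed (use assms in \<open>auto intro!: poly_eqI simp: coeff_map_poly emb_zero coeffs_in_def emb_add emb_diff\<close>)

lemma emb_poly:
  assumes "coeffs_in K p" "x \<in> K"
  shows "\<sigma> (poly p x) = poly (map_poly \<sigma> p) (\<sigma> x)"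
proof -
  have d: "degree (map_poly \<sigma> p) = degree p"
  proof (cases "p = 0")
    case False
    then have "coeff (map_poly \<sigma> p) (degree p) \<noteq> 0"
      using assms(1) emb_eq_0_iff by (simp add: coeff_map_poly emb_zero coeffs_in_def)
    moreover have "degree (map_poly \<sigma> p) \<le> degree p"
      by (intro degree_le) (simp add: coeff_map_poly emb_zero coeff_eq_0)
    ultimately show ?thesis by (metis le_antisym le_degree)
  qed simp
  show ?thesis unfolding poly_altdef d
    by (subst emb_sum) (use assms in \<open>auto simp: coeffs_in_def coeff_map_poly emb_zero emb_mult emb_power
        subfieldD[OF K] subring_power subfield_subring K\<close>)
qed

lemma emb_algebraic_int:
  assumes "x \<in> K" "algebraic_int x"
  shows "algebraic_int (\<sigma> x)"
proof -
  obtain p where p: "lead_coeff p = 1" "\<And>i. coeff p i \<in> \<int>" "poly p x = 0"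
    using assms(2) by (auto elim: algebraic_int.cases)
  have "coeffs_in K p" using p(2) emb_of_int unfolding coeffs_in_def by (metis Ints_cases)
  moreover have "map_poly \<sigma> p = p"
    by (intro poly_eqI) (metis Ints_cases emb_of_int p(2) coeff_map_poly emb_zero)
  ultimately have "poly p (\<sigma> x) = 0" using emb_poly[of p x] assms p(3) emb_zero by simp
  then show ?thesis using p by (auto simp: algebraic_int.simps)
qed

end

lemma number_field_subfield: "number_field K \<Longrightarrow> subfield K"
  by (simp add: number_field_def)

lemma Rats_in_subfield: "subfield K \<Longrightarrow> \<rat> \<subseteq> K"
  using emb.emb_of_rat[of K id] by (auto simp: emb_def embedding_def Rats_def)

lemma number_field_algebraic:
  assumes "number_field K" "x \<in> K"
  shows "integral_over \<rat> x"
proof -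
  obtain B where B: "finite B" "B \<subseteq> K" "\<And>x. x \<in> K \<Longrightarrow> \<exists>c. x = (\<Sum>b\<in>B. of_rat (c b) * b)"
    using assms by (auto simp: number_field_def)
  interpret rmod \<rat> "(*)" by (rule rmod_mult[OF subring_Rats])
  have sp: "y \<in> rspan B" if y: "y \<in> K" for y
  proof -
    obtain c where "y = (\<Sum>b\<in>B. of_rat (c b) * b)" using B(3)[OF y] by blast
    then show ?thesis unfolding rspan_finite[OF B(1)] by (intro exI[of _ "\<lambda>b. of_rat (c b)"]) auto
  qed
  note K = subfieldD[OF number_field_subfield[OF assms(1)]]
  have "\<exists>z\<in>B. z \<noteq> 0"
  proof (rule ccontr)
    assume n: "\<not> (\<exists>z\<in>B. z \<noteq> 0)"
    obtain c where "1 = (\<Sum>b\<in>B. of_rat (c b) * b)" using B(3)[OF K(2)] by blast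
    also have "\<dots> = 0" using n by (intro sum.neutral) auto
    finally show False by simp
  qed
  then obtain z where "z \<in> B" "z \<noteq> 0" by blast
  then show ?thesis
    using integral_over_span[OF subring_Rats B(1)] sp K(4) assms(2) B(2) by blast
qed

text \<open>If the constant coefficient is nonzero, the equation expresses \<open>inverse y\<close>
  as a polynomial in \<open>y\<close>; otherwise a factor \<open>y\<close> can be cancelled.\<close>

lemma inverse_in_subring:
  assumes R: "subring R" "\<rat> \<subseteq> R" and y: "y \<in> R" "y \<noteq> 0"
    and p: "coeffs_in \<rat> p" "p \<noteq> 0" "poly p y = 0"
  shows "inverse y \<in> R"
  using p
proof (induction p rule: pCons_induct)
  case (pCons a p)
  have cp: "coeffs_in \<rat> p" "a \<in> \<rat>"
    using pCons.prems(1) unfolding coeffs_in_def by (metis coeff_pCons_Suc, metis coeff_pCons_0)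
  show ?case
  proof (cases "a = 0")
    case True
    then show ?thesis using pCons cp y by auto
  next
    case False
    have "y * poly p y = - a" using pCons.prems(3) by (simp add: add_eq_0_iff)
    then have "inverse y = (- inverse a) * poly p y" using y False by (simp add: field_simps)
    moreover have "poly p y \<in> R"
      using cp R y by (intro poly_in_subring) (auto simp: coeffs_in_def)
    moreover have "- inverse a \<in> R" using R cp by (intro subringD(5)[OF R(1)]) auto
    ultimately show ?thesis using subringD(4)[OF R(1)] by metis
  qed
qed simp

text \<open>The usual extension to the field generated by \<open>\<beta>\<close>: elements are
  values \<open>poly q \<beta>\<close>, and \<open>\<beta>\<close> goes to a root
  \<open>\<gamma>\<close> of the image of its minimal polynomial.\<close>

lemma extend_embedding_simple:
  assumes E: "subfield E" "E \<subseteq> K" and nf: "number_field K" and \<tau>: "embedding E \<tau>" and \<beta>: "\<beta> \<in> K"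
  obtains E' \<tau>' where "subfield E'" "E \<subseteq> E'" "E' \<subseteq> K" "\<beta> \<in> E'" "embedding E' \<tau>'" "\<And>x. x \<in> E \<Longrightarrow> \<tau>' x = \<tau> x"
proof -
  interpret emb E \<tau> using E \<tau> by unfold_locales
  note E' = subfieldD[OF E(1)] and sub = subfield_subring[OF E(1)]
  have KK: "subfield K" using nf by (rule number_field_subfield)
  obtain p0 where p0: "lead_coeff p0 = 1" "coeffs_in \<rat> p0" "poly p0 \<beta> = 0"
    using number_field_algebraic[OF nf \<beta>] by (auto simp: integral_over_def)
  let ?P = "\<lambda>p. coeffs_in E p \<and> p \<noteq> 0 \<and> poly p \<beta> = 0"
  have "?P p0" using p0 Rats_in_subfield[OF E(1)] by (auto simp: coeffs_in_def)
  then obtain p where p: "?P p" "\<And>q. ?P q \<Longrightarrow> degree p \<le> degree q"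
    using ex_has_least_nat[of ?P p0 degree] by blast
  have dp: "degree p > 0"
  proof (rule ccontr)
    assume "\<not> degree p > 0"
    then obtain a where "p = [:a:]" by (meson degree_eq_zeroE not_gr_zero)
    then show False using p by auto
  qed
  have lp: "coeff p (degree p) \<in> E" "coeff p (degree p) \<noteq> 0" using p(1) by (auto simp: coeffs_in_def)
  have "coeff (map_poly \<tau> p) (degree p) \<noteq> 0"
    using lp emb_eq_0_iff by (simp add: coeff_map_poly emb_zero)
  then have "degree (map_poly \<tau> p) > 0" using dp le_degree by (metis gr_zeroI le_zero_eq not_gr_zero)
  then obtain \<gamma> where \<gamma>: "poly (map_poly \<tau> p) \<gamma> = 0"
    by (metis constant_degree fundamental_theorem_of_algebra not_gr_zero)
  \<comment> \<open>Division by \<open>p\<close>, one leading term at a time. Minimality of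
    \<open>degree p\<close> guarantees that the leading term of a nonzero \<open>q\<close> can be
    cancelled.\<close>
  have A: "poly (map_poly \<tau> q) \<gamma> = 0" if "coeffs_in E q" "poly q \<beta> = 0" for q
    using that
  proof (induction "degree q" arbitrary: q rule: less_induct)
    case less
    show ?case
    proof (cases "q = 0")
      case False
      then have le: "degree p \<le> degree q" using p(2) less.prems by blast
      define c where "c = coeff q (degree q) / coeff p (degree p)"
      define m where "m = monom c (degree q - degree p)"
      define q1 where "q1 = q - m * p"
      have "c \<in> E" using less.prems(1) lp(1) E'(8) by (auto simp: c_def coeffs_in_def)
      then have m: "coeffs_in E m" unfolding m_def by (rule coeffs_in_arith(6)[OF sub])
      have mp: "coeffs_in E (m * p)" using m p(1) by (intro coeffs_in_arith(3)[OF sub]) auto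
      have q1: "coeffs_in E q1" unfolding q1_def by (rule coeffs_in_arith(2)[OF sub less.prems(1) mp])
      have q1\<beta>: "poly q1 \<beta> = 0" using less.prems p by (simp add: q1_def)
      have "coeff q1 (degree q) = 0" using le lp by (simp add: q1_def m_def coeff_monom_mult c_def)
      moreover have "degree q1 \<le> degree q" unfolding q1_def
      proof (rule degree_diff_le)
        have "degree (m * p) \<le> (degree q - degree p) + degree p"
          unfolding m_def by (rule order.trans[OF degree_mult_le]) (simp add: degree_monom_le)
        then show "degree (m * p) \<le> degree q" using le by simp
      qed simp
      ultimately have "q1 = 0 \<or> degree q1 < degree q"
        by (metis le_neq_implies_less leading_coeff_0_iff)
      then have "poly (map_poly \<tau> q1) \<gamma> = 0" using less.hyps q1 q1\<beta> by auto
      moreover have "q = q1 + m * p" by (simp add: q1_def)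
      then have "map_poly \<tau> q = map_poly \<tau> q1 + map_poly \<tau> m * map_poly \<tau> p"
        using map_poly_arith(1)[OF q1 mp] map_poly_arith(3)[OF m] p(1) by simp
      ultimately show ?thesis using \<gamma> by simp
    qed simp
  qed
  define F where "F = {poly q \<beta> | q. coeffs_in E q}"
  have FI: "poly q \<beta> \<in> F" if "coeffs_in E q" for q using that by (auto simp: F_def)
  have FE: "\<exists>q. coeffs_in E q \<and> x = poly q \<beta>" if "x \<in> F" for x using that by (auto simp: F_def)
  have cst: "coeffs_in E [:x:]" if "x \<in> E" for x using coeffs_in_arith(4,5)[OF sub] that by blast
  have EF: "E \<subseteq> F" using FI[OF cst] by auto
  have FK: "F \<subseteq> K"
    using poly_in_subring[OF subfield_subring[OF KK] _ \<beta>] E(2) by (auto simp: F_def coeffs_in_def)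
  have F: "x + y \<in> F \<and> x * y \<in> F" if xy: "x \<in> F" "y \<in> F" for x y
  proof -
    obtain q r where qr: "coeffs_in E q" "x = poly q \<beta>" "coeffs_in E r" "y = poly r \<beta>"
      using FE[OF xy(1)] FE[OF xy(2)] by blast
    show ?thesis using FI[OF coeffs_in_arith(1)[OF sub qr(1,3)]] FI[OF coeffs_in_arith(3)[OF sub qr(1,3)]]
      by (simp add: qr)
  qed
  have Fm: "- x \<in> F" if "x \<in> F" for x
    using F[of "- 1" x] EF E'(2,5) that by (auto simp: subset_iff)
  have Fr: "subring F" unfolding subring_def using F Fm EF E'(1,2) by blast
  have Fi: "inverse x \<in> F" if x: "x \<in> F" for x
  proof (cases "x = 0")
    case True
    then show ?thesis using x by simp
  next
    case False
    obtain r where r: "lead_coeff r = 1" "coeffs_in \<rat> r" "poly r x = 0"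
      using number_field_algebraic[OF nf] x FK by (auto simp: integral_over_def)
    have "r \<noteq> 0" using r(1) by auto
    moreover have "\<rat> \<subseteq> F" using Rats_in_subfield[OF E(1)] EF by blast
    ultimately show ?thesis using inverse_in_subring[OF Fr _ x False r(2)] r(3) by blast
  qed
  have Ff: "subfield F" unfolding subfield_def using F Fm Fi EF E'(1,2) by blast
  \<comment> \<open>An arbitrary representing polynomial is chosen; \<open>A\<close>, applied to a
    difference, shows in \<open>T\<close> that the choice does not matter.\<close>
  define \<tau>' where "\<tau>' z = poly (map_poly \<tau> (SOME q. coeffs_in E q \<and> poly q \<beta> = z)) \<gamma>" for z
  have T: "\<tau>' (poly q \<beta>) = poly (map_poly \<tau> q) \<gamma>" if q: "coeffs_in E q" for q
  proof -
    define r where "r = (SOME r. coeffs_in E r \<and> poly r \<beta> = poly q \<beta>)"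
    have r: "coeffs_in E r \<and> poly r \<beta> = poly q \<beta>" unfolding r_def by (rule someI[of _ q]) (use q in simp)
    have "poly (map_poly \<tau> (r - q)) \<gamma> = 0"
      using r q by (intro A coeffs_in_arith(2)[OF sub]) auto
    then show ?thesis using map_poly_arith(2)[of r q] r q by (simp add: \<tau>'_def r_def)
  qed
  have T2: "\<tau>' x = \<tau> x" if "x \<in> E" for x
    using T[OF cst[OF that]] by (simp add: map_poly_pCons emb_zero)
  have "embedding F \<tau>'" unfolding embedding_def
  proof (intro conjI ballI)
    show "\<tau>' 1 = 1" using T2[OF E'(2)] emb_one by simp
    fix x y assume xy: "x \<in> F" "y \<in> F"
    obtain q r where qr: "coeffs_in E q" "x = poly q \<beta>" "coeffs_in E r" "y = poly r \<beta>"
      using FE[OF xy(1)] FE[OF xy(2)] by blast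
    show "\<tau>' (x + y) = \<tau>' x + \<tau>' y"
      using T[OF coeffs_in_arith(1)[OF sub qr(1,3)]] T[OF qr(1)] T[OF qr(3)] map_poly_arith(1)[OF qr(1,3)]
      by (simp add: qr)
    show "\<tau>' (x * y) = \<tau>' x * \<tau>' y"
      using T[OF coeffs_in_arith(3)[OF sub qr(1,3)]] T[OF qr(1)] T[OF qr(3)] map_poly_arith(3)[OF qr(1,3)]
      by (simp add: qr)
  qed
  moreover have "\<beta> \<in> F" using FI[OF coeffs_in_arith(6)[OF sub E'(2), of 1]] by (simp add: poly_monom)
  ultimately show ?thesis using that Ff EF FK T2 by blast
qed

theorem extend_embedding:
  assumes E: "subfield E" "E \<subseteq> K" and K: "number_field K" and \<tau>: "embedding E \<tau>"
  obtains \<tau>' where "embedding K \<tau>'" "\<And>x. x \<in> E \<Longrightarrow> \<tau>' x = \<tau> x"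
proof -
  obtain B where B: "finite B" "B \<subseteq> K" "\<And>x. x \<in> K \<Longrightarrow> \<exists>c. x = (\<Sum>b\<in>B. of_rat (c b) * b)"
    using K by (auto simp: number_field_def)
  have "\<exists>E' \<tau>'. subfield E' \<and> E \<subseteq> E' \<and> E' \<subseteq> K \<and> C \<subseteq> E' \<and> embedding E' \<tau>' \<and> (\<forall>x\<in>E. \<tau>' x = \<tau> x)"
    if "finite C" "C \<subseteq> K" for C
    using that
  proof (induction C rule: finite_induct)
    case empty
    then show ?case using E \<tau> by blast
  next
    case (insert b C)
    then obtain E1 \<tau>1 where 1: "subfield E1" "E \<subseteq> E1" "E1 \<subseteq> K" "C \<subseteq> E1" "embedding E1 \<tau>1" "\<forall>x\<in>E. \<tau>1 x = \<tau> x"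
      by auto
    obtain E2 \<tau>2 where 2: "subfield E2" "E1 \<subseteq> E2" "E2 \<subseteq> K" "b \<in> E2" "embedding E2 \<tau>2" "\<And>x. x \<in> E1 \<Longrightarrow> \<tau>2 x = \<tau>1 x"
      using extend_embedding_simple[OF 1(1,3) K 1(5), of b] insert.prems by blast
    show ?case using 1 2 by (intro exI[of _ E2] exI[of _ \<tau>2]) auto
  qed
  then obtain E' \<tau>' where E': "subfield E'" "E' \<subseteq> K" "B \<subseteq> E'" "embedding E' \<tau>'" "\<forall>x\<in>E. \<tau>' x = \<tau> x"
    using B(1,2) by metis
  have "K \<subseteq> E'"
  proof
    fix x assume "x \<in> K"
    from B(3)[OF this] obtain c where c: "x = (\<Sum>b\<in>B. of_rat (c b) * b)" by blast
    have "of_rat r \<in> E'" for r using Rats_in_subfield[OF E'(1)] by auto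
    then show "x \<in> E'" unfolding c
      using E'(3) by (intro subring_sum[OF subfield_subring[OF E'(1)]] subfieldD(4)[OF E'(1)]) auto
  qed
  then have "E' = K" using E'(2) by blast
  then show ?thesis using that E' by blast
qed

interpretation qvec: vector_space "\<lambda>(r::rat) (x::complex). of_rat r * x"
  by unfold_locales (auto simp: algebra_simps of_rat_add of_rat_mult)

text \<open>By dimension: a rationally independent subset of \<open>F\<close> lies in the span of a
  finite set, so a maximal one is finite.\<close>

lemma number_field_subset:
  assumes "subfield F" "F \<subseteq> K" "number_field K"
  shows "number_field F"
proof -
  obtain B where B: "finite B" "B \<subseteq> K" "\<And>x. x \<in> K \<Longrightarrow> \<exists>c. x = (\<Sum>b\<in>B. of_rat (c b) * b)"
    using assms(3) by (auto simp: number_field_def)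
  obtain C where C: "C \<subseteq> F" "qvec.independent C" "F \<subseteq> qvec.span C"
    by (rule qvec.maximal_independent_subset)
  have "K \<subseteq> qvec.span B"
  proof
    fix x assume "x \<in> K"
    from B(3)[OF this] show "x \<in> qvec.span B" unfolding qvec.span_finite[OF B(1)] by auto
  qed
  then have "finite C" using qvec.independent_span_bound[OF B(1) C(2)] C(1) assms(2) by blast
  moreover have "\<exists>c. x = (\<Sum>b\<in>C. of_rat (c b) * b)" if "x \<in> F" for x
    using that C(3) unfolding qvec.span_finite[OF \<open>finite C\<close>] by auto
  ultimately show ?thesis unfolding number_field_def using assms(1) C(1) by blast
qed

lemma (in emb) subfield_image: "subfield (\<sigma> ` K)"
  unfolding subfield_def
proof (intro conjI ballI)
  show "0 \<in> \<sigma> ` K" using emb_zero subfieldD(1)[OF K] by (metis imageI)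
  show "1 \<in> \<sigma> ` K" using emb_one subfieldD(2)[OF K] by (metis imageI)
qed (use subfieldD[OF K] in \<open>auto simp: emb_minus[symmetric] emb_inverse[symmetric] emb_add[symmetric] emb_mult[symmetric]\<close>)

lemma (in emb) number_field_image:
  assumes "number_field K"
  shows "number_field (\<sigma> ` K)"
proof -
  obtain B where B: "finite B" "B \<subseteq> K" "\<And>x. x \<in> K \<Longrightarrow> \<exists>c. x = (\<Sum>b\<in>B. of_rat (c b) * b)"
    using assms by (auto simp: number_field_def)
  have inj: "inj_on \<sigma> K" by (rule inj_onI) (simp add: emb_eq_iff)
  then have injB: "inj_on \<sigma> B" using B(2) inj_on_subset by blast
  have "\<exists>c. \<sigma> x = (\<Sum>b\<in>\<sigma> ` B. of_rat (c b) * b)" if x: "x \<in> K" for x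
  proof -
    obtain c where c: "x = (\<Sum>b\<in>B. of_rat (c b) * b)" using B(3)[OF x] by blast
    have "\<sigma> x = (\<Sum>b\<in>B. of_rat (c b) * \<sigma> b)"
      unfolding c by (subst emb_sum) (use B(2) emb_of_rat subfieldD[OF K] emb_mult in \<open>auto simp: subset_iff\<close>)
    also have "\<dots> = (\<Sum>b\<in>\<sigma> ` B. of_rat (c (the_inv_into B \<sigma> b)) * b)"
      using injB by (simp add: sum.reindex the_inv_into_f_f)
    finally show ?thesis by (intro exI[of _ "c \<circ> the_inv_into B \<sigma>"]) simp
  qed
  then show ?thesis unfolding number_field_def using B(1,2) subfield_image
    by (intro conjI exI[of _ "\<sigma> ` B"]) auto
qed

lemma (in emb) embedding_inverse: "embedding (\<sigma> ` K) (the_inv_into K \<sigma>)"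
proof -
  have inj: "inj_on \<sigma> K" by (rule inj_onI) (simp add: emb_eq_iff)
  note inv = the_inv_into_f_f[OF inj]
  show ?thesis unfolding embedding_def
  proof (intro conjI ballI)
    show "the_inv_into K \<sigma> 1 = 1" using inv[of 1] emb_one subfieldD(2)[OF K] by simp
    fix x y assume "x \<in> \<sigma> ` K" "y \<in> \<sigma> ` K"
    then obtain u v where uv: "u \<in> K" "v \<in> K" "x = \<sigma> u" "y = \<sigma> v" by blast
    show "the_inv_into K \<sigma> (x + y) = the_inv_into K \<sigma> x + the_inv_into K \<sigma> y"
      using inv[of "u + v"] inv[OF uv(1)] inv[OF uv(2)] emb_add uv subfieldD[OF K] by simp
    show "the_inv_into K \<sigma> (x * y) = the_inv_into K \<sigma> x * the_inv_into K \<sigma> y"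
      using inv[of "u * v"] inv[OF uv(1)] inv[OF uv(2)] emb_mult uv subfieldD[OF K] by simp
  qed
qed

lemma embedding_comp:
  assumes "embedding K \<sigma>" "embedding (\<sigma> ` K) \<tau>"
  shows "embedding K (\<tau> \<circ> \<sigma>)"
  using assms by (auto simp: embedding_def)

lemma embedding_subset: "embedding K \<sigma> \<Longrightarrow> F \<subseteq> K \<Longrightarrow> embedding F \<sigma>"
  by (auto simp: embedding_def)

lemma embedding_cnj: "embedding K \<sigma> \<Longrightarrow> embedding K (cnj \<circ> \<sigma>)"
  by (auto simp: embedding_def)

lemma embedding_id: "embedding K (\<lambda>x. x)"
  by (auto simp: embedding_def)

definition gen_field :: "complex set \<Rightarrow> complex set" where
  "gen_field T = \<Inter> {F. subfield F \<and> T \<subseteq> F}"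

lemma subfield_gen_field: "subfield (gen_field T)"
  unfolding gen_field_def subfield_def by blast

lemma gen_field_base: "T \<subseteq> gen_field T"
  by (auto simp: gen_field_def)

lemma gen_field_least: "subfield F \<Longrightarrow> T \<subseteq> F \<Longrightarrow> gen_field T \<subseteq> F"
  by (auto simp: gen_field_def)

lemma embeddings_agree_on_gen_field:
  assumes "embedding (gen_field T) \<sigma>" "embedding (gen_field T) \<tau>" "\<And>t. t \<in> T \<Longrightarrow> \<sigma> t = \<tau> t" "x \<in> gen_field T"
  shows "\<sigma> x = \<tau> x"
proof -
  let ?F = "gen_field T"
  interpret s: emb ?F \<sigma> using assms subfield_gen_field by unfold_locales
  interpret t: emb ?F \<tau> using assms subfield_gen_field by unfold_locales
  note F = subfieldD[OF subfield_gen_field[of T]]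
  have "subfield {x \<in> ?F. \<sigma> x = \<tau> x}"
    unfolding subfield_def using F
    by (auto simp: s.emb_zero t.emb_zero s.emb_one t.emb_one s.emb_add t.emb_add s.emb_mult t.emb_mult
        s.emb_minus t.emb_minus s.emb_inverse t.emb_inverse)
  then have "?F \<subseteq> {x \<in> ?F. \<sigma> x = \<tau> x}"
    using gen_field_base assms(3) by (intro gen_field_least) blast+
  then show ?thesis using assms(4) by blast
qed

text \<open>The embedding and its conjugate agree on the generators, hence everywhere.\<close>

lemma real_on_gen_field:
  assumes "embedding (gen_field T) \<sigma>" "\<And>t. t \<in> T \<Longrightarrow> Im (\<sigma> t) = 0"
  shows "real_emb (gen_field T) \<sigma>"
proof -
  have "\<sigma> x = (cnj \<circ> \<sigma>) x" if "x \<in> gen_field T" for x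
    by (rule embeddings_agree_on_gen_field[OF assms(1) embedding_cnj[OF assms(1)] _ that])
      (use assms(2) in \<open>auto simp: complex_eq_iff\<close>)
  then have "Im (\<sigma> x) = Im (cnj (\<sigma> x))" if "x \<in> gen_field T" for x using that by (metis comp_apply)
  then show ?thesis unfolding real_emb_def by simp
qed

subsection \<open>Subgroups of finite index\<close>

text \<open>Coset representatives instead of cosets, the form in which transitivity, powers and
  Schreier generators are direct. For subgroups it is equivalent to
  \<open>fin_index\<close>.\<close>

definition fidx :: "('a, 'b) monoid_scheme \<Rightarrow> 'a set \<Rightarrow> 'a set \<Rightarrow> bool" where
  "fidx G H K \<longleftrightarrow> (\<exists>T. finite T \<and> T \<subseteq> K \<and> (\<forall>k\<in>K. \<exists>h\<in>H. \<exists>t\<in>T. k = h \<otimes>\<^bsub>G\<^esub> t))"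

context group
begin

lemma fidx_map:
  assumes K: "subgroup K G" and fin: "finite (f ` K)"
    and f: "\<And>g k. g \<in> K \<Longrightarrow> k \<in> K \<Longrightarrow> f g = f k \<Longrightarrow> g \<otimes> inv k \<in> H"
  shows "fidx G H K"
proof -
  define r where "r y = (SOME k. k \<in> K \<and> f k = y)" for y
  have r: "r y \<in> K \<and> f (r y) = y" if y: "y \<in> f ` K" for y
  proof -
    obtain k where "k \<in> K \<and> f k = y" using y by blast
    then show ?thesis unfolding r_def by (rule someI)
  qed
  have "\<exists>h\<in>H. \<exists>t\<in>r ` f ` K. k = h \<otimes> t" if k: "k \<in> K" for k
  proof (intro bexI)
    note r1 = r[OF imageI[OF k]]
    show "k \<otimes> inv (r (f k)) \<in> H" by (rule f) (use k r1 in auto)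
    show "k = k \<otimes> inv (r (f k)) \<otimes> r (f k)"
      using k r1 subgroup.mem_carrier[OF K] by (simp add: m_assoc)
  qed (use k in blast)
  then show ?thesis unfolding fidx_def using fin r by (intro exI[of _ "r ` f ` K"]) auto
qed

lemma fin_index_imp_fidx:
  assumes "subgroup H G" "subgroup K G" "fin_index G H K"
  shows "fidx G H K"
proof (rule fidx_map[OF assms(2), where f = "\<lambda>k. H #> k"])
  show "finite ((\<lambda>k. H #> k) ` K)" using assms(3) by (simp add: fin_index_def)
  fix g k assume gk: "g \<in> K" "k \<in> K" "H #> g = H #> k"
  then have c: "g \<in> carrier G" "k \<in> carrier G" using subgroup.mem_carrier[OF assms(2)] by auto
  have "g \<in> H #> k" using rcos_self[OF c(1) assms(1)] gk(3) by simp
  then obtain h where "h \<in> H" "g = h \<otimes> k" by (auto simp: r_coset_def)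
  then show "g \<otimes> inv k \<in> H" using c subgroup.mem_carrier[OF assms(1)] by (simp add: m_assoc)
qed

lemma fidx_imp_fin_index:
  assumes H: "subgroup H G" and K: "subgroup K G" and f: "fidx G H K"
  shows "fin_index G H K"
proof -
  obtain T where T: "finite T" "T \<subseteq> K" "\<And>k. k \<in> K \<Longrightarrow> \<exists>h\<in>H. \<exists>t\<in>T. k = h \<otimes> t"
    using f by (auto simp: fidx_def)
  have "H #> k \<in> (\<lambda>t. H #> t) ` T" if "k \<in> K" for k
  proof -
    from T(3)[OF that] obtain h t where ht: "h \<in> H" "t \<in> T" "k = h \<otimes> t" by blast
    have c: "h \<in> carrier G" "t \<in> carrier G"
      using ht subgroup.mem_carrier[OF H] subgroup.mem_carrier[OF K] T(2) by auto
    have "H #> k = (H #> h) #> t" using ht c subgroup.subset[OF H] by (simp add: coset_mult_assoc)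
    also have "H #> h = H" using ht(1) c(1) H by (simp add: coset_join2)
    finally show ?thesis using ht(2) by blast
  qed
  then have "(\<lambda>k. H #> k) ` K \<subseteq> (\<lambda>t. H #> t) ` T" by blast
  then show ?thesis unfolding fin_index_def using T(1) finite_surj by blast
qed

lemma fidx_trans:
  assumes "subgroup H G" "subgroup K G" "subgroup L G" "K \<subseteq> L" "fidx G H K" "fidx G K L"
  shows "fidx G H L"
proof -
  obtain T where T: "finite T" "T \<subseteq> K" "\<And>k. k \<in> K \<Longrightarrow> \<exists>h\<in>H. \<exists>t\<in>T. k = h \<otimes> t"
    using assms(5) by (auto simp: fidx_def)
  obtain U where U: "finite U" "U \<subseteq> L" "\<And>k. k \<in> L \<Longrightarrow> \<exists>h\<in>K. \<exists>t\<in>U. k = h \<otimes> t"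
    using assms(6) by (auto simp: fidx_def)
  define V where "V = (\<lambda>(t, u). t \<otimes> u) ` (T \<times> U)"
  have "\<exists>h\<in>H. \<exists>v\<in>V. k = h \<otimes> v" if "k \<in> L" for k
  proof -
    from U(3)[OF that] obtain x u where 1: "x \<in> K" "u \<in> U" "k = x \<otimes> u" by blast
    from T(3)[OF 1(1)] obtain h t where 2: "h \<in> H" "t \<in> T" "x = h \<otimes> t" by blast
    have "h \<in> carrier G" "t \<in> carrier G" "u \<in> carrier G"
      using 1 2 T(2) U(2) subgroup.mem_carrier[OF assms(1)] subgroup.mem_carrier[OF assms(2)]
        subgroup.mem_carrier[OF assms(3)] by blast+
    then have "k = h \<otimes> (t \<otimes> u)" using 1 2 by (simp add: m_assoc)
    moreover have "t \<otimes> u \<in> V" using 1 2 by (force simp: V_def)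
    ultimately show ?thesis using 2 by blast
  qed
  moreover have "finite V" using T U by (simp add: V_def)
  moreover have "V \<subseteq> L" using T(2) U(2) assms(4) subgroup.m_closed[OF assms(3)] by (force simp: V_def subset_iff)
  ultimately show ?thesis unfolding fidx_def by blast
qed

text \<open>Two powers of \<open>g\<close> share a representative, and their quotient lies in
  \<open>H\<close>.\<close>

lemma fidx_power:
  assumes H: "subgroup H G" and K: "subgroup K G" and "fidx G H K" and g: "g \<in> K"
  obtains m :: nat where "m > 0" "g [^] m \<in> H"
proof -
  obtain T where T: "finite T" "T \<subseteq> K" "\<And>k. k \<in> K \<Longrightarrow> \<exists>h\<in>H. \<exists>t\<in>T. k = h \<otimes> t"
    using assms(3) by (auto simp: fidx_def)
  have gc: "g \<in> carrier G" using g subgroup.mem_carrier[OF K] by blast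
  have pow: "g [^] n \<in> K" for n :: nat
    by (induction n) (auto simp: subgroup.one_closed[OF K] subgroup.m_closed[OF K] g)
  have "\<forall>n :: nat. \<exists>t. t \<in> T \<and> (\<exists>h\<in>H. g [^] n = h \<otimes> t)" using T(3)[OF pow] by blast
  from choice[OF this] obtain t where t: "\<And>n :: nat. t n \<in> T \<and> (\<exists>h\<in>H. g [^] n = h \<otimes> t n)" by blast
  have "\<not> inj t"
  proof
    assume "inj t"
    moreover have "finite (range t)" by (rule finite_subset[OF _ T(1)]) (use t in auto)
    ultimately show False using finite_imageD by fastforce
  qed
  then obtain a b where ab: "a < b" "t a = t b" unfolding inj_def by (metis linorder_neqE_nat)
  obtain h where h: "h \<in> H" "g [^] a = h \<otimes> t a" using t by blast
  obtain h' where h': "h' \<in> H" "g [^] b = h' \<otimes> t a" using t[of b] ab by auto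
  have c: "t a \<in> carrier G" "h \<in> carrier G" "h' \<in> carrier G"
    using t T(2) h(1) h'(1) subgroup.mem_carrier[OF H] subgroup.mem_carrier[OF K] by blast+
  have "g [^] (b - a) \<otimes> g [^] a = g [^] b" using gc ab by (simp add: nat_pow_mult)
  then have "g [^] (b - a) = g [^] b \<otimes> inv (g [^] a)" using gc by (metis inv_solve_right nat_pow_closed)
  also have "\<dots> = h' \<otimes> t a \<otimes> (inv (t a) \<otimes> inv h)" unfolding h h' using c by (simp add: inv_mult_group)
  also have "\<dots> = h' \<otimes> (t a \<otimes> inv (t a)) \<otimes> inv h" using c by (simp only: m_assoc inv_closed m_closed)
  also have "\<dots> = h' \<otimes> inv h" using c by simp
  finally have "g [^] (b - a) \<in> H"
    using h(1) h'(1) subgroup.m_closed[OF H] subgroup.m_inv_closed[OF H] by simp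
  then show ?thesis using that ab by (metis zero_less_diff)
qed

lemma conj_group:
  assumes "x \<in> carrier G" "a \<in> carrier G" "b \<in> carrier G"
  shows "x \<otimes> (a \<otimes> b) \<otimes> inv x = (x \<otimes> a \<otimes> inv x) \<otimes> (x \<otimes> b \<otimes> inv x)"
proof -
  have "(x \<otimes> a \<otimes> inv x) \<otimes> (x \<otimes> b \<otimes> inv x) = x \<otimes> a \<otimes> (inv x \<otimes> x) \<otimes> b \<otimes> inv x"
    using assms by (simp only: m_assoc inv_closed m_closed)
  then show ?thesis using assms by (simp add: m_assoc)
qed

text \<open>\<open>N\<close> collects the elements all of whose conjugates lie in \<open>H\<close>.
  It contains \<open>g \<otimes> inv k\<close> whenever \<open>g\<close> and \<open>k\<close>
  permute the finitely many cosets of \<open>H\<close> in the same way.\<close>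

lemma normal_core:
  assumes H: "subgroup H G" and K: "subgroup K G" and HK: "H \<subseteq> K" and "fidx G H K"
  obtains N where "subgroup N G" "N \<subseteq> H" "fidx G N K" "\<And>k n. k \<in> K \<Longrightarrow> n \<in> N \<Longrightarrow> k \<otimes> n \<otimes> inv k \<in> N"
proof -
  define N where "N = {n \<in> K. \<forall>k\<in>K. k \<otimes> n \<otimes> inv k \<in> H}"
  note Hc = subgroup.mem_carrier[OF H] and Kc = subgroup.mem_carrier[OF K]
  have NH: "N \<subseteq> H"
  proof
    fix n assume n: "n \<in> N"
    then have "\<one> \<otimes> n \<otimes> inv \<one> \<in> H" using subgroup.one_closed[OF K] unfolding N_def by blast
    then show "n \<in> H" using n Kc by (simp add: N_def)
  qed
  have N: "subgroup N G"
  proof (rule subgroupI)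
    show "N \<subseteq> carrier G" using NH Hc by blast
    have "\<one> \<in> N" unfolding N_def using subgroup.one_closed[OF K] subgroup.one_closed[OF H] Kc by auto
    then show "N \<noteq> {}" by blast
  next
    fix a assume a: "a \<in> N"
    have "k \<otimes> inv a \<otimes> inv k \<in> H" if k: "k \<in> K" for k
    proof -
      have "k \<otimes> inv a \<otimes> inv k = inv (k \<otimes> a \<otimes> inv k)"
        using k a Kc by (simp add: N_def inv_mult_group m_assoc)
      then show ?thesis using a k subgroup.m_inv_closed[OF H] by (simp add: N_def)
    qed
    then show "inv a \<in> N" using a subgroup.m_inv_closed[OF K] by (simp add: N_def)
  next
    fix a b assume ab: "a \<in> N" "b \<in> N"
    have "k \<otimes> (a \<otimes> b) \<otimes> inv k \<in> H" if "k \<in> K" for k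
      using conj_group[of k a b] ab that Kc subgroup.m_closed[OF H] by (auto simp: N_def)
    then show "a \<otimes> b \<in> N" using ab subgroup.m_closed[OF K] by (simp add: N_def)
  qed
  have nrm: "k \<otimes> n \<otimes> inv k \<in> N" if k: "k \<in> K" and n: "n \<in> N" for k n
  proof -
    have nK: "n \<in> K" using n by (simp add: N_def)
    have "x \<otimes> (k \<otimes> n \<otimes> inv k) \<otimes> inv x \<in> H" if x: "x \<in> K" for x
    proof -
      have "x \<otimes> (k \<otimes> n \<otimes> inv k) \<otimes> inv x = (x \<otimes> k) \<otimes> n \<otimes> inv (x \<otimes> k)"
        using x k nK Kc by (simp add: inv_mult_group m_assoc)
      then show ?thesis using n subgroup.m_closed[OF K x k] by (simp add: N_def)
    qed
    then show ?thesis using k nK subgroup.m_closed[OF K] subgroup.m_inv_closed[OF K] by (simp add: N_def)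
  qed
  define Q where "Q = (\<lambda>k. H #> k) ` K"
  have Q: "finite Q" using fidx_imp_fin_index[OF H K assms(4)] by (simp add: Q_def fin_index_def)
  \<comment> \<open>The fixed value \<open>{}\<close> outside \<open>Q\<close> places these maps in
    a finite set of functions.\<close>
  define f where "f g = (\<lambda>X. if X \<in> Q then X #> g else {})" for g
  have cos: "(H #> x) #> g = H #> (x \<otimes> g)" if "x \<in> K" "g \<in> K" for x g
    using that Kc subgroup.subset[OF H] by (simp add: coset_mult_assoc)
  have "f ` K \<subseteq> {h. \<forall>X. (X \<in> Q \<longrightarrow> h X \<in> Q) \<and> (X \<notin> Q \<longrightarrow> h X = {})}"
    using cos subgroup.m_closed[OF K] by (auto simp: f_def Q_def)
  then have fin: "finite (f ` K)" using finite_set_of_finite_funs[OF Q Q] finite_subset by blast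
  have "fidx G N K"
  proof (rule fidx_map[OF K fin])
    fix g k assume gk: "g \<in> K" "k \<in> K" "f g = f k"
    have "x \<otimes> (g \<otimes> inv k) \<otimes> inv x \<in> H" if x: "x \<in> K" for x
    proof -
      have xQ: "H #> x \<in> Q" using x by (simp add: Q_def)
      have "f g (H #> x) = f k (H #> x)" using gk(3) by simp
      then have "H #> (x \<otimes> g) = H #> (x \<otimes> k)" using xQ cos x gk by (simp add: f_def)
      then have "x \<otimes> g \<in> H #> (x \<otimes> k)"
        using rcos_self[of "x \<otimes> g" H] H x gk Kc by simp
      then obtain h where h: "h \<in> H" "x \<otimes> g = h \<otimes> (x \<otimes> k)" by (auto simp: r_coset_def)
      have "x \<otimes> (g \<otimes> inv k) \<otimes> inv x = (x \<otimes> g) \<otimes> inv (x \<otimes> k)"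
        using x gk Kc by (simp add: inv_mult_group m_assoc)
      also have "\<dots> = h" unfolding h(2) using h(1) Hc x gk Kc by (simp add: m_assoc)
      finally show ?thesis using h(1) by simp
    qed
    then show "g \<otimes> inv k \<in> N"
      using gk subgroup.m_closed[OF K] subgroup.m_inv_closed[OF K] by (simp add: N_def)
  qed
  then show ?thesis using that N NH nrm by blast
qed

text \<open>Schreier's argument: with \<open>n k\<close> a chosen \<open>N\<close>-part of
  \<open>k\<close>, a product \<open>h \<otimes> t \<otimes> s\<close> can be rewritten as
  \<open>h'\<close> times a representative at the cost of one generator
  \<open>n (t \<otimes> s)\<close>.\<close>

lemma fidx_fin_gen:
  assumes S: "finite S" "S \<subseteq> carrier G" and N: "subgroup N G" "N \<subseteq> generate G S" and fi: "fidx G N (generate G S)"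
  obtains S' where "finite S'" "S' \<subseteq> N" "N = generate G S'"
proof -
  let ?K = "generate G S"
  have K: "subgroup ?K G" by (rule generate_is_subgroup[OF S(2)])
  note Kc = subgroup.mem_carrier[OF K] and Nc = subgroup.mem_carrier[OF N(1)]
  obtain T0 where T0: "finite T0" "T0 \<subseteq> ?K" "\<And>k. k \<in> ?K \<Longrightarrow> \<exists>h\<in>N. \<exists>t\<in>T0. k = h \<otimes> t"
    using fi by (auto simp: fidx_def)
  define T where "T = insert \<one> T0"
  have T: "finite T" "T \<subseteq> ?K" using T0 subgroup.one_closed[OF K] by (auto simp: T_def)
  define S1 where "S1 = S \<union> (\<lambda>s. inv s) ` S"
  have S1: "finite S1" "S1 \<subseteq> ?K" using S(1) generate.incl[of _ S G] generate.inv[of _ S G] by (auto simp: S1_def)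
  have "\<forall>k. \<exists>h. k \<in> ?K \<longrightarrow> h \<in> N \<and> (\<exists>t\<in>T. k = h \<otimes> t)" using T0(3) unfolding T_def by blast
  from choice[OF this] obtain n where n: "\<And>k. k \<in> ?K \<Longrightarrow> n k \<in> N \<and> (\<exists>t\<in>T. k = n k \<otimes> t)" by blast
  \<comment> \<open>The set \<open>T \<inter> N\<close> is added because an element of
    \<open>N\<close> may be written with a nontrivial representative, which then lies in
    \<open>N\<close> itself. \<open>\<one>\<close> was put into \<open>T\<close> to start the
    rewriting.\<close>
  define S' where "S' = (\<lambda>(t, s). n (t \<otimes> s)) ` (T \<times> S1) \<union> (T \<inter> N)"
  have ts: "t \<otimes> s \<in> ?K" if "t \<in> T" "s \<in> S1" for t s
    using that T(2) S1(2) subgroup.m_closed[OF K] by blast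
  have S'N: "S' \<subseteq> N" using n ts by (auto simp: S'_def)
  have finS': "finite S'" using T S1 by (simp add: S'_def)
  let ?N1 = "generate G S'"
  have S'c: "S' \<subseteq> carrier G" using S'N Nc by blast
  have N1: "subgroup ?N1 G" by (rule generate_is_subgroup[OF S'c])
  have N1N: "?N1 \<subseteq> N" by (rule generate_subgroup_incl[OF S'N N(1)])
  have step: "\<exists>h'\<in>?N1. \<exists>t'\<in>T. h \<otimes> t \<otimes> s = h' \<otimes> t'" if h: "h \<in> ?N1" "t \<in> T" and s: "s \<in> S1" for h t s
  proof -
    have ns: "n (t \<otimes> s) \<in> ?N1" using h s by (intro generate.incl) (force simp: S'_def)
    obtain t' where t': "t' \<in> T" "t \<otimes> s = n (t \<otimes> s) \<otimes> t'" using n[OF ts[OF h(2) s]] by blast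
    have c: "h \<in> carrier G" "t \<in> carrier G" "s \<in> carrier G" "t' \<in> carrier G" "n (t \<otimes> s) \<in> carrier G"
      using h s t' ns T(2) S1(2) Kc subgroup.mem_carrier[OF N1] by blast+
    have "h \<otimes> t \<otimes> s = h \<otimes> (n (t \<otimes> s) \<otimes> t')" using c t'(2) by (simp add: m_assoc)
    also have "\<dots> = (h \<otimes> n (t \<otimes> s)) \<otimes> t'" using c by (simp add: m_assoc)
    finally show ?thesis using subgroup.m_closed[OF N1 h(1) ns] t'(1) by blast
  qed
  have all: "\<exists>h'\<in>?N1. \<exists>t'\<in>T. h \<otimes> t \<otimes> k = h' \<otimes> t'" if "k \<in> ?K" "h \<in> ?N1" "t \<in> T" for k h t
    using that
  proof (induction arbitrary: h t rule: generate.induct)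
    case one
    then show ?case using T(2) Kc subgroup.mem_carrier[OF N1] by (metis m_closed r_one subsetD)
  next
    case (incl s)
    then show ?case using step by (auto simp: S1_def)
  next
    case (inv s)
    then show ?case using step by (auto simp: S1_def)
  next
    case (eng k1 k2)
    obtain h1 t1 where 1: "h1 \<in> ?N1" "t1 \<in> T" "h \<otimes> t \<otimes> k1 = h1 \<otimes> t1" using eng.IH(1)[OF eng.prems] by blast
    obtain h2 t2 where 2: "h2 \<in> ?N1" "t2 \<in> T" "h1 \<otimes> t1 \<otimes> k2 = h2 \<otimes> t2" using eng.IH(2)[OF 1(1,2)] by blast
    have "h \<in> carrier G" "t \<in> carrier G" "k1 \<in> carrier G" "k2 \<in> carrier G"
      using eng Kc subgroup.mem_carrier[OF N1] T(2) by blast+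
    then have "h \<otimes> t \<otimes> (k1 \<otimes> k2) = h2 \<otimes> t2" using 1 2 by (simp add: m_assoc[symmetric])
    then show ?case using 2 by blast
  qed
  have "N \<subseteq> ?N1"
  proof
    fix k assume k: "k \<in> N"
    then obtain h t where ht: "h \<in> ?N1" "t \<in> T" "\<one> \<otimes> \<one> \<otimes> k = h \<otimes> t"
      using all[of k \<one> \<one>] N(2) subgroup.one_closed[OF N1] by (auto simp: T_def)
    have c: "k \<in> carrier G" "h \<in> carrier G" "t \<in> carrier G"
      using k ht T(2) Nc Kc subgroup.mem_carrier[OF N1] by blast+
    have k': "k = h \<otimes> t" using ht c by simp
    then have "t = inv h \<otimes> k" using c by (simp add: m_assoc[symmetric])
    then have "t \<in> N" using ht(1) N1N k subgroup.m_closed[OF N(1)] subgroup.m_inv_closed[OF N(1)] by blast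
    then have "t \<in> ?N1" using ht(2) by (intro generate.incl) (simp add: S'_def)
    then show "k \<in> ?N1" using k' subgroup.m_closed[OF N1 ht(1)] by simp
  qed
  then show ?thesis using that finS' S'N N1N by blast
qed

end

section \<open>Inverses, products and powers in \<open>SLG C\<close> and \<open>SL2\<close>\<close>

lemma real_mat_mk: "real_mat (mk a b c d) \<longleftrightarrow> Im a = 0 \<and> Im b = 0 \<and> Im c = 0 \<and> Im d = 0"
  by (auto simp: real_mat_def forall_2)

lemma real_mat_mult: "real_mat M \<Longrightarrow> real_mat N \<Longrightarrow> real_mat (M ** N)"
  by (cases M rule: mk_cases, cases N rule: mk_cases) (simp add: real_mat_mk)

lemma real_mat_sl2_inv: "real_mat M \<Longrightarrow> real_mat (sl2_inv M)"
  by (cases M rule: mk_cases) (simp add: real_mat_mk)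

lemma real_mat_one: "real_mat (mat 1)"
  by (simp add: mat_mk real_mat_mk)

lemma mpow_commute: "M ** mpow M n = mpow M n ** M"
proof (induction n)
  case (Suc n)
  have "M ** (M ** mpow M n) = M ** (mpow M n ** M)" using Suc by simp
  then show ?case by (simp add: matrix_mul_assoc)
qed simp

lemma group_SLG: "group (SLG C)"
proof (rule groupI)
  fix x assume x: "x \<in> carrier (SLG C)"
  show "\<exists>y\<in>carrier (SLG C). y \<otimes>\<^bsub>SLG C\<^esub> x = \<one>\<^bsub>SLG C\<^esub>"
    by (rule bexI[of _ "\<lambda>i. sl2_inv (x i)"]) (use x in \<open>auto simp: SLG_def sl2_inv_left real_mat_sl2_inv\<close>)
qed (auto simp: SLG_def det_mul matrix_mul_assoc real_mat_mult real_mat_one)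

lemma inv_SLG: "x \<in> carrier (SLG C) \<Longrightarrow> inv\<^bsub>SLG C\<^esub> x = (\<lambda>i. sl2_inv (x i))"
  by (rule group.inv_equality[OF group_SLG]) (auto simp: SLG_def sl2_inv_left real_mat_sl2_inv)

lemma mult_SLG: "x \<otimes>\<^bsub>SLG C\<^esub> y = (\<lambda>i. x i ** y i)"
  by (simp add: SLG_def)

lemma one_SLG: "\<one>\<^bsub>SLG C\<^esub> = (\<lambda>i. mat 1)"
  by (simp add: SLG_def)

lemma pow_SLG: "x [^]\<^bsub>SLG C\<^esub> (n :: nat) = (\<lambda>i. mpow (x i) n)"
  by (induction n) (simp_all add: mpow_commute mult_SLG one_SLG)

lemma group_SL2: "group SL2"
proof (rule groupI)
  fix x assume x: "x \<in> carrier SL2"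
  show "\<exists>y\<in>carrier SL2. y \<otimes>\<^bsub>SL2\<^esub> x = \<one>\<^bsub>SL2\<^esub>"
    by (rule bexI[of _ "sl2_inv x"]) (use x in \<open>auto simp: SL2_def sl2_inv_left\<close>)
qed (auto simp: SL2_def det_mul matrix_mul_assoc)

lemma inv_SL2: "x \<in> carrier SL2 \<Longrightarrow> inv\<^bsub>SL2\<^esub> x = sl2_inv x"
  by (rule group.inv_equality[OF group_SL2]) (auto simp: SL2_def sl2_inv_left)

lemma mult_SL2: "x \<otimes>\<^bsub>SL2\<^esub> y = x ** y"
  by (simp add: SL2_def)

lemma pow_SL2: "x [^]\<^bsub>SL2\<^esub> (n :: nat) = mpow x n"
  by (induction n) (simp_all add: mpow_commute mult_SL2 SL2_def)

section \<open>Spans of matrices and the Cayley-Hamilton identity\<close>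

definition scm :: "complex \<Rightarrow> mat2 \<Rightarrow> mat2" where
  "scm c M = mat c ** M"

lemma scm_mk [simp]: "scm r (mk a b c d) = mk (r * a) (r * b) (r * c) (r * d)"
  by (simp add: scm_def mat_mk)

lemma rmod_scm: "subring R \<Longrightarrow> rmod R scm"
proof unfold_locales
  fix r s :: complex and v w :: mat2
  show "scm (r + s) v = scm r v + scm s v" "scm r (v + w) = scm r v + scm r w" "scm r (scm s v) = scm (r * s) v" "scm 1 v = v"
    by (cases v rule: mk_cases, cases w rule: mk_cases, simp add: algebra_simps)+
qed

lemma scm_mult: "scm r M ** N = scm r (M ** N)" "M ** scm r N = scm r (M ** N)"
  by (cases M rule: mk_cases, cases N rule: mk_cases, simp add: algebra_simps)+

lemma trace_scm [simp]: "trace (scm r M) = r * trace M"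
  by (cases M rule: mk_cases) (simp add: algebra_simps)

lemma trace_plus [simp]: "trace (M + N :: mat2) = trace M + trace N"
  by (cases M rule: mk_cases, cases N rule: mk_cases) simp

lemma mat2_distrib: "(M + N) ** P = M ** P + N ** P" "P ** (M + N) = P ** M + P ** N" for M N P :: mat2
  by (cases M rule: mk_cases, cases N rule: mk_cases, cases P rule: mk_cases, simp add: algebra_simps)+

text \<open>The polarization of \<open>x ** x = scm (trace x) x - scm (det x) (mat 1)\<close>: it
  exchanges two factors modulo shorter words.\<close>

lemma cayley_hamilton_polarized:
  "w ** x = scm (trace x) w + scm (trace w) x + scm (trace (x ** w) - trace x * trace w) (mat 1) - x ** w"
  by (cases x rule: mk_cases, cases w rule: mk_cases) (simp add: mat_mk algebra_simps)

lemma cayley_hamilton: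
  assumes "det x = 1"
  shows "x ** (x ** w) = scm (trace x) (x ** w) - w"
proof -
  have "x ** (x ** w) = scm (trace x) (x ** w) - scm (det x) w"
    by (cases x rule: mk_cases, cases w rule: mk_cases) (simp add: algebra_simps)
  also have "scm (det x) w = w" unfolding assms by (cases w rule: mk_cases) simp
  finally show ?thesis .
qed

text \<open>Products of the entries of a list in increasing order. By the polarized Cayley-Hamilton
  identity every word can be sorted modulo shorter words, so they span all words.\<close>
primrec sorted_words :: "mat2 list \<Rightarrow> mat2 set" where
  "sorted_words [] = {mat 1}"
| "sorted_words (x # L) = sorted_words L \<union> (\<lambda>m. x ** m) ` sorted_words L"

lemma finite_sorted_words: "finite (sorted_words L)"
  by (induction L) auto

lemma one_sorted_words: "mat 1 \<in> sorted_words L"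
  by (induction L) auto

lemma sorted_words_subset:
  assumes "mat 1 \<in> N" "\<And>x y. x \<in> N \<Longrightarrow> y \<in> N \<Longrightarrow> x ** y \<in> N" "set L \<subseteq> N"
  shows "sorted_words L \<subseteq> N"
  using assms(3) by (induction L) (use assms(1,2) in auto)

text \<open>A letter of the tail is absorbed by induction. The head \<open>x\<close> is moved left
  past a sorted word by the polarized identity, and a resulting square of \<open>x\<close> is
  reduced. All coefficients are polynomials in traces of elements of \<open>N\<close>, so they stay
  in \<open>R\<close>.\<close>

lemma sorted_words_closed:
  assumes R: "subring R" and one: "mat 1 \<in> N" and mult: "\<And>x y. x \<in> N \<Longrightarrow> y \<in> N \<Longrightarrow> x ** y \<in> N"
    and tr: "\<And>x. x \<in> N \<Longrightarrow> trace x \<in> R" and det: "\<And>x. x \<in> N \<Longrightarrow> det x = 1"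
    and "set L \<subseteq> N" "g \<in> set L" "w \<in> rmod.rspan R scm (sorted_words L)"
  shows "w ** g \<in> rmod.rspan R scm (sorted_words L)"
  using assms(6-)
proof (induction L arbitrary: g w)
  case Nil
  then show ?case by simp
next
  case (Cons x L)
  interpret rmod R scm by (rule rmod_scm[OF R])
  let ?W = "rspan (sorted_words L)" and ?W1 = "rspan (sorted_words (x # L))"
  have x: "x \<in> N" using Cons.prems by simp
  have LN: "sorted_words L \<subseteq> N" using Cons.prems sorted_words_subset[OF one mult] by simp
  have WW1: "?W \<subseteq> ?W1" by (rule rspan_subset) (auto intro: rspan_base)
  have xW: "x ** u \<in> ?W1" if "u \<in> ?W" for u
    by (rule rspan_hom[OF that, where f = "\<lambda>u. x ** u"])
      (auto simp: mat2_distrib scm_mult intro: rspan_base)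
  have one1: "mat 1 \<in> ?W1" using rspan_base[OF one_sorted_words] .
  have x1: "x \<in> ?W1" using xW[OF rspan_base[OF one_sorted_words]] by simp
  show ?case
  proof (rule rspan_hom[OF Cons.prems(3), where f = "\<lambda>u. u ** g"])
    fix v assume v: "v \<in> sorted_words (x # L)"
    show "v ** g \<in> ?W1"
    proof (cases "g \<in> set L")
      case True
      then have IH: "m ** g \<in> ?W" if "m \<in> sorted_words L" for m
        using Cons.IH[OF _ True rspan_base[OF that]] Cons.prems by simp
      from v consider "v \<in> sorted_words L" | m where "m \<in> sorted_words L" "v = x ** m" by auto
      then show ?thesis
      proof cases
        case 1
        then show ?thesis using IH WW1 by blast
      next
        case 2
        then show ?thesis using xW[OF IH] by (simp add: matrix_mul_assoc)
      qed
    next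
      case False
      then have g: "g = x" using Cons.prems by simp
      have mx: "m ** x \<in> ?W1" "x ** (m ** x) \<in> ?W1" if m: "m \<in> sorted_words L" for m
      proof -
        have mN: "m \<in> N" using m LN by blast
        have c: "trace x \<in> R" "trace m \<in> R" "trace (x ** m) - trace x * trace m \<in> R"
          using tr x mN mult subringD[OF R] by auto
        have m1: "m \<in> ?W1" "x ** m \<in> ?W1" using m by (auto intro: rspan_base)
        show "m ** x \<in> ?W1"
          unfolding cayley_hamilton_polarized[of m x]
          by (intro rspan_diff rspan_add rspan_scale c m1 x1 one1)
        have xx: "x ** x = scm (trace x) x - mat 1" using cayley_hamilton[OF det[OF x], of "mat 1"] by simp
        have diff: "x ** (a - b) = x ** a - x ** b" for a b :: mat2
          by (metis mat2_distrib(2) add_diff_cancel_right' diff_add_cancel)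
        have "x ** (m ** x) = scm (trace x) (x ** m) + scm (trace m) (scm (trace x) x - mat 1)
            + scm (trace (x ** m) - trace x * trace m) x - (scm (trace x) (x ** m) - m)"
          unfolding cayley_hamilton_polarized[of m x] diff mat2_distrib scm_mult xx cayley_hamilton[OF det[OF x]] by simp
        also have "\<dots> \<in> ?W1"
          by (intro rspan_diff rspan_add rspan_scale c m1 x1 one1)
        finally show "x ** (m ** x) \<in> ?W1" .
      qed
      from v show ?thesis unfolding g using mx by (auto simp: matrix_mul_assoc)
    qed
  qed (auto simp: mat2_distrib scm_mult)
qed

subsection \<open>Quaternion orders\<close>

text \<open>The library enumerates the indices as 1 to 4, the quaternion coordinates are numbered 0
  to 3.\<close>

lemma four_eq_zero: "(4 :: 4) = 0"
  by simp

lemma vec4_eq_iff: "(x :: complex^4) = y \<longleftrightarrow> x$0 = y$0 \<and> x$1 = y$1 \<and> x$2 = y$2 \<and> x$3 = y$3"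
  by (auto simp: vec_eq_iff forall_4 four_eq_zero)

lemma quat_alg_iff: "x \<in> quat_alg K \<longleftrightarrow> x$0 \<in> K \<and> x$1 \<in> K \<and> x$2 \<in> K \<and> x$3 \<in> K"
  by (auto simp: quat_alg_def forall_4 four_eq_zero)

lemma nrd_qmult: "nrd a b (qmult a b x y) = nrd a b x * nrd a b y"
  unfolding nrd_def qmult_def by (simp add: power2_eq_square algebra_simps)

lemma quat_alg_closed:
  assumes "subfield K" "x \<in> quat_alg K" "y \<in> quat_alg K" "a \<in> K" "b \<in> K" "c \<in> K"
  shows "x + y \<in> quat_alg K" "- x \<in> quat_alg K" "qmult a b x y \<in> quat_alg K" "(\<chi> t. c * x$t) \<in> quat_alg K"
  using assms subfieldD[OF assms(1)] by (auto simp: quat_alg_iff qmult_def)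

text \<open>Cyclic invariance of the trace against the sign of anticommutation makes each trace, up
  to a nonzero factor, its own negative.\<close>

lemma anticommuting_trace:
  fixes I J :: mat2
  assumes "I ** I = mat A" "J ** J = mat B" "I ** J = - (J ** I)" "A \<noteq> 0" "B \<noteq> 0"
  shows "trace I = 0" "trace J = 0" "trace (I ** J) = 0"
proof -
  have zero: "t = 0" if "t = - t" for t :: complex using that by simp
  obtain p q r s where I: "I = mk p q r s" by (rule mk_cases)
  obtain p' q' r' s' where J: "J = mk p' q' r' s'" by (rule mk_cases)
  have tn: "trace (- M) = - trace M" for M :: mat2 by (cases M rule: mk_cases) simp
  have "trace (I ** J) = - trace (I ** J)" using arg_cong[OF assms(3), of trace] by (simp add: tn trace_comm)
  then show "trace (I ** J) = 0" by (rule zero)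
  have neg: "(- M) ** N = - (M ** N)" "M ** (- N) = - (M ** N)" for M N :: mat2
    by (cases M rule: mk_cases, cases N rule: mk_cases, simp)+
  have "trace (I ** (J ** J)) = - trace (J ** I ** J)"
    using assms(3) by (simp add: matrix_mul_assoc neg tn)
  also have "trace (J ** I ** J) = trace (I ** (J ** J))"
    by (metis trace_comm matrix_mul_assoc)
  finally have "trace (I ** (J ** J)) = 0" by (rule zero)
  then have "B * trace I = 0" unfolding assms(2) by (simp add: I mat_mk algebra_simps)
  then show "trace I = 0" using assms(5) by simp
  have "trace ((I ** I) ** J) = - trace (I ** J ** I)"
    using assms(3) by (metis matrix_mul_assoc neg(2) tn minus_minus)
  also have "trace (I ** J ** I) = trace ((I ** I) ** J)"
    by (metis trace_comm matrix_mul_assoc)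
  finally have "trace ((I ** I) ** J) = 0" by (rule zero)
  then have "A * trace J = 0" unfolding assms(1) by (simp add: J mat_mk algebra_simps)
  then show "trace J = 0" using assms(4) by simp
qed

locale quat_rep = emb K \<phi> for K \<phi> +
  fixes a b :: complex and I J :: mat2
  assumes ab: "a \<in> K" "b \<in> K" "a \<noteq> 0" "b \<noteq> 0"
    and IJ: "I ** I = mat (\<phi> a)" "J ** J = mat (\<phi> b)" "I ** J = - (J ** I)"
begin

abbreviation rho :: "complex^4 \<Rightarrow> mat2" where "rho \<equiv> qrep \<phi> I J"

lemma rho_eq: "rho x = scm (\<phi> (x$0)) (mat 1) + scm (\<phi> (x$1)) I + scm (\<phi> (x$2)) J + scm (\<phi> (x$3)) (I ** J)"
  by (simp add: qrep_def scm_def)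

lemma \<phi>ab: "\<phi> a \<noteq> 0" "\<phi> b \<noteq> 0"
  using ab emb_eq_0_iff by auto

text \<open>With these coordinates multiplicativity of \<open>rho\<close> and the norm formula are
  polynomial consequences of three relations.\<close>

lemma basis_entries:
  obtains p q r s t u where "I = mk p q r (- p)" "J = mk s t u (- s)" "p * p + q * r = \<phi> a" "s * s + t * u = \<phi> b"
    "2 * p * s + q * u + r * t = 0"
proof -
  obtain p q r p' where I: "I = mk p q r p'" by (rule mk_cases)
  obtain s t u s' where J: "J = mk s t u s'" by (rule mk_cases)
  note tr = anticommuting_trace[OF IJ \<phi>ab]
  have "p' = - p" "s' = - s" using tr(1,2) by (auto simp: I J add_eq_0_iff)
  moreover have "p * p + q * r = \<phi> a" "s * s + t * u = \<phi> b" using IJ(1,2) by (auto simp: I J mat_mk)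
  moreover have "2 * p * s + q * u + r * t = 0" using tr(3) calculation by (simp add: I J algebra_simps)
  ultimately show ?thesis using that I J by simp
qed

lemma rho_add:
  assumes "x \<in> quat_alg K" "y \<in> quat_alg K"
  shows "rho (x + y) = rho x + rho y"
  using assms rmod.sc_add_left[OF rmod_scm[OF subfield_subring[OF K]]]
  by (simp add: rho_eq quat_alg_iff emb_add)

lemma rho_scale:
  assumes "c \<in> K" "x \<in> quat_alg K"
  shows "rho (\<chi> t. c * x$t) = scm (\<phi> c) (rho x)"
proof -
  interpret rmod UNIV scm by (rule rmod_scm) (simp add: subring_def)
  show ?thesis using assms by (simp add: rho_eq quat_alg_iff emb_mult sc_add_right sc_sc)
qed

lemma rho_uminus:
  assumes "x \<in> quat_alg K"
  shows "rho (- x) = - rho x"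
proof -
  interpret rmod UNIV scm by (rule rmod_scm) (simp add: subring_def)
  show ?thesis using assms by (simp add: rho_eq quat_alg_iff emb_minus sc_minus)
qed

lemma rho_one: "rho qone = mat 1"
  by (simp add: rho_eq qone_def emb_one emb_zero)
    (cases I rule: mk_cases, cases J rule: mk_cases, simp add: mat_mk)

lemma rho_trace: "trace (rho x) = 2 * \<phi> (x$0)"
  using anticommuting_trace[OF IJ \<phi>ab] by (simp add: rho_eq mat_mk)

lemma rho_mult:
  assumes "x \<in> quat_alg K" "y \<in> quat_alg K"
  shows "rho (qmult a b x y) = rho x ** rho y"
proof -
  obtain p q r s t u where e: "I = mk p q r (- p)" "J = mk s t u (- s)" "p * p + q * r = \<phi> a" "s * s + t * u = \<phi> b"
    "2 * p * s + q * u + r * t = 0" by (rule basis_entries)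
  have z: "x$0 \<in> K" "x$1 \<in> K" "x$2 \<in> K" "x$3 \<in> K" "y$0 \<in> K" "y$1 \<in> K" "y$2 \<in> K" "y$3 \<in> K"
    using assms by (auto simp: quat_alg_iff)
  note F = emb_add emb_mult emb_diff subfieldD[OF K] z ab
  define X0 X1 X2 X3 where X: "X0 = \<phi> (x$0)" "X1 = \<phi> (x$1)" "X2 = \<phi> (x$2)" "X3 = \<phi> (x$3)"
  define Y0 Y1 Y2 Y3 where Y: "Y0 = \<phi> (y$0)" "Y1 = \<phi> (y$1)" "Y2 = \<phi> (y$2)" "Y3 = \<phi> (y$3)"
  have q: "\<phi> (qmult a b x y $ 0) = X0*Y0 + \<phi> a*X1*Y1 + \<phi> b*X2*Y2 - \<phi> a*\<phi> b*X3*Y3"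
    "\<phi> (qmult a b x y $ 1) = X0*Y1 + X1*Y0 - \<phi> b*X2*Y3 + \<phi> b*X3*Y2"
    "\<phi> (qmult a b x y $ 2) = X0*Y2 + X2*Y0 + \<phi> a*X1*Y3 - \<phi> a*X3*Y1"
    "\<phi> (qmult a b x y $ 3) = X0*Y3 + X3*Y0 + X1*Y2 - X2*Y1"
    by (simp_all add: qmult_def F X Y)
  show ?thesis
    unfolding rho_eq
    unfolding q X[symmetric] Y[symmetric] e(1,2) mat_mk mk_mult scm_mk mk_arith mk_eq_iff e(3,4)[symmetric]
    using e(5) by (intro conjI; algebra)
qed

lemma rho_det:
  assumes "x \<in> quat_alg K"
  shows "det (rho x) = \<phi> (nrd a b x)"
proof -
  obtain p q r s t u where e: "I = mk p q r (- p)" "J = mk s t u (- s)" "p * p + q * r = \<phi> a" "s * s + t * u = \<phi> b"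
    "2 * p * s + q * u + r * t = 0" by (rule basis_entries)
  have z: "x$0 \<in> K" "x$1 \<in> K" "x$2 \<in> K" "x$3 \<in> K" using assms by (auto simp: quat_alg_iff)
  note F = emb_add emb_mult emb_diff subfieldD[OF K] z ab
  have n: "\<phi> (nrd a b x) = \<phi> (x$0) * \<phi> (x$0) - \<phi> a * \<phi> (x$1) * \<phi> (x$1) - \<phi> b * \<phi> (x$2) * \<phi> (x$2) + \<phi> a * \<phi> b * \<phi> (x$3) * \<phi> (x$3)"
    by (simp add: nrd_def power2_eq_square F mult.assoc)
  show ?thesis
    unfolding rho_eq
    unfolding n e(1,2) mat_mk mk_mult scm_mk mk_arith det_mk e(3,4)[symmetric]
    using e(5) by algebra
qed

lemma rho_sum:
  assumes "finite B" "B \<subseteq> quat_alg K" "\<And>v. c v \<in> K"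
  shows "(\<Sum>v\<in>B. (\<chi> t. c v * v$t)) \<in> quat_alg K \<and> rho (\<Sum>v\<in>B. (\<chi> t. c v * v$t)) = (\<Sum>v\<in>B. scm (\<phi> (c v)) (rho v))"
  using assms(1,2)
proof (induction rule: finite_induct)
  case empty
  have "0 \<in> quat_alg K" using subfieldD(1)[OF K] by (simp add: quat_alg_iff)
  moreover have "rho 0 = 0"
    by (simp add: rho_eq emb_zero) (cases I rule: mk_cases, cases J rule: mk_cases, simp add: mat_mk mk_zero)
  ultimately show ?case by simp
next
  case (insert v B)
  have v: "v \<in> quat_alg K" "(\<chi> t. c v * v$t) \<in> quat_alg K"
    using insert.prems quat_alg_closed(4)[OF K _ _ ab(1,2) assms(3)] by auto
  then show ?case
    using insert quat_alg_closed(1)[OF K v(2) _ ab(1,2) ab(1)] by (simp add: rho_add rho_scale assms(3))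
qed

end

text \<open>The eigenvector is a row, so that left multiplication by \<open>M\<close> becomes
  multiplication by \<open>l\<close> after applying the row.\<close>

lemma row_eigenvector:
  fixes M :: mat2
  assumes "det M = 1" "trace M = l + m" "l * m = 1"
  obtains e1 e2 where "e1 \<noteq> 0 \<or> e2 \<noteq> 0"
    "e1 * M$1$1 + e2 * M$2$1 = l * e1" "e1 * M$1$2 + e2 * M$2$2 = l * e2"
proof -
  obtain a b c d where M: "M = mk a b c d" by (rule mk_cases)
  have h: "a * d - b * c = 1" "a + d = l + m" using assms by (auto simp: M)
  \<comment> \<open>Two candidates, \<open>(c, l - a)\<close> and \<open>(l - d, b)\<close>. Both
    vanish only for a scalar matrix, where any row works.\<close>
  have 1: "c * a + (l - a) * c = l * c" "(l - d) * b + b * d = l * b" by (simp_all add: algebra_simps)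
  have 2: "c * b + (l - a) * d = l * (l - a)" using h assms(3) by algebra
  have 3: "(l - d) * a + b * c = l * (l - d)" using h assms(3) by algebra
  show ?thesis
  proof (cases "c \<noteq> 0 \<or> l - a \<noteq> 0")
    case True
    then show ?thesis using that[of c "l - a"] 1 2 by (auto simp: M)
  next
    case c: False
    show ?thesis
    proof (cases "l - d \<noteq> 0 \<or> b \<noteq> 0")
      case True
      then show ?thesis using that[of "l - d" b] 1 3 by (auto simp: M)
    next
      case False
      then show ?thesis using that[of 1 0] c by (auto simp: M)
    qed
  qed
qed

text \<open>A real square root gives a diagonal matrix with trace 0, and an antidiagonal one serves
  for the other generator. The contrapositive is what ramified places need: both values are
  negative.\<close>

lemma split_real_if_nonneg:
  assumes "Im (\<sigma> a) = 0" "Im (\<sigma> b) = 0" "Re (\<sigma> a) \<ge> 0 \<or> Re (\<sigma> b) \<ge> 0"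
  shows "split_real \<sigma> a b"
proof -
  have sq: "of_real (sqrt (Re z)) * of_real (sqrt (Re z)) = z" if "Im z = 0" "Re z \<ge> 0" for z
    using that by (simp add: complex_eq_iff)
  show ?thesis
  proof (cases "Re (\<sigma> a) \<ge> 0")
    case True
    define \<alpha> where "\<alpha> = complex_of_real (sqrt (Re (\<sigma> a)))"
    have "\<alpha> * \<alpha> = \<sigma> a" using sq assms(1) True by (simp add: \<alpha>_def)
    moreover have "Im \<alpha> = 0" by (simp add: \<alpha>_def)
    ultimately show ?thesis unfolding split_real_def
      by (intro exI[of _ "mk \<alpha> 0 0 (-\<alpha>)"] exI[of _ "mk 0 1 (\<sigma> b) 0"]) (use assms in \<open>simp add: real_mat_mk mat_mk\<close>)
  next
    case False
    define \<beta> where "\<beta> = complex_of_real (sqrt (Re (\<sigma> b)))"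
    have "\<beta> * \<beta> = \<sigma> b" using sq assms False by (simp add: \<beta>_def)
    moreover have "Im \<beta> = 0" by (simp add: \<beta>_def)
    ultimately show ?thesis unfolding split_real_def
      by (intro exI[of _ "mk 0 1 (\<sigma> a) 0"] exI[of _ "mk \<beta> 0 0 (-\<beta>)"]) (use assms in \<open>simp add: real_mat_mk mat_mk\<close>)
  qed
qed

text \<open>On real matrices of trace 0 the form given by the scalar \<open>M ** M\<close> has
  signature (2, 1), so two vectors with negative values cannot be orthogonal, whereas anticommuting
  matrices are.\<close>

lemma not_split_real_if_neg:
  assumes "Im (\<sigma> a) = 0" "Im (\<sigma> b) = 0" "Re (\<sigma> a) < 0" "Re (\<sigma> b) < 0"
  shows "\<not> split_real \<sigma> a b"
proof
  assume "split_real \<sigma> a b"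
  then obtain I J where IJ: "real_mat I" "real_mat J" "I ** I = mat (\<sigma> a)" "J ** J = mat (\<sigma> b)" "I ** J = - (J ** I)"
    by (auto simp: split_real_def)
  have ab: "\<sigma> a = of_real (Re (\<sigma> a))" "\<sigma> b = of_real (Re (\<sigma> b))" using assms by (simp_all add: complex_eq_iff)
  have n0: "\<sigma> a \<noteq> 0" "\<sigma> b \<noteq> 0" using assms by auto
  note tr = anticommuting_trace[OF IJ(3-5) n0]
  have real: "\<exists>p q r s. M = mk (of_real p) (of_real q) (of_real r) (of_real s)" if "real_mat M" for M
    using that by (cases M rule: mk_cases) (auto simp: real_mat_mk complex_eq_iff intro: exI[of _ "Re _"])
  obtain p q r p' where I: "I = mk (of_real p) (of_real q) (of_real r) (of_real p')" using real[OF IJ(1)] by blast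
  obtain s t u s' where J: "J = mk (of_real s) (of_real t) (of_real u) (of_real s')" using real[OF IJ(2)] by blast
  have "of_real (p + p') = (0 :: complex)" "of_real (s + s') = (0 :: complex)" using tr(1,2) by (simp_all add: I J)
  then have ps: "p' = - p" "s' = - s" by (simp_all only: of_real_eq_0_iff)
  have "of_real (p * p + q * r) = (of_real (Re (\<sigma> a)) :: complex)" "of_real (s * s + t * u) = (of_real (Re (\<sigma> b)) :: complex)"
    "of_real (2 * p * s + q * u + r * t) = (0 :: complex)"
    using IJ(3,4) tr(3) ab by (simp_all add: I J ps mat_mk algebra_simps)
  then have e: "p * p + q * r < 0" "s * s + t * u < 0" "q * u + r * t = - (2 * p * s)"
    using assms by (simp_all only: of_real_eq_iff of_real_eq_0_iff)
  have "p * p < - (q * r)" "s * s < - (t * u)" using e by linarith+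
  then have "(p * p) * (s * s) < (- (q * r)) * (- (t * u))"
    by (rule mult_strict_mono'[OF _ _ zero_le_square zero_le_square])
  moreover have "4 * ((- (q * r)) * (- (t * u))) = (q * u + r * t) * (q * u + r * t) - (q * u - r * t) * (q * u - r * t)"
    by (simp add: algebra_simps)
  ultimately have "4 * ((p * p) * (s * s)) < (q * u + r * t) * (q * u + r * t) - (q * u - r * t) * (q * u - r * t)"
    by linarith
  also have "\<dots> \<le> (q * u + r * t) * (q * u + r * t)" by simp
  also have "\<dots> = 4 * ((p * p) * (s * s))" unfolding e(3) by (simp add: algebra_simps)
  finally show False by simp
qed

lemma sl2_inv_eq: "sl2_inv M = scm (trace M) (mat 1) - M"
  by (cases M rule: mk_cases) (simp add: mat_mk)

context quat_rep
begin

lemma order_scale: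
  assumes "is_order K a b Ord" "x \<in> Ord" "r \<in> K" "algebraic_int r"
  shows "(\<chi> t. r * x$t) \<in> Ord"
proof -
  obtain B where B: "Ord = {(\<Sum>v\<in>B. (\<chi> t. c v * v$t)) | c. \<forall>v. c v \<in> K \<and> algebraic_int (c v)}"
    using assms(1) unfolding is_order_def by blast
  obtain c where c: "\<forall>v. c v \<in> K \<and> algebraic_int (c v)" "x = (\<Sum>v\<in>B. (\<chi> t. c v * v$t))"
    using assms(2) B by auto
  have "(\<chi> t. r * x$t) = (\<Sum>v\<in>B. (\<chi> t. (r * c v) * v$t))"
    unfolding c(2) by (simp add: vec_eq_iff sum_distrib_left mult.assoc)
  moreover have "\<forall>v. r * c v \<in> K \<and> algebraic_int (r * c v)"
    using c(1) assms(3,4) subfieldD(4)[OF K] subringD(4)[OF subring_algebraic_int] by auto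
  ultimately show ?thesis unfolding B mem_Collect_eq by (intro exI[of _ "\<lambda>v. r * c v"] conjI)
qed

text \<open>A row eigenvector maps the order onto a finitely generated module over the algebraic
  integers, made of complex numbers, on which \<open>x\<close> acts as multiplication by
  \<open>l\<close>.\<close>

lemma order_eigenvalue_integral:
  assumes ord: "is_order K a b Ord" and x: "x \<in> Ord"
    and l: "det (rho x) = 1" "trace (rho x) = l + m" "l * m = 1"
  shows "algebraic_int l"
proof -
  obtain B where B: "finite B" "B \<subseteq> Ord" "Ord = {(\<Sum>v\<in>B. (\<chi> t. c v * v$t)) | c. \<forall>v. c v \<in> K \<and> algebraic_int (c v)}"
    using ord unfolding is_order_def by blast
  have OK: "Ord \<subseteq> quat_alg K" "qone \<in> Ord" "\<And>y. y \<in> Ord \<Longrightarrow> qmult a b x y \<in> Ord"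
    using ord x unfolding is_order_def by blast+
  have BK: "B \<subseteq> quat_alg K" using B OK by blast
  obtain f1 f2 where e: "f1 \<noteq> 0 \<or> f2 \<noteq> 0"
    "f1 * rho x$1$1 + f2 * rho x$2$1 = l * f1" "f1 * rho x$1$2 + f2 * rho x$2$2 = l * f2"
    by (rule row_eigenvector[OF l])
  define f where "f M k = f1 * M$1$k + f2 * M$2$k" for M :: mat2 and k
  have f_add: "f (M + N) k = f M k + f N k" for M N k by (simp add: f_def algebra_simps)
  have f_zero: "f 0 k = 0" for k by (simp add: f_def)
  have k12: "P k" if "P 1" "P 2" for P and k :: 2 using that by (metis exhaust_2)
  have f_scm: "f (scm r M) k = r * f M k" for r M k
    by (cases M rule: mk_cases, rule k12[of _ k]) (simp_all add: f_def algebra_simps)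
  have f_mult: "f (rho x ** M) k = l * f M k" for M k
  proof -
    have "f (rho x ** M) k = (f1 * rho x$1$1 + f2 * rho x$2$1) * M$1$k + (f1 * rho x$1$2 + f2 * rho x$2$2) * M$2$k"
      by (simp add: f_def matrix_matrix_mult_def sum_2 algebra_simps)
    then show ?thesis unfolding e by (simp add: f_def algebra_simps)
  qed
  have f_sum: "f (sum g A) k = (\<Sum>v\<in>A. f (g v) k)" for g k and A :: "(complex^4) set"
    by (induction A rule: infinite_finite_induct) (simp_all add: f_zero f_add)
  interpret amod: rmod "{x. algebraic_int x}" "(*)" by (rule rmod_mult[OF subring_algebraic_int])
  define V where "V k = (\<lambda>v. f (rho v) k) ` B" for k
  have span: "f (rho y) k \<in> amod.rspan (V k)" if y: "y \<in> Ord" for y k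
  proof -
    obtain c where c: "\<forall>v. c v \<in> K \<and> algebraic_int (c v)" "y = (\<Sum>v\<in>B. (\<chi> t. c v * v$t))"
      using y unfolding B(3) by blast
    have "f (rho y) k = (\<Sum>v\<in>B. \<phi> (c v) * f (rho v) k)"
      unfolding c(2) using rho_sum[OF B(1) BK, of c] c(1) by (simp add: f_sum f_scm)
    also have "\<dots> \<in> amod.rspan (V k)"
      using c(1) emb_algebraic_int by (intro amod.rspan_sum amod.rspan_scale amod.rspan_base) (auto simp: V_def)
    finally show ?thesis .
  qed
  \<comment> \<open>A column in which the image of the identity is nonzero, so that the module
    \<open>V k\<close> is not zero.\<close>
  obtain k where k: "f (mat 1) k \<noteq> 0"
  proof -
    have "f (mat 1) 1 = f1" "f (mat 1) 2 = f2" by (simp_all add: f_def mat_mk)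
    then show ?thesis using e(1) that by metis
  qed
  have "\<exists>z\<in>V k. z \<noteq> 0"
  proof (rule ccontr)
    assume n: "\<not> (\<exists>z\<in>V k. z \<noteq> 0)"
    have "z = 0" if "z \<in> amod.rspan (V k)" for z
      using that n by (induction rule: amod.rspan.induct) auto
    then show False using span[OF OK(2), of k] k rho_one by simp
  qed
  then obtain z where z: "z \<in> V k" "z \<noteq> 0" by blast
  show ?thesis
  proof (rule algebraic_int_span[OF _ z])
    show "finite (V k)" using B by (simp add: V_def)
    fix v assume "v \<in> V k"
    then obtain y where y: "y \<in> B" "v = f (rho y) k" by (auto simp: V_def)
    have "l * v = f (rho (qmult a b x y)) k"
      using y BK OK(1) x by (subst rho_mult) (auto simp: f_mult)
    then show "l * v \<in> amod.rspan (V k)" using span OK(3) B(2) y(1) by auto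
  qed
qed

lemma order_trace_integral:
  assumes ord: "is_order K a b Ord" and x: "x \<in> Ord" and n: "nrd a b x = 1"
  shows "algebraic_int (trace (rho x))"
proof -
  have d: "det (rho x) = 1" using rho_det x n ord emb_one by (auto simp: is_order_def)
  obtain l m where lm: "trace (rho x) = l + m" "l * m = 1" by (metis exists_eigenvalues)
  have "algebraic_int l" by (rule order_eigenvalue_integral[OF ord x d lm])
  moreover have "algebraic_int m"
    by (rule order_eigenvalue_integral[OF ord x d, of m l]) (use lm in \<open>auto simp: algebra_simps\<close>)
  ultimately show ?thesis using lm subringD(3)[OF subring_algebraic_int] by simp
qed

end

section \<open>Signs, saturation and the norm one group of an order\<close>

lemma finite_signs: "finite (signs :: ('n::finite \<Rightarrow> mat2) set)"
proof -
  have "finite {f :: 'n \<Rightarrow> mat2. \<forall>i. (i \<in> UNIV \<longrightarrow> f i \<in> {mat 1, - mat 1}) \<and> (i \<notin> UNIV \<longrightarrow> f i = mat 1)}"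
    by (rule finite_set_of_finite_funs) auto
  then show ?thesis by (simp add: signs_def)
qed

lemma sign_facts:
  assumes "M = mat 1 \<or> M = - mat 1"
  shows "det M = 1" "real_mat M" "sl2_inv M = M" "M ** M = mat 1" "M ** N = N ** M"
    "\<exists>e. (e = 1 \<or> e = -1) \<and> (\<forall>N. M ** N = scm e N)"
proof -
  obtain p q r s where N: "N = mk p q r s" by (rule mk_cases)
  show "det M = 1" "real_mat M" "sl2_inv M = M" "M ** M = mat 1" "M ** N = N ** M"
    using assms by (auto simp: mat_mk real_mat_mk N)
  from assms show "\<exists>e. (e = 1 \<or> e = -1) \<and> (\<forall>N. M ** N = scm e N)"
  proof
    assume "M = mat 1"
    then have "M ** N = scm 1 N" for N by (simp add: scm_def)
    then show ?thesis by blast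
  next
    assume "M = - mat 1"
    then have "M ** N = scm (-1) N" for N by (simp add: scm_def mat_mk)
    then show ?thesis by blast
  qed
qed

lemma signsD: "s \<in> signs \<Longrightarrow> s i = mat 1 \<or> s i = - mat 1"
  by (auto simp: signs_def)

lemma signs_subset_SLG: "s \<in> signs \<Longrightarrow> s \<in> carrier (SLG C)"
  using sign_facts[OF signsD] by (auto simp: SLG_def)

lemma signs_mult:
  assumes "s \<in> signs" "t \<in> signs"
  shows "(\<lambda>i. s i ** t i) \<in> signs"
proof -
  have "M ** N = mat 1 \<or> M ** N = - mat 1" if "M = mat 1 \<or> M = - mat 1" "N = mat 1 \<or> N = - mat 1" for M N :: mat2
    using that by (auto simp: mat_mk)
  then show ?thesis using assms unfolding signs_def by blast
qed

lemma satI: "s \<in> signs \<Longrightarrow> u \<in> H \<Longrightarrow> (\<lambda>i. s i ** u i) \<in> sat H"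
  unfolding sat_def by blast

lemma subgroup_sat:
  assumes H: "subgroup H (SLG C)"
  shows "subgroup (sat H) (SLG C)"
proof (rule group.subgroupI[OF group_SLG])
  note Hc = subgroup.mem_carrier[OF H]
  have in_carrier: "g \<in> carrier (SLG C)" if g: "g \<in> sat H" for g
  proof -
    obtain s u where su: "s \<in> signs" "u \<in> H" "g = (\<lambda>i. s i ** u i)" using g by (auto simp: sat_def)
    have "s \<otimes>\<^bsub>SLG C\<^esub> u \<in> carrier (SLG C)"
      using monoid.m_closed[OF group.is_monoid[OF group_SLG]] signs_subset_SLG[OF su(1)] Hc[OF su(2)] by blast
    then show ?thesis by (simp add: su(3) mult_SLG)
  qed
  then show "sat H \<subseteq> carrier (SLG C)" by blast
  have "(\<lambda>i. mat 1) \<in> signs" by (simp add: signs_def)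
  then show "sat H \<noteq> {}" using subgroup.one_closed[OF H] unfolding sat_def by blast
  fix g assume g: "g \<in> sat H"
  obtain s u where su: "s \<in> signs" "u \<in> H" "g = (\<lambda>i. s i ** u i)" using g by (auto simp: sat_def)
  have "(\<lambda>i. sl2_inv (g i)) = (\<lambda>i. s i ** sl2_inv (u i))"
    unfolding su(3) sl2_inv_mult using sign_facts(3,5)[OF signsD[OF su(1)]] by metis
  moreover have "(\<lambda>i. sl2_inv (u i)) \<in> H"
    using subgroup.m_inv_closed[OF H su(2)] inv_SLG[OF Hc[OF su(2)]] by simp
  ultimately have "(\<lambda>i. sl2_inv (g i)) \<in> sat H" using satI[OF su(1), of "\<lambda>i. sl2_inv (u i)"] by simp
  then show "inv\<^bsub>SLG C\<^esub> g \<in> sat H" using inv_SLG[OF in_carrier[OF g]] by simp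
  fix h assume h: "h \<in> sat H"
  obtain t v where tv: "t \<in> signs" "v \<in> H" "h = (\<lambda>i. t i ** v i)" using h by (auto simp: sat_def)
  have "(\<lambda>i. g i ** h i) = (\<lambda>i. (s i ** t i) ** (u i ** v i))"
  proof
    fix i
    have "u i ** t i = t i ** u i" using sign_facts(5)[OF signsD[OF tv(1)]] by metis
    then show "g i ** h i = (s i ** t i) ** (u i ** v i)" unfolding su(3) tv(3) by (metis matrix_mul_assoc)
  qed
  moreover have "(\<lambda>i. u i ** v i) \<in> H" using subgroup.m_closed[OF H su(2) tv(2)] by (simp add: mult_SLG)
  ultimately show "g \<otimes>\<^bsub>SLG C\<^esub> h \<in> sat H"
    unfolding mult_SLG using satI[OF signs_mult[OF su(1) tv(1)], of "\<lambda>i. u i ** v i"] by simp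
qed

lemma (in group) fidx_Int:
  assumes H: "subgroup H G" and K: "subgroup K G" and "K \<subseteq> L" and f: "fin_index G H L"
  shows "fidx G (H \<inter> K) K"
proof (rule fidx_map[OF K, where f = "\<lambda>k. H #> k"])
  show "finite ((\<lambda>k. H #> k) ` K)"
    using f assms(3) unfolding fin_index_def by (meson finite_subset image_mono)
  fix g k assume gk: "g \<in> K" "k \<in> K" "H #> g = H #> k"
  then have c: "g \<in> carrier G" "k \<in> carrier G" using subgroup.mem_carrier[OF K] by auto
  have "g \<in> H #> k" using rcos_self[OF c(1) H] gk(3) by simp
  then obtain h where "h \<in> H" "g = h \<otimes> k" by (auto simp: r_coset_def)
  then have "g \<otimes> inv k \<in> H" using c subgroup.mem_carrier[OF H] by (simp add: m_assoc)
  then show "g \<otimes> inv k \<in> H \<inter> K" using gk subgroup.m_closed[OF K] subgroup.m_inv_closed[OF K] by simp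
qed

locale arith =
  fixes C :: "'n::finite set" and K a b Ord \<phi> I J
  assumes ad: "arith_data C K a b Ord \<phi> I J"
begin

lemma nf: "number_field K" and order: "is_order K a b Ord"
  using ad by (simp_all add: arith_data_def)

lemma ad_facts:
  "\<forall>i. i \<in> C \<longleftrightarrow> \<not> real_emb K (\<phi> i)"
  "\<forall>\<sigma>. embedding K \<sigma> \<and> \<not> real_emb K \<sigma> \<longrightarrow>
        (\<exists>i\<in>C. same_emb K \<sigma> (\<phi> i) \<or> same_emb K \<sigma> (cnj \<circ> \<phi> i))"
  "\<forall>\<sigma>. embedding K \<sigma> \<and> real_emb K \<sigma> \<and> (\<forall>i. i \<notin> C \<longrightarrow> \<not> same_emb K \<sigma> (\<phi> i)) \<longrightarrow> \<not> split_real \<sigma> a b"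
  "\<forall>i. I i ** I i = mat (\<phi> i a) \<and> J i ** J i = mat (\<phi> i b) \<and>
          I i ** J i = - (J i ** I i) \<and> (i \<notin> C \<longrightarrow> real_mat (I i) \<and> real_mat (J i))"
  "a \<in> K" "b \<in> K"
  by (insert ad, unfold arith_data_def, elim conjE, assumption)+

lemma sf: "subfield K"
  using nf by (rule number_field_subfield)

lemma quat_rep: "quat_rep K (\<phi> i) a b (I i) (J i)"
  using ad sf by unfold_locales (auto simp: arith_data_def)

lemma emb_i: "emb K (\<phi> i)"
  using quat_rep by (simp add: quat_rep_def)

definition rho :: "complex^4 \<Rightarrow> 'n \<Rightarrow> mat2" where
  "rho x = (\<lambda>i. qrep (\<phi> i) (I i) (J i) x)"

definition units :: "('n \<Rightarrow> mat2) set" where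
  "units = {rho x | x. x \<in> Ord \<and> nrd a b x = 1}"

lemma Gamma_star_eq: "Gamma_star C a b Ord \<phi> I J = sat units"
  by (simp add: Gamma_star_def units_def rho_def)

lemma order_facts:
  "qone \<in> Ord" "\<forall>x\<in>Ord. \<forall>y\<in>Ord. x + y \<in> Ord \<and> - x \<in> Ord \<and> qmult a b x y \<in> Ord"
  by (insert order, unfold is_order_def, elim conjE, assumption)+

lemma ord_quat: "x \<in> Ord \<Longrightarrow> x \<in> quat_alg K"
  using order by (auto simp: is_order_def)

lemma rho_trace: "trace (rho x i) = 2 * \<phi> i (x$0)"
  unfolding rho_def by (rule quat_rep.rho_trace[OF quat_rep])

lemma rho_det: "x \<in> Ord \<Longrightarrow> nrd a b x = 1 \<Longrightarrow> det (rho x i) = 1"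
  unfolding rho_def using quat_rep.rho_det[OF quat_rep] ord_quat emb.emb_one[OF emb_i] by simp

lemma rho_trace_integral: "x \<in> Ord \<Longrightarrow> nrd a b x = 1 \<Longrightarrow> algebraic_int (trace (rho x i))"
  unfolding rho_def by (rule quat_rep.order_trace_integral[OF quat_rep order])

lemma rho_mult:
  assumes "x \<in> Ord" "y \<in> Ord"
  shows "rho (qmult a b x y) i = rho x i ** rho y i"
  unfolding rho_def by (rule quat_rep.rho_mult[OF quat_rep]) (use assms ord_quat in auto)

lemma rho_real:
  assumes "i \<notin> C" "x \<in> Ord"
  shows "real_mat (rho x i)"
proof -
  have r: "real_emb K (\<phi> i)" "real_mat (I i)" "real_mat (J i)" using ad_facts(1,4) assms(1) by auto
  have x: "x$t \<in> K" for t using ord_quat[OF assms(2)] by (simp add: quat_alg_def)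
  obtain p q u v where i: "I i = mk p q u v" by (rule mk_cases)
  obtain p' q' u' v' where j: "J i = mk p' q' u' v'" by (rule mk_cases)
  show ?thesis using r x unfolding rho_def quat_rep.rho_eq[OF quat_rep] i j
    by (auto simp: mat_mk real_mat_mk real_emb_def)
qed

text \<open>The inverse is the conjugate quaternion, the reduced trace minus \<open>x\<close>. It
  lies in the order because the reduced trace \<open>2 * x$0\<close> is an algebraic
  integer.\<close>

lemma unit_inverse:
  assumes x: "x \<in> Ord" "nrd a b x = 1"
  obtains y where "y \<in> Ord" "nrd a b y = 1" "\<And>i. rho y i = sl2_inv (rho x i)"
proof -
  \<comment> \<open>Any index will do: integrality is known for the image of the trace under one
    place and is carried back to \<open>K\<close> by the inverse embedding.\<close>
  define i0 :: 'n where "i0 = undefined"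
  interpret q: quat_rep K "\<phi> i0" a b "I i0" "J i0" by (rule quat_rep)
  have xK: "x$t \<in> K" for t using ord_quat[OF x(1)] by (simp add: quat_alg_def)
  have K2: "2 * x$0 \<in> K" unfolding mult_2 by (rule subfieldD(3)[OF sf xK xK])
  have t: "algebraic_int (\<phi> i0 (2 * x$0))"
    using rho_trace_integral[OF x, of i0] unfolding rho_trace mult_2 q.emb_add[OF xK xK] .
  have inj: "inj_on (\<phi> i0) K" by (rule inj_onI) (simp add: q.emb_eq_iff)
  interpret e: emb "\<phi> i0 ` K" "the_inv_into K (\<phi> i0)"
    by unfold_locales (rule q.subfield_image, rule q.embedding_inverse)
  have int: "algebraic_int (2 * x$0)"
    using e.emb_algebraic_int[OF imageI[OF K2] t] the_inv_into_f_f[OF inj K2] by simp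
  define y where "y = (\<chi> t. (2 * x$0) * qone$t) + - x"
  have one: "qone \<in> Ord" and cl: "\<And>x y. x \<in> Ord \<Longrightarrow> y \<in> Ord \<Longrightarrow> x + y \<in> Ord \<and> - x \<in> Ord"
    using order_facts by blast+
  have s: "(\<chi> t. (2 * x$0) * qone$t) \<in> Ord" by (rule q.order_scale[OF order one K2 int])
  show ?thesis
  proof (rule that)
    show "y \<in> Ord" unfolding y_def using cl s x(1) by blast
    show "nrd a b y = 1" using x(2) by (simp add: nrd_def y_def qone_def power2_eq_square algebra_simps)
    fix i
    interpret r: quat_rep K "\<phi> i" a b "I i" "J i" by (rule quat_rep)
    have "rho y i = scm (\<phi> i (2 * x$0)) (mat 1) + - rho x i"
      unfolding y_def rho_def
      by (subst r.rho_add) (use s x(1) ord_quat cl one K2 in \<open>auto simp: r.rho_scale r.rho_uminus r.rho_one\<close>)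
    also have "\<phi> i (2 * x$0) = trace (rho x i)"
      unfolding rho_trace mult_2 by (rule r.emb_add[OF xK xK])
    finally show "rho y i = sl2_inv (rho x i)" unfolding sl2_inv_eq by simp
  qed
qed

lemma unit_carrier: "x \<in> Ord \<Longrightarrow> nrd a b x = 1 \<Longrightarrow> rho x \<in> carrier (SLG C)"
  using rho_det rho_real by (auto simp: SLG_def)

lemma subgroup_units: "subgroup units (SLG C)"
proof (rule group.subgroupI[OF group_SLG])
  show "units \<subseteq> carrier (SLG C)" using unit_carrier by (auto simp: units_def)
  have "qone \<in> Ord" "nrd a b qone = 1" using order by (auto simp: is_order_def nrd_def qone_def)
  then show "units \<noteq> {}" by (auto simp: units_def)
  fix g assume "g \<in> units"
  then obtain x where x: "x \<in> Ord" "nrd a b x = 1" "g = rho x" by (auto simp: units_def)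
  obtain y where y: "y \<in> Ord" "nrd a b y = 1" "\<And>i. rho y i = sl2_inv (rho x i)" using unit_inverse[OF x(1,2)] by blast
  have "inv\<^bsub>SLG C\<^esub> g = rho y" unfolding x(3) using inv_SLG[OF unit_carrier[OF x(1,2)]] y(3) by auto
  then show "inv\<^bsub>SLG C\<^esub> g \<in> units" using y by (auto simp: units_def)
  fix h assume "h \<in> units"
  then obtain z where z: "z \<in> Ord" "nrd a b z = 1" "h = rho z" by (auto simp: units_def)
  have "g \<otimes>\<^bsub>SLG C\<^esub> h = rho (qmult a b x z)" unfolding x(3) z(3) mult_SLG using rho_mult[OF x(1) z(1)] by auto
  moreover have "qmult a b x z \<in> Ord" using order_facts x(1) z(1) by blast
  moreover have "nrd a b (qmult a b x z) = 1" using x z by (simp add: nrd_qmult)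
  ultimately show "g \<otimes>\<^bsub>SLG C\<^esub> h \<in> units" unfolding units_def by blast
qed

text \<open>The places of \<open>K\<close>: the chosen ones, their conjugates, and ramified real ones.\<close>
lemma embedding_cases:
  assumes \<sigma>: "embedding K \<sigma>"
  obtains i where "same_emb K \<sigma> (\<phi> i)" | i where "same_emb K \<sigma> (cnj \<circ> \<phi> i)"
  | "\<And>x. nrd a b x = 1 \<Longrightarrow> x \<in> Ord \<Longrightarrow> Im (\<sigma> (2 * x$0)) = 0 \<and> \<bar>Re (\<sigma> (2 * x$0))\<bar> \<le> 2"
proof (cases "real_emb K \<sigma>")
  case False
  then have "\<exists>i\<in>C. same_emb K \<sigma> (\<phi> i) \<or> same_emb K \<sigma> (cnj \<circ> \<phi> i)" using ad_facts(2) \<sigma> by simp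
  then show ?thesis using that by blast
next
  case real: True
  show ?thesis
  proof (cases "\<exists>i. i \<notin> C \<and> same_emb K \<sigma> (\<phi> i)")
    case True
    then show ?thesis using that by blast
  next
    case False
    then have ns: "\<not> split_real \<sigma> a b" using ad_facts(3) \<sigma> real by blast
    note ab = ad_facts(5,6)
    have im: "Im (\<sigma> y) = 0" if "y \<in> K" for y using real that by (simp add: real_emb_def)
    have neg: "Re (\<sigma> a) < 0" "Re (\<sigma> b) < 0"
      using split_real_if_nonneg[of \<sigma> a b] im ab ns by (meson not_le)+
    interpret s: emb K \<sigma> using sf \<sigma> by unfold_locales
    have "Im (\<sigma> (2 * x$0)) = 0 \<and> \<bar>Re (\<sigma> (2 * x$0))\<bar> \<le> 2" if x: "nrd a b x = 1" "x \<in> Ord" for x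
    proof -
      have xK: "x$t \<in> K" for t using ord_quat[OF x(2)] by (simp add: quat_alg_def)
      note F = s.emb_add s.emb_mult s.emb_diff subfieldD[OF sf] xK ab
      define r where "r t = Re (\<sigma> (x$t))" for t
      have r: "\<sigma> (x$t) = of_real (r t)" for t using im[OF xK] by (simp add: r_def complex_eq_iff)
      define A B where AB: "A = Re (\<sigma> a)" "B = Re (\<sigma> b)"
      have sab: "\<sigma> a = of_real A" "\<sigma> b = of_real B" using im ab by (simp_all add: complex_eq_iff AB)
      have "\<sigma> (nrd a b x) = \<sigma> (x$0) * \<sigma> (x$0) - \<sigma> a * \<sigma> (x$1) * \<sigma> (x$1) - \<sigma> b * \<sigma> (x$2) * \<sigma> (x$2) + \<sigma> a * \<sigma> b * \<sigma> (x$3) * \<sigma> (x$3)"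
        by (simp add: nrd_def power2_eq_square F mult.assoc)
      also have "\<dots> = of_real (r 0 * r 0 - A * r 1 * r 1 - B * r 2 * r 2 + A * B * r 3 * r 3)"
        unfolding r sab by simp
      finally have "of_real (r 0 * r 0 - A * r 1 * r 1 - B * r 2 * r 2 + A * B * r 3 * r 3) = (of_real 1 :: complex)"
        using x(1) s.emb_one by simp
      then have e: "r 0 * r 0 - A * r 1 * r 1 - B * r 2 * r 2 + A * B * r 3 * r 3 = 1"
        by (simp only: of_real_eq_iff)
      \<comment> \<open>With \<open>A\<close> and \<open>B\<close> negative the norm form is
        positive definite, so norm 1 bounds the coordinate \<open>r 0\<close> by 1 and the reduced
        trace by 2.\<close>
      have "A * (r 1 * r 1) \<le> 0" "B * (r 2 * r 2) \<le> 0" "A * B * (r 3 * r 3) \<ge> 0"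
        using neg unfolding AB[symmetric]
        by (intro mult_nonpos_nonneg mult_nonneg_nonneg mult_nonpos_nonpos zero_le_square; simp)+
      then have "(r 0)\<^sup>2 \<le> 1" using e unfolding power2_eq_square mult.assoc by linarith
      then have "\<bar>r 0\<bar> \<le> 1" using abs_square_le_1 by blast
      moreover have "\<sigma> (2 * x$0) = of_real (2 * r 0)"
        unfolding mult_2 s.emb_add[OF xK xK] r by simp
      ultimately show ?thesis by simp
    qed
    then show ?thesis using that by blast
  qed
qed

end

subsection \<open>From arithmetic groups to proportional lengths\<close>

lemma SLG_det: "subgroup H (SLG C) \<Longrightarrow> g \<in> H \<Longrightarrow> det (g i) = 1"
  using subgroup.mem_carrier by (fastforce simp: SLG_def)

lemma SLG_subgroupD:
  assumes H: "subgroup H (SLG C)"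
  shows "(\<lambda>i. mat 1) \<in> H" "g \<in> H \<Longrightarrow> h \<in> H \<Longrightarrow> (\<lambda>i. g i ** h i) \<in> H" "g \<in> H \<Longrightarrow> (\<lambda>i. sl2_inv (g i)) \<in> H"
  using subgroup.one_closed[OF H] subgroup.m_closed[OF H] subgroup.m_inv_closed[OF H] inv_SLG subgroup.mem_carrier[OF H]
  by (fastforce simp: one_SLG mult_SLG)+

lemma mgrp_proj:
  assumes H: "subgroup H (SLG C)"
  shows "mgrp ((\<lambda>g. g i) ` H)"
  unfolding mgrp_def
proof (intro conjI ballI)
  show "mat 1 \<in> (\<lambda>g. g i) ` H" using SLG_subgroupD(1)[OF H] by force
  fix x assume "x \<in> (\<lambda>g. g i) ` H"
  then obtain g where g: "g \<in> H" "x = g i" by blast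
  show "det x = 1" using SLG_det[OF H g(1)] g(2) by simp
  show "sl2_inv x \<in> (\<lambda>g. g i) ` H" using SLG_subgroupD(3)[OF H g(1)] g(2) by force
  fix y assume "y \<in> (\<lambda>g. g i) ` H"
  then obtain h where h: "h \<in> H" "y = h i" by blast
  show "x ** y \<in> (\<lambda>g. g i) ` H" using SLG_subgroupD(2)[OF H g(1) h(1)] g(2) h(2) by force
qed

text \<open>Finite index is inherited by \<open>\<Gamma>\<close> from \<open>\<Delta>\<close>, and
  dropping the saturation costs only the finitely many signs, which belong to
  \<open>\<Gamma>\<close>.\<close>

lemma (in arith) fidx_units:
  assumes \<Delta>: "Gsubgroup C \<Delta>" and com: "commensurable (SLG C) \<Delta> (Gamma_star C a b Ord \<phi> I J)"
    and \<Gamma>: "Gsubgroup C \<Gamma>" "\<Gamma> \<subseteq> \<Delta>"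
  shows "fidx (SLG C) (\<Gamma> \<inter> units) \<Gamma>"
proof -
  interpret G: group "SLG C" by (rule group_SLG)
  let ?S = "sat units"
  have sub: "subgroup \<Delta> (SLG C)" "subgroup \<Gamma> (SLG C)" "signs \<subseteq> \<Gamma>" using \<Delta> \<Gamma> by (auto simp: Gsubgroup_def)
  have S: "subgroup ?S (SLG C)" by (rule subgroup_sat[OF subgroup_units])
  have int: "subgroup (\<Gamma> \<inter> ?S) (SLG C)" "subgroup (\<Gamma> \<inter> units) (SLG C)" "subgroup (\<Delta> \<inter> ?S) (SLG C)"
    by (intro G.subgroups_Inter_pair sub S subgroup_units)+
  have "fin_index (SLG C) (\<Delta> \<inter> ?S) \<Delta>" using com by (simp add: commensurable_def Gamma_star_eq)
  then have "fidx (SLG C) ((\<Delta> \<inter> ?S) \<inter> \<Gamma>) \<Gamma>" by (rule G.fidx_Int[OF int(3) sub(2) \<Gamma>(2)])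
  moreover have "(\<Delta> \<inter> ?S) \<inter> \<Gamma> = \<Gamma> \<inter> ?S" using \<Gamma>(2) by blast
  ultimately have 1: "fidx (SLG C) (\<Gamma> \<inter> ?S) \<Gamma>" by simp
  have one: "(\<lambda>i. mat 1) \<in> units" by (rule SLG_subgroupD(1)[OF subgroup_units])
  have sgS: "signs \<subseteq> ?S"
  proof
    fix s :: "'n \<Rightarrow> mat2" assume "s \<in> signs"
    from satI[OF this one] show "s \<in> ?S" by simp
  qed
  have "fidx (SLG C) (\<Gamma> \<inter> units) (\<Gamma> \<inter> ?S)"
    unfolding fidx_def
  proof (intro exI[of _ signs] conjI ballI)
    fix k assume k: "k \<in> \<Gamma> \<inter> ?S"
    then obtain s u where su: "s \<in> signs" "u \<in> units" "k = (\<lambda>i. s i ** u i)" by (auto simp: sat_def)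
    have ss: "s i ** s i = mat 1" "s i ** u i = u i ** s i" for i using sign_facts(4,5)[OF signsD[OF su(1)]] by blast+
    have "(\<lambda>i. s i ** k i) \<in> \<Gamma>" using SLG_subgroupD(2)[OF sub(2)] su(1) sub(3) k by blast
    moreover have "(\<lambda>i. s i ** k i) = u" unfolding su(3) using ss(1) by (simp add: matrix_mul_assoc)
    ultimately have "u \<in> \<Gamma>" by simp
    moreover have "k = u \<otimes>\<^bsub>SLG C\<^esub> s" unfolding mult_SLG su(3) using ss(2) by simp
    ultimately show "\<exists>h\<in>\<Gamma> \<inter> units. \<exists>t\<in>signs. k = h \<otimes>\<^bsub>SLG C\<^esub> t" using su by blast
  qed (use sub(3) sgS finite_signs in auto)
  then show ?thesis using G.fidx_trans[OF int(2) int(1) sub(2) _ _ 1] by blast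
qed

lemma lengths_in_limit_cone: "g \<in> \<Gamma> \<Longrightarrow> (\<chi> i. tlen (g i)) \<in> limit_cone \<Gamma>"
  unfolding limit_cone_def by blast

text \<open>The factors \<open>c\<close> are the ratios of the lengths of one element
  \<open>g0\<close> that is loxodromic in coordinate \<open>j\<close>. Conversely the ray through
  \<open>c\<close> is itself a closed cone containing all length vectors, so it contains the limit
  cone.\<close>

lemma single_proj_point_iff:
  fixes \<Gamma> :: "('n::finite \<Rightarrow> mat2) set"
  assumes \<Gamma>: "subgroup \<Gamma> (SLG C)" and ne: "nonelementary ((\<lambda>g. g j) ` \<Gamma>)"
  shows "single_proj_point (limit_cone \<Gamma>) \<longleftrightarrow>
    (\<exists>c. c j = 1 \<and> (\<forall>i. c i \<ge> 0) \<and> (\<forall>g\<in>\<Gamma>. \<forall>i. tlen (g i) = c i * tlen (g j)))"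
proof -
  have pos: "tlen (g i) \<ge> 0" if "g \<in> \<Gamma>" for g i using tlen_nonneg SLG_det[OF \<Gamma> that] by blast
  obtain g0 where g0: "g0 \<in> \<Gamma>" "tlen (g0 j) > 0"
    using nonelementary_loxodromic[OF ne mgrp_proj[OF \<Gamma>]] by blast
  define v where "v g = (\<chi> i. tlen (g i))" for g :: "'n \<Rightarrow> mat2"
  have v0: "v g0 \<in> limit_cone \<Gamma> - {0}"
    using lengths_in_limit_cone[OF g0(1)] g0(2) by (auto simp: v_def vec_eq_iff intro!: exI[of _ j])
  show ?thesis
  proof
    assume sp: "single_proj_point (limit_cone \<Gamma>)"
    define c where "c i = tlen (g0 i) / tlen (g0 j)" for i
    have "tlen (g i) = c i * tlen (g j)" if g: "g \<in> \<Gamma>" for g i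
    proof (cases "v g = 0")
      case True
      then have "tlen (g k) = 0" for k by (simp add: v_def vec_eq_iff)
      then show ?thesis by simp
    next
      case False
      then have "v g \<in> limit_cone \<Gamma> - {0}" using lengths_in_limit_cone[OF g] by (simp add: v_def)
      then obtain r where "v g = r *\<^sub>R v g0" using sp v0 unfolding single_proj_point_def by blast
      then have "tlen (g k) = r * tlen (g0 k)" for k by (simp add: v_def vec_eq_iff)
      then show ?thesis using g0(2) by (simp add: c_def)
    qed
    moreover have "c j = 1" "\<forall>i. c i \<ge> 0" using g0 pos by (auto simp: c_def)
    ultimately show "\<exists>c. c j = 1 \<and> (\<forall>i. c i \<ge> 0) \<and> (\<forall>g\<in>\<Gamma>. \<forall>i. tlen (g i) = c i * tlen (g j))" by blast
  next
    assume "\<exists>c. c j = 1 \<and> (\<forall>i. c i \<ge> 0) \<and> (\<forall>g\<in>\<Gamma>. \<forall>i. tlen (g i) = c i * tlen (g j))"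
    then obtain c where c: "c j = 1" "\<And>g i. g \<in> \<Gamma> \<Longrightarrow> tlen (g i) = c i * tlen (g j)" by blast
    \<comment> \<open>Since \<open>c j = 1\<close>, a point of the ray is recovered from its
      coordinate \<open>j\<close>.\<close>
    define S where "S = {x :: real^'n. x $ j \<ge> 0 \<and> x = (x $ j) *\<^sub>R (\<chi> i. c i)}"
    have "closed S" unfolding S_def
      by (intro closed_Collect_conj closed_Collect_le closed_Collect_eq continuous_intros)
    moreover have "cone S" unfolding cone_def
    proof (intro ballI allI impI)
      fix x and r :: real assume x: "x \<in> S" and r: "r \<ge> 0"
      have "r *\<^sub>R x = r *\<^sub>R ((x $ j) *\<^sub>R (\<chi> i. c i))" using x by (simp add: S_def)
      moreover have "x $ j \<ge> 0" using x by (simp add: S_def)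
      ultimately show "r *\<^sub>R x \<in> S" using r c(1) by (simp add: S_def)
    qed
    moreover have "(\<lambda>g. \<chi> i. tlen (g i)) ` \<Gamma> \<subseteq> S"
    proof clarify
      fix g assume g: "g \<in> \<Gamma>"
      have "(\<chi> i. tlen (g i)) = tlen (g j) *\<^sub>R (\<chi> i. c i)"
        unfolding vec_eq_iff
      proof
        fix i show "(\<chi> i. tlen (g i)) $ i = (tlen (g j) *\<^sub>R (\<chi> i. c i)) $ i" using c(2)[OF g, of i] by simp
      qed
      then show "(\<chi> i. tlen (g i)) \<in> S" unfolding S_def mem_Collect_eq vec_lambda_beta using pos[OF g] by blast
    qed
    ultimately have LS: "limit_cone \<Gamma> \<subseteq> S" unfolding limit_cone_def by blast
    show "single_proj_point (limit_cone \<Gamma>)" unfolding single_proj_point_def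
    proof (intro conjI ballI)
      show "limit_cone \<Gamma> - {0} \<noteq> {}" using v0 by blast
      fix x y assume xy: "x \<in> limit_cone \<Gamma> - {0}" "y \<in> limit_cone \<Gamma> - {0}"
      have x: "x = (x $ j) *\<^sub>R (\<chi> i. c i)" and y: "y = (y $ j) *\<^sub>R (\<chi> i. c i)" "y \<noteq> 0"
        using xy LS unfolding S_def by blast+
      have "y $ j \<noteq> 0" using y by (metis scaleR_zero_left)
      then have "(x $ j) *\<^sub>R (\<chi> i. c i) = (x $ j / y $ j) *\<^sub>R ((y $ j) *\<^sub>R (\<chi> i. c i))" by simp
      then show "\<exists>r. x = r *\<^sub>R y" using x y(1) by metis
    qed
  qed
qed

text \<open>The two number fields meet in \<open>F\<close>, which contains the traces of suitable
  powers of \<open>g j\<close>. From there \<open>\<phi> i\<close> after the inverse of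
  \<open>\<phi> j\<close> is extended to the second field, whose places are known because it has a
  single factor.\<close>

lemma cmp_proportional_lengths:
  fixes C :: "'n::finite set" and C' :: "unit set"
  assumes A: "arith C K a b Ord \<phi> I J" and A': "arith C' K' a' b' Ord' \<phi>' I' J'"
    and \<Gamma>: "subgroup \<Gamma> (SLG C)" and fi: "fidx (SLG C) (\<Gamma> \<inter> arith.units a b Ord \<phi> I J) \<Gamma>"
    and \<Lambda>: "subgroup \<Lambda> SL2" "(\<lambda>g. g j) ` \<Gamma> \<subseteq> \<Lambda>" and h: "det h = 1"
    and com: "commensurable SL2 \<Lambda> {h ** g () ** sl2_inv h | g. g \<in> Gamma_star C' a' b' Ord' \<phi>' I' J'}"
  obtains c :: real where "c = 0 \<or> c = 1" "\<And>g. g \<in> \<Gamma> \<Longrightarrow> tlen (g i) = c * tlen (g j)"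
proof -
  interpret A: arith C K a b Ord \<phi> I J by (rule A)
  interpret B: arith C' K' a' b' Ord' \<phi>' I' J' by (rule A')
  interpret G: group "SLG C" by (rule group_SLG)
  interpret L: group SL2 by (rule group_SL2)
  let ?S = "sat B.units"
  have S: "subgroup ?S (SLG C')" by (rule subgroup_sat[OF B.subgroup_units])
  define Q where "Q = {h ** g () ** sl2_inv h | g. g \<in> ?S}"
  have hh: "h ** x ** sl2_inv h ** (h ** y ** sl2_inv h) = h ** (x ** y) ** sl2_inv h" for x y
    by (metis matrix_mul_assoc matrix_mul_rid sl2_inv_left h)
  have hi: "sl2_inv (h ** x ** sl2_inv h) = h ** sl2_inv x ** sl2_inv h" for x
    by (simp add: sl2_inv_mult matrix_mul_assoc)
  have QI: "h ** g () ** sl2_inv h \<in> Q" if "g \<in> ?S" for g using that unfolding Q_def by blast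
  have Qc: "x \<in> carrier SL2" if "x \<in> Q" for x
    using that SLG_det[OF S] h by (auto simp: Q_def SL2_def det_mul)
  have Q: "subgroup Q SL2"
  proof (rule L.subgroupI)
    show "Q \<subseteq> carrier SL2" using Qc by blast
    show "Q \<noteq> {}" using QI[OF SLG_subgroupD(1)[OF S]] by blast
    fix x assume x: "x \<in> Q"
    then obtain g where g: "g \<in> ?S" "x = h ** g () ** sl2_inv h" by (auto simp: Q_def)
    show "inv\<^bsub>SL2\<^esub> x \<in> Q"
      using QI[OF SLG_subgroupD(3)[OF S g(1)]] inv_SL2[OF Qc[OF x]] by (simp add: g(2) hi)
    fix y assume y: "y \<in> Q"
    then obtain k where k: "k \<in> ?S" "y = h ** k () ** sl2_inv h" by (auto simp: Q_def)
    show "x \<otimes>\<^bsub>SL2\<^esub> y \<in> Q"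
      using QI[OF SLG_subgroupD(2)[OF S g(1) k(1)]] by (simp add: g(2) k(2) mult_SL2 hh)
  qed
  have "fin_index SL2 (\<Lambda> \<inter> Q) \<Lambda>" using com by (simp add: commensurable_def Q_def B.Gamma_star_eq)
  then have fQ: "fidx SL2 (\<Lambda> \<inter> Q) \<Lambda>"
    by (intro L.fin_index_imp_fidx L.subgroups_Inter_pair \<Lambda>(1) Q)
  define i' :: unit where "i' = ()"
  interpret p: emb K "\<phi> j" by (rule A.emb_i)
  interpret p': emb K' "\<phi>' i'" by (rule B.emb_i)
  interpret pi: emb K "\<phi> i" by (rule A.emb_i)
  define F where "F = \<phi> j ` K \<inter> \<phi>' i' ` K'"
  have F: "subfield F" using p.subfield_image p'.subfield_image unfolding F_def subfield_def by blast
  have injK: "inj_on (\<phi> j) K" by (rule inj_onI) (simp add: p.emb_eq_iff)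
  define \<sigma> where "\<sigma> = \<phi> i \<circ> the_inv_into K (\<phi> j)"
  have \<sigma>: "embedding (\<phi> j ` K) \<sigma>" unfolding \<sigma>_def
  proof (rule embedding_comp[OF p.embedding_inverse])
    have "the_inv_into K (\<phi> j) ` \<phi> j ` K = K" using injK by (simp add: the_inv_into_onto)
    then show "embedding (the_inv_into K (\<phi> j) ` \<phi> j ` K) (\<phi> i)" using pi.emb by simp
  qed
  have \<sigma>_eq: "\<sigma> (\<phi> j x) = \<phi> i x" if "x \<in> K" for x
    using the_inv_into_f_f[OF injK that] by (simp add: \<sigma>_def)
  have FK': "F \<subseteq> \<phi>' i' ` K'" and F\<sigma>: "embedding F \<sigma>"
    using embedding_subset[OF \<sigma>, of F] by (auto simp: F_def)
  obtain \<tau> where \<tau>: "embedding (\<phi>' i' ` K') \<tau>" "\<And>x. x \<in> F \<Longrightarrow> \<tau> x = \<sigma> x"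
    using extend_embedding[OF F FK' p'.number_field_image[OF B.nf] F\<sigma>] by blast
  have \<tau>\<phi>: "embedding K' (\<tau> \<circ> \<phi>' i')" by (rule embedding_comp[OF p'.emb \<tau>(1)])
  interpret t: emb "\<phi>' i' ` K'" \<tau> using p'.subfield_image \<tau>(1) by unfold_locales
  \<comment> \<open>A first power makes \<open>g\<close> a unit in all coordinates at once, a second
    one brings coordinate \<open>j\<close> into the conjugated group \<open>Q\<close>. The sign
    \<open>s\<close> comes from the saturation and is the same for both traces.\<close>
  have key: "\<exists>n x y s. n > 0 \<and> (s = 1 \<or> s = -1) \<and> x \<in> Ord \<and> y \<in> Ord' \<and> nrd a' b' y = 1
      \<and> trace (mpow (g j) n) = s * \<phi>' i' (2 * y$0) \<and> trace (mpow (g i) n) = s * \<tau> (\<phi>' i' (2 * y$0))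
      \<and> 2 * y$0 \<in> K'"
    if g: "g \<in> \<Gamma>" for g
  proof -
    obtain m :: nat where m: "m > 0" "g [^]\<^bsub>SLG C\<^esub> m \<in> \<Gamma> \<inter> A.units"
      by (rule G.fidx_power[OF G.subgroups_Inter_pair[OF \<Gamma> A.subgroup_units] \<Gamma> fi g])
    define g1 where "g1 = g [^]\<^bsub>SLG C\<^esub> m"
    have g1: "g1 \<in> \<Gamma>" "g1 \<in> A.units" using m(2) unfolding g1_def by blast+
    have "g1 j \<in> \<Lambda>" using g1(1) \<Lambda>(2) by blast
    obtain m' :: nat where m': "m' > 0" "g1 j [^]\<^bsub>SL2\<^esub> m' \<in> \<Lambda> \<inter> Q"
      by (rule L.fidx_power[OF L.subgroups_Inter_pair[OF \<Lambda>(1) Q] \<Lambda>(1) fQ \<open>g1 j \<in> \<Lambda>\<close>])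
    have gc: "g \<in> carrier (SLG C)" using subgroup.mem_carrier[OF \<Gamma> g] .
    have pw: "mpow (g1 k) m' = mpow (g k) (m * m')" for k
      using G.nat_pow_pow[OF gc, of m m'] unfolding g1_def pow_SLG by (metis mult.commute)
    interpret Un: subgroup A.units "SLG C" by (rule A.subgroup_units)
    have "g1 [^]\<^bsub>SLG C\<^esub> m' \<in> A.units"
      by (induction m') (use g1(2) in \<open>auto simp: Un.one_closed Un.m_closed\<close>)
    then obtain x where x: "x \<in> Ord" "nrd a b x = 1" "g1 [^]\<^bsub>SLG C\<^esub> m' = A.rho x" by (auto simp: A.units_def)
    have tr: "trace (mpow (g k) (m * m')) = 2 * \<phi> k (x$0)" for k
      using x(3) A.rho_trace[of x k] unfolding pow_SLG by (metis pw)
    obtain w where w: "w \<in> ?S" "mpow (g j) (m * m') = h ** w () ** sl2_inv h"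
      using m'(2) unfolding pow_SL2 pw Q_def by auto
    obtain s u where su: "s \<in> signs" "u \<in> B.units" "w = (\<lambda>i. s i ** u i)" using w(1) by (auto simp: sat_def)
    obtain y where y: "y \<in> Ord'" "nrd a' b' y = 1" "u = B.rho y" using su(2) by (auto simp: B.units_def)
    obtain e where e: "e = 1 \<or> e = -1" "\<And>N. s i' ** N = scm e N" using sign_facts(6)[OF signsD[OF su(1)]] by blast
    have "trace (mpow (g j) (m * m')) = trace (w ())" unfolding w(2) by (rule trace_conj[OF h])
    also have "\<dots> = e * (2 * \<phi>' i' (y$0))"
      unfolding su(3) y(3) i'_def[symmetric] e(2) by (simp add: B.rho_trace)
    finally have trj: "trace (mpow (g j) (m * m')) = e * (2 * \<phi>' i' (y$0))" .
    have y0: "y$0 \<in> K'" and x0: "x$0 \<in> K" using B.ord_quat[OF y(1)] A.ord_quat[OF x(1)] by (auto simp: quat_alg_def)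
    note K' = subfieldD[OF B.sf] and KK = subfieldD[OF A.sf]
    have y2: "2 * y$0 \<in> K'" "\<phi>' i' (2 * y$0) = 2 * \<phi>' i' (y$0)"
      unfolding mult_2 using K'(3)[OF y0 y0] p'.emb_add[OF y0 y0] by auto
    have x2: "2 * x$0 \<in> K" "\<phi> k (2 * x$0) = 2 * \<phi> k (x$0)" for k
      unfolding mult_2 using KK(3)[OF x0 x0] emb.emb_add[OF A.emb_i x0 x0] by auto
    have ey: "e * \<phi>' i' (2 * y$0) \<in> \<phi>' i' ` K'" "\<tau> (e * \<phi>' i' (2 * y$0)) = e * \<tau> (\<phi>' i' (2 * y$0))"
      using e(1) y2(1) t.emb_minus[of "\<phi>' i' (2 * y$0)"] p'.emb_minus[of "2 * y$0", symmetric] K'(5) by auto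
    have z: "\<phi> j (2 * x$0) = e * \<phi>' i' (2 * y$0)" using trj tr[of j] x2(2) y2(2) by simp
    then have "e * \<phi>' i' (2 * y$0) \<in> F" unfolding F_def using ey(1) x2(1) by (metis IntI imageI)
    then have "\<tau> (e * \<phi>' i' (2 * y$0)) = \<sigma> (\<phi> j (2 * x$0))" unfolding z by (rule \<tau>(2))
    then have "trace (mpow (g i) (m * m')) = e * \<tau> (\<phi>' i' (2 * y$0))"
      unfolding \<sigma>_eq[OF x2(1)] ey(2) using tr[of i] x2(2) by simp
    moreover have "m * m' > 0" using m(1) m'(1) by simp
    ultimately show ?thesis using e(1) x(1) y(1,2) trj y2 by metis
  qed
  have pw: "det (mpow (g k) n) = 1" "tlen (mpow (g k) n) = n * tlen (g k)" if "g \<in> \<Gamma>" for g k n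
    using det_mpow tlen_mpow SLG_det[OF \<Gamma> that] by blast+
  have u: "k = i'" for k :: unit by (simp add: i'_def)
  from B.embedding_cases[OF \<tau>\<phi>] show ?thesis
  proof cases
    case (1 k)
    have "tlen (g i) = 1 * tlen (g j)" if g: "g \<in> \<Gamma>" for g
    proof -
      obtain n :: nat and y :: "complex^4" and s where n: "n > 0" "s = 1 \<or> s = -1" "trace (mpow (g j) n) = s * \<phi>' i' (2 * y$0)"
        "trace (mpow (g i) n) = s * \<tau> (\<phi>' i' (2 * y$0))" "2 * y$0 \<in> K'" using key[OF g] by blast
      have "\<tau> (\<phi>' i' (2 * y$0)) = \<phi>' i' (2 * y$0)" using 1 n(5) u[of k] by (simp add: same_emb_def)
      then have "trace (mpow (g i) n) = 1 * trace (mpow (g j) n)" using n(3,4) by simp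
      then have "tlen (mpow (g i) n) = tlen (mpow (g j) n)" using tlen_cong[OF pw(1)[OF g] pw(1)[OF g]] by blast
      then show ?thesis using pw(2)[OF g] n(1) by simp
    qed
    then show ?thesis using that by blast
  next
    case (2 k)
    have "tlen (g i) = 1 * tlen (g j)" if g: "g \<in> \<Gamma>" for g
    proof -
      obtain n :: nat and y :: "complex^4" and s where n: "n > 0" "s = 1 \<or> s = -1" "trace (mpow (g j) n) = s * \<phi>' i' (2 * y$0)"
        "trace (mpow (g i) n) = s * \<tau> (\<phi>' i' (2 * y$0))" "2 * y$0 \<in> K'" using key[OF g] by blast
      have "\<tau> (\<phi>' i' (2 * y$0)) = cnj (\<phi>' i' (2 * y$0))" using 2 n(5) u[of k] by (simp add: same_emb_def)
      then have "trace (mpow (g i) n) = 1 * cnj (trace (mpow (g j) n))" using n(2,3,4) by auto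
      then have "tlen (mpow (g i) n) = tlen (mpow (g j) n)" using tlen_cong[OF pw(1)[OF g] pw(1)[OF g]] by blast
      then show ?thesis using pw(2)[OF g] n(1) by simp
    qed
    then show ?thesis using that by blast
  next
    case 3
    have "tlen (g i) = 0 * tlen (g j)" if g: "g \<in> \<Gamma>" for g
    proof -
      obtain n :: nat and y :: "complex^4" and s where n: "n > 0" "s = 1 \<or> s = -1" "y \<in> Ord'" "nrd a' b' y = 1"
        "trace (mpow (g i) n) = s * \<tau> (\<phi>' i' (2 * y$0))" using key[OF g] by blast
      have "Im (trace (mpow (g i) n)) = 0 \<and> \<bar>Re (trace (mpow (g i) n))\<bar> \<le> 2"
        using 3[OF n(4,3)] n(2) unfolding n(5) by auto
      then have "tlen (mpow (g i) n) = 0" using tlen_eq_0_iff[OF pw(1)[OF g]] by blast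
      then show ?thesis using pw(2)[OF g] n(1) by simp
    qed
    then show ?thesis using that by blast
  qed
qed

lemma arithmetic_imp_proportional:
  fixes C :: "'n::finite set"
  assumes \<Delta>: "irr_arithmetic C \<Delta>" and \<Gamma>: "Gsubgroup C \<Gamma>" "\<Gamma> \<subseteq> \<Delta>"
    and \<Lambda>: "arith_fuchsian_or_kleinian \<Lambda>" "(\<lambda>g. g j) ` \<Gamma> \<subseteq> \<Lambda>"
  obtains c :: "'n \<Rightarrow> real" where "\<And>i. c i = 0 \<or> c i = 1" "\<And>g i. g \<in> \<Gamma> \<Longrightarrow> tlen (g i) = c i * tlen (g j)"
proof -
  obtain K a b Ord \<phi> I J where A: "arith_data C K a b Ord \<phi> I J" "commensurable (SLG C) \<Delta> (Gamma_star C a b Ord \<phi> I J)"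
    and D: "Gsubgroup C \<Delta>" using \<Delta> unfolding irr_arithmetic_def by blast
  obtain C' K' a' b' Ord' \<phi>' I' J' h where B: "arith_data (C' :: unit set) K' a' b' Ord' \<phi>' I' J'" "det h = 1"
    "commensurable SL2 \<Lambda> {h ** g () ** sl2_inv h | g. g \<in> Gamma_star C' a' b' Ord' \<phi>' I' J'}"
    and L: "subgroup \<Lambda> SL2" using \<Lambda>(1) unfolding arith_fuchsian_or_kleinian_def by blast
  have A': "arith C K a b Ord \<phi> I J" using A(1) by (rule arith.intro)
  have B': "arith C' K' a' b' Ord' \<phi>' I' J'" using B(1) by (rule arith.intro)
  have G: "subgroup \<Gamma> (SLG C)" using \<Gamma>(1) by (simp add: Gsubgroup_def)
  have fi: "fidx (SLG C) (\<Gamma> \<inter> arith.units a b Ord \<phi> I J) \<Gamma>"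
    by (rule arith.fidx_units[OF A' D A(2) \<Gamma>])
  have "\<forall>i. \<exists>c :: real. (c = 0 \<or> c = 1) \<and> (\<forall>g\<in>\<Gamma>. tlen (g i) = c * tlen (g j))"
    using cmp_proportional_lengths[OF A' B' G fi L \<Lambda>(2) B(2,3)] by metis
  from choice[OF this] show ?thesis using that by blast
qed

subsection \<open>The order spanned by a group of matrices\<close>

lemma span_mult:
  assumes S: "subring S" and mult: "\<And>p q. p \<in> P \<Longrightarrow> q \<in> P \<Longrightarrow> p ** q \<in> P"
    and u: "u \<in> rmod.rspan S scm P" and v: "v \<in> rmod.rspan S scm P"
  shows "u ** v \<in> rmod.rspan S scm P"
proof -
  interpret rmod S scm by (rule rmod_scm[OF S])
  have 1: "p ** v \<in> rspan P" if "p \<in> P" for p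
    by (rule rspan_hom[OF v, where f = "\<lambda>v. p ** v"])
      (use that mult in \<open>auto simp: mat2_distrib scm_mult intro: rspan_base\<close>)
  show ?thesis
    by (rule rspan_hom[OF u, where f = "\<lambda>u. u ** v"]) (use 1 in \<open>auto simp: mat2_distrib scm_mult\<close>)
qed

lemma span_trace:
  assumes S: "subring S" and tr: "\<And>p. p \<in> P \<Longrightarrow> trace p \<in> S" and u: "u \<in> rmod.rspan S scm P"
  shows "trace u \<in> S"
proof -
  interpret rmod S scm by (rule rmod_scm[OF S])
  show ?thesis using u
    by (induction rule: rspan.induct) (auto simp: tr subringD[OF S] mk_zero)
qed

lemma span_conj:
  assumes S: "subring S" and u: "u \<in> rmod.rspan S scm P"
    and "\<And>p. p \<in> P \<Longrightarrow> e ** p ** f \<in> rmod.rspan S scm P'"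
  shows "e ** u ** f \<in> rmod.rspan S scm P'"
proof -
  interpret rmod S scm by (rule rmod_scm[OF S])
  show ?thesis
    by (rule rspan_hom[OF u, where f = "\<lambda>u. e ** u ** f"]) (use assms(3) in \<open>auto simp: mat2_distrib scm_mult\<close>)
qed

lemma span_mono_ring:
  assumes S: "subring S" and S': "subring S'" "S \<subseteq> S'" and u: "u \<in> rmod.rspan S scm P"
  shows "u \<in> rmod.rspan S' scm P"
proof -
  interpret s: rmod S scm by (rule rmod_scm[OF S])
  interpret s': rmod S' scm by (rule rmod_scm[OF S'(1)])
  show ?thesis using u by (induction rule: s.rspan.induct) (use S'(2) in \<open>auto intro: s'.rspan.intros\<close>)
qed

lemma exists_generic_normal_form:
  assumes G: "mgrp P" and ne: "nonelementary P"
  obtains g h Q l m a c d where "g \<in> P" "h \<in> P" "det Q = 1" "l * m = 1" "cmod l > 1"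
    "sl2_inv Q ** g ** Q = mk l 0 0 m" "sl2_inv Q ** h ** Q = mk a 1 c d" "c \<noteq> 0" "tlen g > 0"
proof -
  obtain g where g: "g \<in> P" "tlen g > 0" by (rule nonelementary_loxodromic[OF ne G])
  have dt: "det g = 1" using g G by (simp add: mgrp_def)
  obtain l m where lm: "trace g = l + m" "l * m = 1" "cmod l \<ge> 1" by (rule exists_eigenvalues)
  have l1: "cmod l > 1" using g(2) tlen_eq_ln[OF dt lm] lm(3) by (auto simp: less_le)
  have neq: "l \<noteq> m" using norm_inverse_ratio(2,3)[OF lm(2) l1] by auto
  obtain Q where Q: "det Q = 1" "sl2_inv Q ** g ** Q = mk l 0 0 m"
    by (rule exists_diagonal[OF dt lm(1,2) neq])
  obtain h a b c d where h: "h \<in> P" "sl2_inv Q ** h ** Q = mk a b c d" "b \<noteq> 0" "c \<noteq> 0"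
    by (rule nonelementary_generic[OF ne G Q(1)])
  define s where "s = csqrt b"
  have s: "s * s = b" "s \<noteq> 0" using h by (auto simp: s_def simp flip: power2_eq_square)
  define q where "q = mk s 0 0 (1 / s)"
  have C: "sl2_inv (Q ** q) ** M ** (Q ** q) = sl2_inv q ** (sl2_inv Q ** M ** Q) ** q" for M
    by (simp add: sl2_inv_mult matrix_mul_assoc)
  have "det (Q ** q) = 1" using Q(1) s(2) by (simp add: det_mul q_def)
  moreover have "sl2_inv (Q ** q) ** g ** (Q ** q) = mk l 0 0 m" unfolding C Q(2) using s(2) by (simp add: q_def)
  moreover have "sl2_inv (Q ** q) ** h ** (Q ** q) = mk a 1 (b * c) d"
    unfolding C h(2) s(1)[symmetric] using s(2) by (simp add: q_def)
  ultimately show ?thesis using that g h lm l1 by (metis mult_eq_0_iff)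
qed

text \<open>What the construction needs of \<open>P\<close>, to be applied to \<open>p_j(N)\<close>.
  The assumption \<open>gen\<close> will make the order finitely generated; \<open>places\<close>
  leaves the identity and its conjugate as the only places that may be unramified.\<close>

locale trace_group =
  fixes P M :: "mat2 set" and F R :: "complex set"
  assumes P: "mgrp P" and ne: "nonelementary P" and M: "finite M" "M \<subseteq> P"
    and F_def: "F = gen_field (trace ` P)" and R_def: "R = {x \<in> F. algebraic_int x}"
    and nf: "number_field F" and int: "\<And>p. p \<in> P \<Longrightarrow> algebraic_int (trace p)"
    and gen: "P \<subseteq> rmod.rspan R scm M"
    and places: "\<And>\<tau>. embedding F \<tau> \<Longrightarrow> (\<forall>x\<in>F. \<tau> x = x) \<or> (\<forall>x\<in>F. \<tau> x = cnj x)
        \<or> (\<forall>p\<in>P. Im (\<tau> (trace p)) = 0 \<and> \<bar>Re (\<tau> (trace p))\<bar> \<le> 2)"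
begin

lemma F: "subfield F" and FR: "subring F"
  using subfield_gen_field subfield_subring by (auto simp: F_def)

lemma R: "subring R" and RF: "R \<subseteq> F"
  using FR subring_algebraic_int by (auto simp: R_def subring_def)

lemma trF: "p \<in> P \<Longrightarrow> trace p \<in> F" and trR: "p \<in> P \<Longrightarrow> trace p \<in> R"
  using gen_field_base[of "trace ` P"] int by (auto simp: F_def R_def)

sublocale r: rmod R scm
  by (rule rmod_scm[OF R])

sublocale f: rmod F scm
  by (rule rmod_scm[OF FR])

definition W where "W = r.rspan P"

text \<open>The norm one group of the order \<open>W\<close>, realized by matrices.\<close>

definition Q1 where "Q1 = {w \<in> W. det w = 1}"

lemma PD: "mat 1 \<in> P" "p \<in> P \<Longrightarrow> q \<in> P \<Longrightarrow> p ** q \<in> P" "p \<in> P \<Longrightarrow> sl2_inv p \<in> P" "p \<in> P \<Longrightarrow> det p = 1"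
  using P by (auto simp: mgrp_def)

lemma W_one: "mat 1 \<in> W" and W_mult: "u \<in> W \<Longrightarrow> v \<in> W \<Longrightarrow> u ** v \<in> W"
  using r.rspan_base[OF PD(1)] span_mult[OF R PD(2)] by (auto simp: W_def)

lemma Q1_subgroup: "subgroup Q1 SL2"
proof -
  interpret L: group SL2 by (rule group_SL2)
  show ?thesis
  proof (rule L.subgroupI)
    show "Q1 \<subseteq> carrier SL2" by (auto simp: Q1_def SL2_def)
    have "mat 1 \<in> Q1" using W_one by (simp add: Q1_def)
    then show "Q1 \<noteq> {}" by blast
    fix x assume x: "x \<in> Q1"
    have "trace x \<in> R" by (rule span_trace[OF R trR]) (use x in \<open>auto simp: Q1_def W_def\<close>)
    then have "sl2_inv x \<in> W" unfolding sl2_inv_eq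
      using x W_one by (auto simp: Q1_def W_def intro: r.rspan_diff r.rspan_scale)
    then show "inv\<^bsub>SL2\<^esub> x \<in> Q1" using x inv_SL2[of x] by (auto simp: Q1_def SL2_def)
    fix y assume "y \<in> Q1"
    then show "x \<otimes>\<^bsub>SL2\<^esub> y \<in> Q1" using x W_mult by (auto simp: Q1_def mult_SL2 det_mul)
  qed
qed

lemma P_sub_Q1: "P \<subseteq> Q1"
  using r.rspan_base[of _ P] PD(4) by (auto simp: Q1_def W_def)

text \<open>For a loxodromic \<open>g\<close>, diagonal with entries \<open>l\<close> and \<open>m\<close>, and a generic \<open>h\<close> the matrices
  \<open>I = g - (l + m)/2\<close> and \<open>J = [h,I]\<close> anticommute and have scalar squares in \<open>F\<close>. At a place where all
  traces of \<open>P\<close> lie in \<open>[-2,2]\<close> both squares are negative, since \<open>I\<^sup>2 = tr(g)\<^sup>2/4 - 1\<close> and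
  \<open>J\<^sup>2 = tr [g,h] - 2\<close>, so the algebra ramifies there.\<close>
theorem arithmetic_order:
  obtains C :: "unit set" and a b Ord \<phi> I J h where "C = {} \<or> C = UNIV" "arith_data C F a b Ord \<phi> I J" "det h = 1"
    "{h ** g () ** sl2_inv h | g. g \<in> Gamma_star C a b Ord \<phi> I J} = Q1"
proof -
  obtain g h Q l m p c d where gh: "g \<in> P" "h \<in> P" and Q: "det Q = 1" and lm: "l * m = 1" "cmod l > 1"
    and g': "sl2_inv Q ** g ** Q = mk l 0 0 m" and h': "sl2_inv Q ** h ** Q = mk p 1 c d" and c: "c \<noteq> 0" and tg: "tlen g > 0"
    by (rule exists_generic_normal_form[OF P ne])
  define N where "N x = sl2_inv Q ** x ** Q" for x
  have N_mult: "N (x ** y) = N x ** N y" for x y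
    unfolding N_def by (metis Q matrix_mul_assoc matrix_mul_rid sl2_inv_right)
  have N_inv: "N (Q ** x ** sl2_inv Q) = x" and inv_N: "Q ** N x ** sl2_inv Q = x" for x
    unfolding N_def by (metis Q matrix_mul_assoc matrix_mul_lid matrix_mul_rid sl2_inv_right sl2_inv_left)+
  have N_tr: "trace (N x) = trace x" and N_det: "det (N x) = det x" for x
    unfolding N_def using trace_conj[of "sl2_inv Q" x] Q by (simp_all add: det_mul)
  have N_sl2: "N (sl2_inv x) = sl2_inv (N x)" for x by (simp add: N_def sl2_inv_mult matrix_mul_assoc)
  have N_one: "N (mat 1) = mat 1" using Q by (simp add: N_def sl2_inv_left)
  define P' where "P' = N ` P"
  have P'D: "mat 1 \<in> P'" "x \<in> P' \<Longrightarrow> y \<in> P' \<Longrightarrow> x ** y \<in> P'" for x y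
    using PD(1,2) N_one by (auto simp: P'_def simp flip: N_mult intro: rev_image_eqI)
  define \<alpha> where "\<alpha> = (l - m) / 2"
  have \<alpha>0: "\<alpha> \<noteq> 0" using norm_inverse_ratio(2,3)[OF lm] by (auto simp: \<alpha>_def)
  define a where "a = \<alpha> * \<alpha>"
  define b where "b = - 4 * \<alpha> * \<alpha> * c"
  define I where "I = mk \<alpha> 0 0 (- \<alpha>)"
  define J where "J = mk 0 (- 2 * \<alpha>) (2 * \<alpha> * c) 0"
  have gN: "N g = mk l 0 0 m" and hN: "N h = mk p 1 c d" using g' h' by (simp_all add: N_def)
  have trg: "trace g = l + m" using N_tr[of g] gN by simp
  have pd: "p * d - c = 1" using N_det[of h] hN PD(4)[OF gh(2)] by simp
  define k where "k = g ** h ** sl2_inv g ** sl2_inv h"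
  have k: "k \<in> P" using gh PD by (simp add: k_def)
  have a_eq: "a = trace g * trace g / 4 - 1"
  proof -
    have "4 * a = (l + m) * (l + m) - 4 * (l * m)" by (simp add: a_def \<alpha>_def field_simps)
    then show ?thesis unfolding trg lm(1) by (simp add: field_simps)
  qed
  have b_eq: "b = trace k - 2"
  proof -
    have "trace (N k) = 2 * (l * m) * (p * d) - c * (l * l + m * m)"
      unfolding k_def N_mult N_sl2 gN hN by (simp add: algebra_simps)
    also have "\<dots> = 2 * (p * d) - c * (l * l + m * m)" using lm(1) by simp
    also have "p * d = 1 + c" using pd by (simp add: algebra_simps)
    finally have "trace k = 2 + 2 * c * (l * m) - c * (l * l + m * m)" using N_tr[of k] lm(1) by (simp add: algebra_simps)
    moreover have "b = 2 * c * (l * m) - c * (l * l + m * m)" by (simp add: b_def \<alpha>_def field_simps)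
    ultimately show ?thesis by simp
  qed
  note FD = subfieldD[OF F]
  have F4: "4 \<in> F" "2 \<in> F" using subsetD[OF Rats_in_subfield[OF F]] Rats_number_of by metis+
  have abF: "a \<in> F" "b \<in> F"
  proof -
    show "a \<in> F" unfolding a_eq by (intro FD(7) FD(8) FD(4) FD(2) F4 trF gh(1))
    show "b \<in> F" unfolding b_eq by (intro FD(7) F4 trF k)
  qed
  have ab0: "a \<noteq> 0" "b \<noteq> 0" using \<alpha>0 c by (auto simp: a_def b_def)
  have IJ: "I ** I = mat a" "J ** J = mat b" "I ** J = - (J ** I)"
    by (simp_all add: I_def J_def mat_mk a_def b_def algebra_simps)
  have IJ_eq: "I ** J = mk 0 (- 2 * a) (- 2 * a * c) 0" by (simp add: I_def J_def a_def algebra_simps)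
  interpret q: quat_rep F "\<lambda>x. x" a b I J
    by unfold_locales (use F embedding_id abF ab0 IJ in auto)
  define A where "A = f.rspan P'"
  have A_mult: "u \<in> A \<Longrightarrow> v \<in> A \<Longrightarrow> u ** v \<in> A" for u v
    unfolding A_def by (rule span_mult[OF FR P'D(2)])
  have A_tr: "u \<in> A \<Longrightarrow> trace u \<in> F" for u
    unfolding A_def by (rule span_trace[OF FR]) (auto simp: P'_def N_tr trF)
  have A_one: "mat 1 \<in> A" unfolding A_def by (rule f.rspan_base[OF P'D(1)])
  have gA: "N g \<in> A" "N h \<in> A" unfolding A_def using gh by (auto intro: f.rspan_base simp: P'_def)
  have IA: "I \<in> A"
  proof -
    have "I = N g - scm (trace g / 2) (mat 1)" by (simp add: gN trg I_def mat_mk \<alpha>_def field_simps)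
    moreover have "trace g / 2 \<in> F" using trF[OF gh(1)] FD F4 by simp
    ultimately show ?thesis using gA(1) A_one unfolding A_def by (auto intro: f.rspan_diff f.rspan_scale)
  qed
  have JA: "J \<in> A"
  proof -
    have "J = N h ** I - I ** N h" by (simp add: hN I_def J_def algebra_simps)
    then show ?thesis using A_mult[OF gA(2) IA] A_mult[OF IA gA(2)] unfolding A_def by (auto intro: f.rspan_diff)
  qed
  have IJA: "I ** J \<in> A" by (rule A_mult[OF IA JA])
  have rhoA: "q.rho x \<in> A" if "x \<in> quat_alg F" for x
    unfolding q.rho_eq using that IA JA IJA A_one unfolding A_def quat_alg_iff
    by (intro f.rspan_add f.rspan_scale) auto
  \<comment> \<open>Coordinates in the basis 1, \<open>I\<close>, \<open>J\<close>,
    \<open>I ** J\<close>, recovered from the trace form, for which this basis is orthogonal. The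
    minus sign in the last one comes from the square \<open>- a * b\<close> of
    \<open>I ** J\<close>.\<close>
  define co where "co x = (\<chi> t :: 4. if t = 0 then trace x / 2 else if t = 1 then trace (x ** I) / (2 * a)
    else if t = 2 then trace (x ** J) / (2 * b) else - trace (x ** (I ** J)) / (2 * a * b))" for x :: mat2
  have co_nth: "co x $ 0 = trace x / 2" "co x $ 1 = trace (x ** I) / (2 * a)"
    "co x $ 2 = trace (x ** J) / (2 * b)" "co x $ 3 = - trace (x ** (I ** J)) / (2 * a * b)" for x
    by (simp_all add: co_def)
  have cancel: "y = z" if "x \<noteq> 0" "x * y = x * z" for x y z :: complex using that by simp
  have rho_co: "q.rho (co x) = x" for x
  proof -
    obtain x1 x2 x3 x4 where x: "x = mk x1 x2 x3 x4" by (rule mk_cases)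
    define u0 u1 u2 u3 where u: "u0 = co x $ 0" "u1 = co x $ 1" "u2 = co x $ 2" "u3 = co x $ 3"
    have t0: "2 * u0 = x1 + x4" unfolding u co_nth x by simp
    have "2 * a * u1 = trace (x ** I)" unfolding u co_nth using ab0 by simp
    also have "\<dots> = \<alpha> * (x1 - x4)" by (simp add: x I_def algebra_simps)
    finally have "\<alpha> * (2 * \<alpha> * u1) = \<alpha> * (x1 - x4)" by (simp add: a_def mult_ac)
    then have t1: "2 * \<alpha> * u1 = x1 - x4" by (rule cancel[rotated]) (rule \<alpha>0)
    have "2 * b * u2 = trace (x ** J)" unfolding u co_nth using ab0 by simp
    also have "\<dots> = (2 * \<alpha>) * (c * x2 - x3)" by (simp add: x J_def algebra_simps)
    finally have "(2 * \<alpha>) * (- 4 * (\<alpha> * u2 * c)) = (2 * \<alpha>) * (c * x2 - x3)" by (simp add: b_def mult_ac)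
    then have t2: "- 4 * (\<alpha> * u2 * c) = c * x2 - x3" by (rule cancel[rotated]) (use \<alpha>0 in simp)
    have nz: "2 * a * b \<noteq> 0" using ab0 by simp
    have "2 * a * b * u3 = - trace (x ** (I ** J))"
      unfolding u co_nth by (simp only: times_divide_eq_right nonzero_mult_div_cancel_left[OF nz])
    also have "\<dots> = (2 * a) * (c * x2 + x3)" by (simp add: x IJ_eq algebra_simps)
    finally have "(2 * a) * (b * u3) = (2 * a) * (c * x2 + x3)" by (simp add: mult_ac)
    then have "b * u3 = c * x2 + x3" by (rule cancel[rotated]) (use ab0 in simp)
    then have t3: "- 4 * (a * u3 * c) = c * x2 + x3" by (simp add: b_def a_def mult_ac)
    have "q.rho (co x) = mk (u0 + u1 * \<alpha>) (- 2 * (\<alpha> * u2) - 2 * (a * u3))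
        (2 * (\<alpha> * u2 * c) - 2 * (a * u3 * c)) (u0 - u1 * \<alpha>)"
      unfolding q.rho_eq mat_mk IJ_eq unfolding J_def I_def u by (simp add: mult_ac)
    also have "\<dots> = x" unfolding x mk_eq_iff
    proof (intro conjI)
      have "2 * (u0 + u1 * \<alpha>) = 2 * u0 + 2 * \<alpha> * u1" by (simp add: algebra_simps)
      also have "\<dots> = 2 * x1" unfolding t0 t1 by simp
      finally show "u0 + u1 * \<alpha> = x1" by (rule cancel[rotated]) simp
      have "2 * (u0 - u1 * \<alpha>) = 2 * u0 - 2 * \<alpha> * u1" by (simp add: algebra_simps)
      also have "\<dots> = 2 * x4" unfolding t0 t1 by simp
      finally show "u0 - u1 * \<alpha> = x4" by (rule cancel[rotated]) simp
      have "(2 * c) * (- 2 * (\<alpha> * u2) - 2 * (a * u3)) = - 4 * (\<alpha> * u2 * c) + - 4 * (a * u3 * c)"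
        by (simp add: algebra_simps)
      also have "\<dots> = (2 * c) * x2" unfolding t2 t3 by simp
      finally show "- 2 * (\<alpha> * u2) - 2 * (a * u3) = x2" by (rule cancel[rotated]) (use c in simp)
      have "2 * (2 * (\<alpha> * u2 * c) - 2 * (a * u3 * c)) = - (- 4 * (\<alpha> * u2 * c)) + - 4 * (a * u3 * c)"
        by (simp add: algebra_simps)
      also have "\<dots> = 2 * x3" unfolding t2 t3 by simp
      finally show "2 * (\<alpha> * u2 * c) - 2 * (a * u3 * c) = x3" by (rule cancel[rotated]) simp
    qed
    finally show ?thesis .
  qed
  have co_F: "co x \<in> quat_alg F" if "x \<in> A" for x
    unfolding quat_alg_iff co_nth using A_tr[OF that] A_tr[OF A_mult[OF that IA]] A_tr[OF A_mult[OF that JA]]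
      A_tr[OF A_mult[OF that IJA]] FD abF F4 by auto
  have rho_inj: "x = y" if "q.rho x = q.rho y" for x y
  proof -
    have t: "trace I = 0" "trace J = 0" "trace (I ** J) = 0" by (simp_all add: I_def J_def)
    have tr0: "trace (q.rho z) = 2 * z $ 0" for z using q.rho_trace .
    have m: "trace (q.rho z ** I) = 2 * a * z $ 1" "trace (q.rho z ** J) = 2 * b * z $ 2"
      "trace (q.rho z ** (I ** J)) = - 2 * a * b * z $ 3" for z
      unfolding q.rho_eq mat_mk IJ_eq unfolding I_def J_def
      by (simp_all add: a_def b_def algebra_simps)
    have "co (q.rho z) = z" for z
      unfolding vec4_eq_iff co_nth tr0 m using ab0 by simp
    then show ?thesis using that by metis
  qed
  define W' where "W' = r.rspan P'"
  have W'A: "u \<in> W' \<Longrightarrow> u \<in> A" for u unfolding W'_def A_def by (rule span_mono_ring[OF R FR RF])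
  have W'_mult: "u \<in> W' \<Longrightarrow> v \<in> W' \<Longrightarrow> u ** v \<in> W'" for u v
    unfolding W'_def by (rule span_mult[OF R P'D(2)])
  have W'_one: "mat 1 \<in> W'" unfolding W'_def by (rule r.rspan_base[OF P'D(1)])
  have NW: "N w \<in> W'" if "w \<in> W" for w
    unfolding N_def W'_def
    by (rule span_conj[OF R that[unfolded W_def]]) (auto simp: P'_def N_def intro: r.rspan_base)
  have WN: "Q ** w ** sl2_inv Q \<in> W" if "w \<in> W'" for w
    unfolding W_def
    by (rule span_conj[OF R that[unfolded W'_def]]) (auto simp: P'_def inv_N intro: r.rspan_base)
  define M' where "M' = N ` M"
  have M': "finite M'" "M' \<subseteq> P'" using M by (auto simp: M'_def P'_def)
  have P'M': "P' \<subseteq> r.rspan M'"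
  proof
    fix x assume "x \<in> P'"
    then obtain y where y: "y \<in> P" "x = N y" by (auto simp: P'_def)
    have "y \<in> r.rspan M" using gen y(1) by blast
    then show "x \<in> r.rspan M'" unfolding y(2) N_def
      by (rule span_conj[OF R]) (auto simp: M'_def N_def intro: r.rspan_base)
  qed
  have W'M': "W' = r.rspan M'"
  proof
    show "W' \<subseteq> r.rspan M'" unfolding W'_def by (rule r.rspan_subset[OF P'M'])
    show "r.rspan M' \<subseteq> W'" unfolding W'_def using M'(2) by (intro r.rspan_subset) (auto intro: r.rspan_base)
  qed
  have AM': "A \<subseteq> f.rspan M'"
    unfolding A_def using P'M' span_mono_ring[OF R FR RF] by (intro f.rspan_subset) blast
  define Ord where "Ord = {x \<in> quat_alg F. q.rho x \<in> W'}"
  define B where "B = co ` M'"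
  have M'A: "M' \<subseteq> A" using M'(2) unfolding A_def by (auto intro: f.rspan_base)
  have BO: "B \<subseteq> Ord"
  proof
    fix v assume "v \<in> B"
    then obtain w where w: "w \<in> M'" "v = co w" unfolding B_def by blast
    have "w \<in> W'" unfolding W'_def using w(1) M'(2) r.rspan_base by blast
    moreover have "v \<in> quat_alg F" unfolding w(2) using w(1) M'A by (intro co_F) blast
    ultimately show "v \<in> Ord" unfolding Ord_def w(2) mem_Collect_eq rho_co by blast
  qed
  have BF: "B \<subseteq> quat_alg F" and finB: "finite B" using BO M'(1) unfolding Ord_def B_def by blast+
  \<comment> \<open>Coefficients are indexed by matrices in \<open>M'\<close> for spans and by
    coordinate vectors in \<open>B\<close> for the order; \<open>q.rho\<close> translates between
    the two since \<open>co\<close> is injective.\<close>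
  have comb: "q.rho (\<Sum>v\<in>B. (\<chi> t. k (q.rho v) * v$t)) = (\<Sum>w\<in>M'. scm (k w) w)" if "\<And>w. k w \<in> F" for k
  proof -
    have "inj_on co M'" by (rule inj_onI) (metis rho_co)
    then have "(\<Sum>v\<in>B. scm (k (q.rho v)) (q.rho v)) = (\<Sum>w\<in>M'. scm (k w) w)"
      unfolding B_def by (simp add: sum.reindex rho_co)
    then show ?thesis using q.rho_sum[OF finB BF, of "\<lambda>v. k (q.rho v)"] that by simp
  qed
  have Ord_eq: "Ord = {(\<Sum>v\<in>B. (\<chi> t. k v * v$t)) | k. \<forall>v. k v \<in> F \<and> algebraic_int (k v)}" (is "_ = ?S")
  proof
    show "Ord \<subseteq> ?S"
    proof
      fix x assume x: "x \<in> Ord"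
      then have "q.rho x \<in> r.rspan M'" using W'M' by (simp add: Ord_def)
      then obtain k where k: "\<forall>w. k w \<in> R" "q.rho x = (\<Sum>w\<in>M'. scm (k w) w)" unfolding r.rspan_finite[OF M'(1)] by blast
      have kF: "k w \<in> F" for w using k(1) RF by blast
      have "x = (\<Sum>v\<in>B. (\<chi> t. k (q.rho v) * v$t))"
        by (rule rho_inj, rule trans[OF k(2) comb[of k, OF kF, symmetric]])
      moreover have "\<forall>v. k (q.rho v) \<in> F \<and> algebraic_int (k (q.rho v))" using k(1) unfolding R_def by blast
      ultimately show "x \<in> ?S" unfolding mem_Collect_eq by (intro exI[of _ "\<lambda>v. k (q.rho v)"] conjI)
    qed
    show "?S \<subseteq> Ord"
    proof
      fix x assume "x \<in> ?S"
      then obtain k where k: "\<forall>v. k v \<in> F \<and> algebraic_int (k v)" "x = (\<Sum>v\<in>B. (\<chi> t. k v * v$t))" by blast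
      have kF: "k v \<in> F" "k v \<in> R" for v using k(1) unfolding R_def by blast+
      note s = q.rho_sum[OF finB BF, of k, OF kF(1), folded k(2)]
      have "(\<Sum>v\<in>B. scm (k v) (q.rho v)) \<in> W'"
        unfolding W'_def
      proof (intro r.rspan_sum r.rspan_scale kF(2))
        fix v assume "v \<in> B"
        then show "q.rho v \<in> r.rspan P'" using BO unfolding Ord_def W'_def by blast
      qed
      then show "x \<in> Ord" using s by (simp add: Ord_def)
    qed
  qed
  have spanF: "\<exists>B k. finite B \<and> B \<subseteq> Ord \<and> (\<forall>v. k v \<in> F) \<and> x = (\<Sum>v\<in>B. (\<chi> t. k v * v$t))" if x: "x \<in> quat_alg F" for x
  proof -
    have "q.rho x \<in> f.rspan M'" using rhoA[OF x] AM' by blast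
    then obtain k where k: "\<forall>w. k w \<in> F" "q.rho x = (\<Sum>w\<in>M'. scm (k w) w)" unfolding f.rspan_finite[OF M'(1)] by blast
    then have kF: "k w \<in> F" for w by blast
    have "x = (\<Sum>v\<in>B. (\<chi> t. k (q.rho v) * v$t))"
      by (rule rho_inj, rule trans[OF k(2) comb[of k, OF kF, symmetric]])
    then show ?thesis using finB BO kF by (intro exI[of _ B] exI[of _ "\<lambda>v. k (q.rho v)"] conjI allI)
  qed
  have OrdF: "Ord \<subseteq> quat_alg F" by (auto simp: Ord_def)
  have one_Ord: "qone \<in> Ord" using W'_one q.rho_one FD by (auto simp: Ord_def quat_alg_iff qone_def)
  have cl_Ord: "x + y \<in> Ord \<and> - x \<in> Ord \<and> qmult a b x y \<in> Ord" if "x \<in> Ord" "y \<in> Ord" for x y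
    using that quat_alg_closed(1,2,3)[OF F _ _ abF abF(1), of x y] W'_mult
    by (auto simp: Ord_def q.rho_add q.rho_uminus q.rho_mult W'_def intro: r.rspan_add r.rspan_minus)
  have ord: "is_order F a b Ord" unfolding is_order_def
  proof (intro conjI ballI)
    show "\<exists>B. finite B \<and> B \<subseteq> Ord \<and> Ord = {\<Sum>v\<in>B. \<chi> t. c v * v $ t |c. \<forall>v. c v \<in> F \<and> algebraic_int (c v)}"
      by (intro exI[of _ B] conjI finB BO Ord_eq)
  qed (use OrdF one_Ord cl_Ord spanF in blast)+
  \<comment> \<open>The single factor is real or complex according to the identity embedding: the
    Fuchsian or the Kleinian case.\<close>
  define C :: "unit set" where "C = (if real_emb F (\<lambda>x. x) then {} else UNIV)"
  have neg: "\<not> split_real \<tau> a b" if \<tau>: "embedding F \<tau>" and bd: "\<forall>p\<in>P. Im (\<tau> (trace p)) = 0 \<and> \<bar>Re (\<tau> (trace p))\<bar> \<le> 2" for \<tau>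
  proof -
    interpret t: emb F \<tau> using F \<tau> by unfold_locales
    have "4 * a = trace g * trace g - 4" by (simp add: a_eq)
    then have "\<tau> (4 * a) = \<tau> (trace g) * \<tau> (trace g) - \<tau> 4"
      using trF[OF gh(1)] FD F4 by (simp add: t.emb_diff t.emb_mult)
    moreover have "\<tau> 4 = 4" "\<tau> 2 = 2" using t.emb_of_nat[of 4] t.emb_of_nat[of 2] by simp_all
    ultimately have ta: "4 * \<tau> a = \<tau> (trace g) * \<tau> (trace g) - 4" using t.emb_mult[OF F4(1) abF(1)] by simp
    have tb: "\<tau> b = \<tau> (trace k) - 2" unfolding b_eq using trF[OF k] F4 \<open>\<tau> 2 = 2\<close> by (simp add: t.emb_diff)
    have n0: "\<tau> a \<noteq> 0" "\<tau> b \<noteq> 0" using ab0 abF t.emb_eq_0_iff by auto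
    define x where "x = Re (\<tau> (trace g))"
    have x: "\<tau> (trace g) = of_real x" "\<bar>x\<bar> \<le> 2" using bd gh(1) by (auto simp: x_def complex_eq_iff)
    have x4: "x * x \<le> 4" using x(2) abs_le_square_iff[of x 2] by (simp add: power2_eq_square)
    have "4 * \<tau> a = of_real (x * x - 4)" using ta x by simp
    then have "Im (4 * \<tau> a) = 0" "Re (4 * \<tau> a) = x * x - 4" by simp_all
    then have a1: "Im (\<tau> a) = 0" "Re (\<tau> a) \<le> 0" using x4 by simp_all
    have b1: "Im (\<tau> b) = 0" "Re (\<tau> b) \<le> 0" unfolding tb using bd k by auto
    have "Re (\<tau> a) \<noteq> 0" "Re (\<tau> b) \<noteq> 0" using n0 a1 b1 by (auto simp: complex_eq_iff)
    then show ?thesis using a1 b1 by (intro not_split_real_if_neg) auto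
  qed
  have real_of_bd: "real_emb F \<tau>" if "embedding F \<tau>" "\<forall>p\<in>P. Im (\<tau> (trace p)) = 0 \<and> \<bar>Re (\<tau> (trace p))\<bar> \<le> 2" for \<tau>
    using real_on_gen_field[of "trace ` P" \<tau>] that unfolding F_def by blast
  \<comment> \<open>If \<open>F\<close> is real, the loxodromic \<open>g\<close> has real trace
    outside [-2, 2]. So \<open>a\<close> is positive, \<open>\<alpha>\<close> is real, and
    \<open>c\<close> lies in \<open>F\<close>: the normal form is already real.\<close>
  have realIJ: "real_mat I \<and> real_mat J" if re: "real_emb F (\<lambda>x. x)"
  proof -
    have im: "Im x = 0" if "x \<in> F" for x using re that by (simp add: real_emb_def)
    define x where "x = Re (trace g)"
    have x: "trace g = of_real x" using im[OF trF[OF gh(1)]] by (simp add: x_def complex_eq_iff)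
    have "\<bar>x\<bar> > 2" using tg tlen_eq_0_iff[OF PD(4)[OF gh(1)]] x by auto
    then have "x * x > 4" using abs_le_square_iff[of x 2] by (simp add: power2_eq_square not_le[symmetric])
    moreover have "a = of_real (x * x / 4 - 1)" unfolding a_eq x by simp
    ultimately have "Re a > 0" "Im a = 0" by auto
    then have "Re \<alpha> * Im \<alpha> = 0" "Re \<alpha> * Re \<alpha> - Im \<alpha> * Im \<alpha> > 0" by (auto simp: a_def)
    then have i\<alpha>: "Im \<alpha> = 0" by (auto simp: not_less[symmetric])
    have "c = - b / (4 * a)" using \<alpha>0 by (simp add: a_def b_def)
    then have "c \<in> F" using FD abF F4 by auto
    then have "Im c = 0" by (rule im)
    then show ?thesis using i\<alpha> by (simp add: I_def J_def real_mat_mk)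
  qed
  have id_cases: "same_emb F \<tau> (\<lambda>x. x) \<or> same_emb F \<tau> (cnj \<circ> (\<lambda>x. x)) \<or> (real_emb F \<tau> \<and> \<not> split_real \<tau> a b)"
    if "embedding F \<tau>" for \<tau>
    using places[OF that] neg[OF that] real_of_bd[OF that] unfolding same_emb_def comp_def by blast
  have A1: "arith_data C F a b Ord (\<lambda>_ x. x) (\<lambda>_. I) (\<lambda>_. J)"
    unfolding arith_data_def
  proof (intro conjI allI ballI impI)
    show "number_field F" "a \<in> F" "b \<in> F" "a \<noteq> 0" "b \<noteq> 0" "is_order F a b Ord" by (fact nf abF ab0 ord)+
    show "embedding F (\<lambda>x. x)" by (rule embedding_id)
    show "I ** I = mat a" "J ** J = mat b" "I ** J = - (J ** I)" by (fact IJ)+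
  next
    fix i :: unit
    show "(i \<in> C) = (\<not> real_emb F (\<lambda>x. x))" by (simp add: C_def)
    show "split_real (\<lambda>x. x) a b" if "i \<notin> C"
      unfolding split_real_def using IJ realIJ that by (auto simp: C_def split: if_splits)
    show "real_mat I" "real_mat J" if "i \<notin> C" using realIJ that by (auto simp: C_def split: if_splits)
  next
    fix i j :: unit assume "i \<noteq> j"
    then show "\<not> same_emb F (\<lambda>x. x) (\<lambda>x. x)" by simp
  next
    fix i j assume "i \<in> C" "j \<in> C"
    then have "\<not> real_emb F (\<lambda>x. x)" by (auto simp: C_def split: if_splits)
    then show "\<not> same_emb F (\<lambda>x. x) (cnj \<circ> (\<lambda>x. x))"
      by (auto simp: real_emb_def same_emb_def complex_eq_iff)
  next
    fix \<tau> assume \<tau>: "embedding F \<tau> \<and> \<not> real_emb F \<tau>"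
    then have s: "same_emb F \<tau> (\<lambda>x. x) \<or> same_emb F \<tau> (cnj \<circ> (\<lambda>x. x))" using id_cases by blast
    moreover have "\<not> real_emb F (\<lambda>x. x)" using s \<tau> by (auto simp: real_emb_def same_emb_def)
    ultimately show "\<exists>i\<in>C. same_emb F \<tau> (\<lambda>x. x) \<or> same_emb F \<tau> (cnj \<circ> (\<lambda>x. x))" by (auto simp: C_def)
  next
    fix \<tau> assume \<tau>: "embedding F \<tau> \<and> real_emb F \<tau> \<and> (\<forall>i. i \<notin> C \<longrightarrow> \<not> same_emb F \<tau> (\<lambda>x. x))"
    show "\<not> split_real \<tau> a b"
    proof (rule ccontr)
      assume "\<not> \<not> split_real \<tau> a b"
      then have s: "same_emb F \<tau> (\<lambda>x. x) \<or> same_emb F \<tau> (cnj \<circ> (\<lambda>x. x))" using id_cases \<tau> by blast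
      then have re: "real_emb F (\<lambda>x. x)" using \<tau> by (auto simp: real_emb_def same_emb_def)
      then have "same_emb F \<tau> (\<lambda>x. x)" using s by (auto simp: real_emb_def same_emb_def complex_eq_iff)
      then show False using \<tau> re by (auto simp: C_def)
    qed
  qed
  have A2: "{Q ** g () ** sl2_inv Q | g. g \<in> Gamma_star C a b Ord (\<lambda>_ x. x) (\<lambda>_. I) (\<lambda>_. J)} = Q1" (is "?G = _")
  proof
    show "?G \<subseteq> Q1"
    proof
      fix w assume "w \<in> ?G"
      then obtain s :: "unit \<Rightarrow> mat2" and x where sx: "s \<in> signs" "x \<in> Ord" "nrd a b x = 1" "w = Q ** (s () ** q.rho x) ** sl2_inv Q"
        by (auto simp: Gamma_star_def sat_def)
      obtain e where e: "e = 1 \<or> e = -1" "\<And>N. s () ** N = scm e N" using sign_facts(6)[OF signsD[OF sx(1)]] by blast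
      have "e \<in> R" using e(1) subringD[OF R] by auto
      then have "s () ** q.rho x \<in> W'" unfolding e(2) W'_def
        using sx(2) by (intro r.rspan_scale) (auto simp: Ord_def W'_def)
      then have "w \<in> W" unfolding sx(4) by (rule WN)
      moreover have "det w = 1"
        using q.rho_det[of x] sx(2,3) sign_facts(1)[OF signsD[OF sx(1)]] Q by (simp add: sx(4) det_mul Ord_def)
      ultimately show "w \<in> Q1" by (simp add: Q1_def)
    qed
    show "Q1 \<subseteq> ?G"
    proof
      fix w assume w: "w \<in> Q1"
      then have Nw: "N w \<in> W'" using NW by (simp add: Q1_def)
      have x: "co (N w) \<in> Ord" using Nw W'A co_F rho_co by (simp add: Ord_def)
      have "nrd a b (co (N w)) = det (q.rho (co (N w)))" using q.rho_det OrdF x by auto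
      also have "\<dots> = 1" using rho_co N_det w by (simp add: Q1_def)
      finally have n: "nrd a b (co (N w)) = 1" .
      have "(\<lambda>i :: unit. mat 1) \<in> signs" by (simp add: signs_def)
      moreover have "(\<lambda>_. q.rho (co (N w))) \<in> {(\<lambda>i :: unit. q.rho x) | x. x \<in> Ord \<and> nrd a b x = 1}"
        unfolding mem_Collect_eq by (intro exI[of _ "co (N w)"] conjI refl x n)
      ultimately have "(\<lambda>i :: unit. mat 1 ** q.rho (co (N w))) \<in> Gamma_star C a b Ord (\<lambda>_ x. x) (\<lambda>_. I) (\<lambda>_. J)"
        unfolding Gamma_star_def by (rule satI)
      then have G: "(\<lambda>i :: unit. N w) \<in> Gamma_star C a b Ord (\<lambda>_ x. x) (\<lambda>_. I) (\<lambda>_. J)"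
        by (simp only: rho_co matrix_mul_lid)
      show "w \<in> ?G" unfolding mem_Collect_eq
        by (intro exI[of _ "\<lambda>i. N w"] conjI G) (simp only: inv_N)
    qed
  qed
  have A3: "C = {} \<or> C = UNIV" by (simp add: C_def)
  show ?thesis by (rule that[OF A3 A1 Q A2])
qed

theorem normalizer_in_arithmetic:
  assumes E: "mgrp E" and PE: "P \<subseteq> E" and norm: "\<And>e p. e \<in> E \<Longrightarrow> p \<in> P \<Longrightarrow> e ** p ** sl2_inv e \<in> P"
    and T: "finite T" "T \<subseteq> E" "\<And>e. e \<in> E \<Longrightarrow> \<exists>p\<in>P. \<exists>t\<in>T. e = p ** t"
  obtains \<Lambda> where "arith_fuchsian_or_kleinian \<Lambda>" "E \<subseteq> \<Lambda>"
proof -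
  interpret L: group SL2 by (rule group_SL2)
  obtain C :: "unit set" and a b Ord \<phi> I J h where A: "C = {} \<or> C = UNIV" "arith_data C F a b Ord \<phi> I J" "det h = 1"
    "{h ** g () ** sl2_inv h | g. g \<in> Gamma_star C a b Ord \<phi> I J} = Q1" by (rule arithmetic_order)
  have ED: "mat 1 \<in> E" "e \<in> E \<Longrightarrow> e' \<in> E \<Longrightarrow> e ** e' \<in> E" "e \<in> E \<Longrightarrow> sl2_inv e \<in> E" "e \<in> E \<Longrightarrow> det e = 1" for e e'
    using E by (auto simp: mgrp_def)
  have Q1D: "mat 1 \<in> Q1" "x \<in> Q1 \<Longrightarrow> y \<in> Q1 \<Longrightarrow> x ** y \<in> Q1" "x \<in> Q1 \<Longrightarrow> sl2_inv x \<in> Q1" "x \<in> Q1 \<Longrightarrow> det x = 1" for x y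
    using subgroup.one_closed[OF Q1_subgroup] subgroup.m_closed[OF Q1_subgroup] subgroup.m_inv_closed[OF Q1_subgroup, of x]
      inv_SL2[of x] by (auto simp: SL2_def Q1_def)
  have conj: "e ** x ** sl2_inv e \<in> Q1" if "e \<in> E" "x \<in> Q1" for e x
  proof -
    have "e ** x ** sl2_inv e \<in> W" unfolding W_def
      by (rule span_conj[OF R]) (use that norm in \<open>auto simp: Q1_def W_def intro: r.rspan_base\<close>)
    then show ?thesis using that ED(4) by (auto simp: Q1_def det_mul)
  qed
  define \<Lambda> where "\<Lambda> = {x ** e | x e. x \<in> Q1 \<and> e \<in> E}"
  have LI: "x ** e \<in> \<Lambda>" if "x \<in> Q1" "e \<in> E" for x e using that by (auto simp: \<Lambda>_def)
  have swap: "e ** x = (e ** x ** sl2_inv e) ** e" if "e \<in> E" for e x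
    using sl2_inv_left[OF ED(4)[OF that]] by (simp add: matrix_mul_assoc[symmetric])
  have Lc: "y \<in> carrier SL2" if "y \<in> \<Lambda>" for y
    using that Q1D(4) ED(4) by (auto simp: \<Lambda>_def SL2_def det_mul)
  have \<Lambda>: "subgroup \<Lambda> SL2"
  proof (rule L.subgroupI)
    show "\<Lambda> \<subseteq> carrier SL2" using Lc by blast
    show "\<Lambda> \<noteq> {}" using LI[OF Q1D(1) ED(1)] by blast
    fix y assume y: "y \<in> \<Lambda>"
    then obtain x e where xe: "x \<in> Q1" "e \<in> E" "y = x ** e" by (auto simp: \<Lambda>_def)
    have "sl2_inv y = (sl2_inv e ** sl2_inv x ** sl2_inv (sl2_inv e)) ** sl2_inv e"
      unfolding xe(3) sl2_inv_mult by (rule swap[OF ED(3)[OF xe(2)]])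
    then have "sl2_inv y \<in> \<Lambda>" using LI[OF conj[OF ED(3)[OF xe(2)] Q1D(3)[OF xe(1)]] ED(3)[OF xe(2)]] by simp
    then show "inv\<^bsub>SL2\<^esub> y \<in> \<Lambda>" using inv_SL2[OF Lc[OF y]] by simp
    fix z assume "z \<in> \<Lambda>"
    then obtain x' e' where xe': "x' \<in> Q1" "e' \<in> E" "z = x' ** e'" by (auto simp: \<Lambda>_def)
    have "y ** z = x ** (e ** x') ** e'" by (simp add: xe(3) xe'(3) matrix_mul_assoc)
    also have "\<dots> = (x ** (e ** x' ** sl2_inv e)) ** (e ** e')"
      by (subst swap[OF xe(2)]) (simp add: matrix_mul_assoc)
    finally have "y ** z \<in> \<Lambda>" using LI[OF Q1D(2)[OF xe(1) conj[OF xe(2) xe'(1)]] ED(2)[OF xe(2) xe'(2)]] by simp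
    then show "y \<otimes>\<^bsub>SL2\<^esub> z \<in> \<Lambda>" by (simp add: mult_SL2)
  qed
  have E\<Lambda>: "E \<subseteq> \<Lambda>" using LI[OF Q1D(1)] by fastforce
  have Q\<Lambda>: "Q1 \<subseteq> \<Lambda>" using LI[OF _ ED(1)] by fastforce
  \<comment> \<open>Because \<open>P \<subseteq> Q1\<close>, the representatives of \<open>E\<close>
    modulo \<open>P\<close> also serve for \<open>\<Lambda>\<close> modulo
    \<open>Q1\<close>.\<close>
  have "fidx SL2 Q1 \<Lambda>" unfolding fidx_def
  proof (intro exI[of _ T] conjI ballI)
    fix y assume "y \<in> \<Lambda>"
    then obtain x e where xe: "x \<in> Q1" "e \<in> E" "y = x ** e" by (auto simp: \<Lambda>_def)
    obtain p t where pt: "p \<in> P" "t \<in> T" "e = p ** t" using T(3)[OF xe(2)] by blast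
    have "y = (x ** p) \<otimes>\<^bsub>SL2\<^esub> t" by (simp add: xe pt mult_SL2 matrix_mul_assoc)
    moreover have "x ** p \<in> Q1" using Q1D(2)[OF xe(1)] P_sub_Q1 pt(1) by blast
    ultimately show "\<exists>h\<in>Q1. \<exists>t\<in>T. y = h \<otimes>\<^bsub>SL2\<^esub> t" using pt(2) by blast
  qed (use T E\<Lambda> in auto)
  then have 1: "fin_index SL2 Q1 \<Lambda>" by (rule L.fidx_imp_fin_index[OF Q1_subgroup \<Lambda>])
  have "fidx SL2 Q1 Q1" unfolding fidx_def
    by (intro exI[of _ "{mat 1}"]) (use Q1D(1) in \<open>auto simp: mult_SL2\<close>)
  then have 2: "fin_index SL2 Q1 Q1" by (rule L.fidx_imp_fin_index[OF Q1_subgroup Q1_subgroup])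
  have "commensurable SL2 \<Lambda> Q1" unfolding commensurable_def using 1 2 Q\<Lambda> by (simp add: Int_absorb1)
  moreover have "- mat 1 \<in> \<Lambda>"
  proof -
    have "- mat 1 \<in> W" using r.rspan_minus W_one unfolding W_def by blast
    then have "- mat 1 \<in> Q1" using sign_facts(1)[of "- mat 1"] by (simp add: Q1_def)
    then show ?thesis using Q\<Lambda> by blast
  qed
  ultimately have "arith_fuchsian_or_kleinian \<Lambda>"
    unfolding arith_fuchsian_or_kleinian_def using \<Lambda> A
    by (intro conjI exI[of _ C] exI[of _ F] exI[of _ a] exI[of _ b] exI[of _ Ord] exI[of _ \<phi>] exI[of _ I] exI[of _ J] exI[of _ h])
      simp_all
  then show ?thesis using that E\<Lambda> by blast
qed

end

subsection \<open>From proportional lengths to arithmetic groups\<close>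

lemma (in group) fidx_refl:
  assumes H: "subgroup H G"
  shows "fidx G H H"
  unfolding fidx_def
  by (intro exI[of _ "{\<one>}"]) (use subgroup.one_closed[OF H] subgroup.mem_carrier[OF H] in auto)

text \<open>A finite orbit of \<open>H\<close> would make the orbit of \<open>\<Gamma>\<close> a
  subset of finitely many translates of it.\<close>

lemma nonelementary_fidx:
  assumes H: "subgroup H (SLG C)" and \<Gamma>: "subgroup \<Gamma> (SLG C)" and fi: "fidx (SLG C) H \<Gamma>"
    and ne: "nonelementary ((\<lambda>g. g j) ` \<Gamma>)"
  shows "nonelementary ((\<lambda>g. g j) ` H)"
proof -
  obtain T where T: "finite T" "T \<subseteq> \<Gamma>" "\<And>k. k \<in> \<Gamma> \<Longrightarrow> \<exists>h\<in>H. \<exists>t\<in>T. k = h \<otimes>\<^bsub>SLG C\<^esub> t"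
    using fi unfolding fidx_def by blast
  \<comment> \<open>The representatives stand to the right of \<open>H\<close>, but translating an
    orbit needs them on the left; the decomposition of the inverse provides this.\<close>
  have dec: "\<exists>t\<in>T. \<exists>h\<in>H. g j = sl2_inv (t j) ** h j" if g: "g \<in> \<Gamma>" for g
  proof -
    obtain h t where ht: "h \<in> H" "t \<in> T" "(\<lambda>i. sl2_inv (g i)) = h \<otimes>\<^bsub>SLG C\<^esub> t"
      using T(3)[OF SLG_subgroupD(3)[OF \<Gamma> g]] by blast
    have "sl2_inv (g j) = h j ** t j" using fun_cong[OF ht(3), of j] by (simp add: mult_SLG)
    then have "g j = sl2_inv (t j) ** sl2_inv (h j)" by (metis sl2_inv_inv sl2_inv_mult)
    moreover have "(\<lambda>i. sl2_inv (h i)) \<in> H" by (rule SLG_subgroupD(3)[OF H ht(1)])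
    ultimately show ?thesis using ht(2) by (intro bexI[of _ t] bexI[of _ "\<lambda>i. sl2_inv (h i)"])
  qed
  have orbit: "finite ((\<lambda>g. f g) ` (\<lambda>g. g j) ` \<Gamma>)"
    if fin: "finite ((\<lambda>g. f g) ` (\<lambda>g. g j) ` H)" and act: "\<And>x y. f (x ** y) = a x (f y)"
    for f :: "mat2 \<Rightarrow> 'c" and a
  proof (rule finite_subset)
    show "f ` (\<lambda>g. g j) ` \<Gamma> \<subseteq> (\<Union>t\<in>T. a (sl2_inv (t j)) ` f ` (\<lambda>g. g j) ` H)"
    proof clarify
      fix g assume "g \<in> \<Gamma>"
      then obtain t h where th: "t \<in> T" "h \<in> H" "g j = sl2_inv (t j) ** h j" using dec by blast
      have "f (g j) = a (sl2_inv (t j)) (f (h j))" unfolding th(3) by (rule act)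
      then show "f (g j) \<in> (\<Union>t\<in>T. a (sl2_inv (t j)) ` f ` (\<lambda>g. g j) ` H)" using th by blast
    qed
    show "finite (\<Union>t\<in>T. a (sl2_inv (t j)) ` f ` (\<lambda>g. g j) ` H)" using T(1) fin by blast
  qed
  show ?thesis unfolding nonelementary_def
  proof (intro conjI notI)
    assume "\<exists>X\<in>H3. finite ((\<lambda>g. actH g X) ` (\<lambda>g. g j) ` H)"
    then obtain X where X: "X \<in> H3" "finite ((\<lambda>g. actH g X) ` (\<lambda>g. g j) ` H)" by blast
    have "finite ((\<lambda>g. actH g X) ` (\<lambda>g. g j) ` \<Gamma>)" by (rule orbit[OF X(2), of actH]) (rule actH_mult)
    then show False using ne X(1) unfolding nonelementary_def by blast
  next
    assume "\<exists>v. v \<noteq> 0 \<and> finite ((\<lambda>g. cline (g *v v)) ` (\<lambda>g. g j) ` H)"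
    then obtain v where v: "v \<noteq> 0" "finite ((\<lambda>g. cline (g *v v)) ` (\<lambda>g. g j) ` H)" by blast
    have "finite ((\<lambda>g. cline (g *v v)) ` (\<lambda>g. g j) ` \<Gamma>)"
      by (rule orbit[OF v(2), of "\<lambda>x. (`) (\<lambda>w. x *v w)"]) (simp add: cline_mulv[symmetric] matrix_vector_mul_assoc)
    then show False using ne v(1) unfolding nonelementary_def by blast
  qed
qed

text \<open>The three cases match the three kinds of places of the field to be constructed: the
  identity, its conjugate, and the ramified real ones.\<close>

definition trace_alt :: "('n \<Rightarrow> mat2) set \<Rightarrow> 'n \<Rightarrow> 'n \<Rightarrow> bool" where
  "trace_alt H j i \<longleftrightarrow> (\<forall>g\<in>H. trace (g i) = trace (g j)) \<or> (\<forall>g\<in>H. trace (g i) = cnj (trace (g j)))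
     \<or> (\<forall>g\<in>H. Im (trace (g i)) = 0 \<and> \<bar>Re (trace (g i))\<bar> \<le> 2)"

lemma trace_alt_mono: "trace_alt H j i \<Longrightarrow> H' \<subseteq> H \<Longrightarrow> trace_alt H' j i"
  unfolding trace_alt_def by blast

text \<open>For \<open>\<kappa> = 0\<close> all lengths in coordinate \<open>i\<close> vanish.
  Otherwise rigidity identifies the two conjugated coordinates \<open>A\<close> and \<open>B\<close>
  up to a sign; the sign is a character, and \<open>H'\<close> is its kernel.\<close>

lemma trace_alternative:
  assumes H: "subgroup H (SLG C)" and ne: "nonelementary ((\<lambda>g. g j) ` H)"
    and \<kappa>: "\<kappa> \<ge> 0" "\<And>g. g \<in> H \<Longrightarrow> tlen (g i) = \<kappa> * tlen (g j)"
  obtains H' where "subgroup H' (SLG C)" "H' \<subseteq> H" "fidx (SLG C) H' H" "trace_alt H' j i"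
proof (cases "\<kappa> = 0")
  case True
  have "Im (trace (g i)) = 0 \<and> \<bar>Re (trace (g i))\<bar> \<le> 2" if g: "g \<in> H" for g
    using \<kappa>(2)[OF g] True tlen_eq_0_iff[OF SLG_det[OF H g]] by simp
  then have "trace_alt H j i" unfolding trace_alt_def by blast
  then show ?thesis using that[OF H _ group.fidx_refl[OF group_SLG H]] by blast
next
  case False
  interpret G: group "SLG C" by (rule group_SLG)
  define S where "S = (\<lambda>g. (g j, g i)) ` H"
  have SI: "(g j, g i) \<in> S" if "g \<in> H" for g using that by (auto simp: S_def)
  have SE: "\<exists>g\<in>H. x = g j \<and> y = g i" if "(x, y) \<in> S" for x y using that by (auto simp: S_def)
  have S: "mgrp2 S"
  proof -
    have "(mat 1, mat 1) \<in> S" using SI[OF SLG_subgroupD(1)[OF H]] by simp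
    moreover have "det x = 1 \<and> det y = 1 \<and> (sl2_inv x, sl2_inv y) \<in> S" if xy: "(x, y) \<in> S" for x y
    proof -
      obtain g where g: "g \<in> H" "x = g j" "y = g i" using SE[OF xy] by blast
      show ?thesis using SLG_det[OF H g(1)] SI[OF SLG_subgroupD(3)[OF H g(1)]] by (simp add: g)
    qed
    moreover have "(x ** x', y ** y') \<in> S" if xy: "(x, y) \<in> S" "(x', y') \<in> S" for x y x' y'
    proof -
      obtain g where g: "g \<in> H" "x = g j" "y = g i" using SE[OF xy(1)] by blast
      obtain h where h: "h \<in> H" "x' = h j" "y' = h i" using SE[OF xy(2)] by blast
      show ?thesis using SI[OF SLG_subgroupD(2)[OF H g(1) h(1)]] by (simp add: g h)
    qed
    ultimately show ?thesis unfolding mgrp2_def by blast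
  qed
  have len: "tlen y = \<kappa> * tlen x" if xy: "(x, y) \<in> S" for x y
  proof -
    obtain g where g: "g \<in> H" "x = g j" "y = g i" using SE[OF xy] by blast
    show ?thesis unfolding g(2,3) by (rule \<kappa>(2)[OF g(1)])
  qed
  have "fst ` S = (\<lambda>g. g j) ` H" by (simp add: S_def image_image)
  then have ne': "nonelementary (fst ` S)" using ne by simp
  have kpos: "\<kappa> > 0" using \<kappa>(1) False by simp
  obtain Q R f where Q: "det Q = 1" "det R = 1" "f = id \<or> f = cnjm"
    and rig: "\<And>x y. (x, y) \<in> S \<Longrightarrow> sl2_inv R ** y ** R = f (sl2_inv Q ** x ** Q) \<or> sl2_inv R ** y ** R = - f (sl2_inv Q ** x ** Q)"
    using length_rigidity[OF S kpos len ne'] by blast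
  define A where "A g = f (sl2_inv Q ** g j ** Q)" for g :: "'a \<Rightarrow> mat2"
  define B where "B g = sl2_inv R ** g i ** R" for g :: "'a \<Rightarrow> mat2"
  have AB: "B g = A g \<or> B g = - A g" if "g \<in> H" for g using rig[OF SI[OF that]] by (simp add: A_def B_def)
  have cm: "sl2_inv Q ** (x ** y) ** Q = (sl2_inv Q ** x ** Q) ** (sl2_inv Q ** y ** Q)" if "det Q = 1" for Q x y :: mat2
    by (metis that matrix_mul_assoc matrix_mul_rid sl2_inv_right)
  have ci: "sl2_inv Q ** sl2_inv x ** Q = sl2_inv (sl2_inv Q ** x ** Q)" for Q x
    by (simp add: sl2_inv_mult matrix_mul_assoc)
  have fm: "f (x ** y) = f x ** f y" and fi: "f (sl2_inv x) = sl2_inv (f x)" and f1: "f (mat 1) = mat 1" for x y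
    using Q(3) cnjm_mult[of x y] sl2_inv_cnjm[of x] by (elim disjE; simp add: mat_mk)+
  have Am: "A (\<lambda>i. g i ** h i) = A g ** A h" and Ai: "A (\<lambda>i. sl2_inv (g i)) = sl2_inv (A g)"
    and Bm: "B (\<lambda>i. g i ** h i) = B g ** B h" and Bi: "B (\<lambda>i. sl2_inv (g i)) = sl2_inv (B g)" for g h
    unfolding A_def B_def by (simp_all only: cm[OF Q(1)] cm[OF Q(2)] fm ci fi)
  have A1: "A (\<lambda>i. mat 1) = mat 1" and B1: "B (\<lambda>i. mat 1) = mat 1"
    unfolding A_def B_def by (simp_all only: matrix_mul_rid sl2_inv_left[OF Q(1)] sl2_inv_left[OF Q(2)] f1)
  define H' where "H' = {g \<in> H. B g = A g}"
  have H'H: "H' \<subseteq> H" by (auto simp: H'_def)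
  have H': "subgroup H' (SLG C)"
  proof (rule G.subgroupI)
    show "H' \<subseteq> carrier (SLG C)" using H'H subgroup.subset[OF H] by blast
    show "H' \<noteq> {}" using SLG_subgroupD(1)[OF H] A1 B1 by (auto simp: H'_def)
    fix g assume g: "g \<in> H'"
    then have gH: "g \<in> H" using H'H by blast
    show "inv\<^bsub>SLG C\<^esub> g \<in> H'"
      using inv_SLG[OF subgroup.mem_carrier[OF H gH]] SLG_subgroupD(3)[OF H gH] g by (simp add: H'_def Ai Bi)
    fix h assume h: "h \<in> H'"
    show "g \<otimes>\<^bsub>SLG C\<^esub> h \<in> H'"
      using SLG_subgroupD(2)[OF H gH, of h] g h by (simp add: H'_def mult_SLG Am Bm)
  qed
  have fi: "fidx (SLG C) H' H"
  \<comment> \<open>The separating map is the truth value of \<open>B g = A g\<close>: two elements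
    with the same sign have their quotient in \<open>H'\<close>.\<close>
  proof (rule G.fidx_map[OF H, where f = "\<lambda>g. B g = A g"])
    show "finite ((\<lambda>g. B g = A g) ` H)" by simp
    fix g h assume gh: "g \<in> H" "h \<in> H" "(B g = A g) = (B h = A h)"
    have e: "g \<otimes>\<^bsub>SLG C\<^esub> inv\<^bsub>SLG C\<^esub> h = (\<lambda>i. g i ** sl2_inv (h i))"
      using inv_SLG[OF subgroup.mem_carrier[OF H gh(2)]] by (simp add: mult_SLG)
    have "B g ** sl2_inv (B h) = A g ** sl2_inv (A h)"
    proof (cases "B g = A g")
      case True
      then show ?thesis using gh by simp
    next
      case False
      then have "B g = - A g" "B h = - A h" using AB gh by blast+
      then show ?thesis
        by (cases "A g" rule: mk_cases, cases "A h" rule: mk_cases) simp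
    qed
    then have "B (\<lambda>i. g i ** sl2_inv (h i)) = A (\<lambda>i. g i ** sl2_inv (h i))"
      by (simp only: Am[of g "\<lambda>i. sl2_inv (h i)"] Bm[of g "\<lambda>i. sl2_inv (h i)"] Ai Bi)
    moreover have "(\<lambda>i. g i ** sl2_inv (h i)) \<in> H"
      using SLG_subgroupD(2)[OF H gh(1) SLG_subgroupD(3)[OF H gh(2)]] .
    ultimately show "g \<otimes>\<^bsub>SLG C\<^esub> inv\<^bsub>SLG C\<^esub> h \<in> H'" unfolding e H'_def by simp
  qed
  have tr: "trace (B g) = trace (g i)" "trace (sl2_inv Q ** g j ** Q) = trace (g j)" for g
    unfolding B_def using trace_conj[of "sl2_inv R" "g i"] trace_conj[of "sl2_inv Q" "g j"] Q by simp_all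
  have "trace_alt H' j i"
  proof -
    have BA: "trace (g i) = trace (A g)" if "g \<in> H'" for g using that tr(1)[of g] by (simp add: H'_def)
    from Q(3) show ?thesis
    proof
      assume "f = id"
      then have "trace (A g) = trace (g j)" for g using tr(2) by (simp add: A_def)
      then show ?thesis using BA unfolding trace_alt_def by simp
    next
      assume "f = cnjm"
      then have "trace (A g) = cnj (trace (g j))" for g using tr(2) by (simp add: A_def trace_cnjm)
      then show ?thesis using BA unfolding trace_alt_def by simp
    qed
  qed
  then show ?thesis using that[OF H' H'H fi] by blast
qed

lemma trace_alternatives:
  fixes H :: "('n::finite \<Rightarrow> mat2) set"
  assumes H: "subgroup H (SLG C)" and ne: "nonelementary ((\<lambda>g. g j) ` H)"
    and c: "\<And>i. c i \<ge> 0" "\<And>g i. g \<in> H \<Longrightarrow> tlen (g i) = c i * tlen (g j)"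
  obtains H' where "subgroup H' (SLG C)" "H' \<subseteq> H" "fidx (SLG C) H' H" "\<forall>i. trace_alt H' j i"
proof -
  interpret G: group "SLG C" by (rule group_SLG)
  have "\<exists>H'. subgroup H' (SLG C) \<and> H' \<subseteq> H \<and> fidx (SLG C) H' H \<and> (\<forall>i\<in>X. trace_alt H' j i)" if "finite X" for X
    using that
  proof (induction X rule: finite_induct)
    case empty
    then show ?case using H G.fidx_refl[OF H] by blast
  next
    case (insert i X)
    then obtain H1 where H1: "subgroup H1 (SLG C)" "H1 \<subseteq> H" "fidx (SLG C) H1 H" "\<forall>i\<in>X. trace_alt H1 j i" by blast
    have ne1: "nonelementary ((\<lambda>g. g j) ` H1)" by (rule nonelementary_fidx[OF H1(1) H H1(3) ne])
    have l: "tlen (g i) = c i * tlen (g j)" if "g \<in> H1" for g by (rule c(2)[OF subsetD[OF H1(2) that]])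
    obtain H2 where H2: "subgroup H2 (SLG C)" "H2 \<subseteq> H1" "fidx (SLG C) H2 H1" "trace_alt H2 j i"
      by (rule trace_alternative[where H = H1 and j = j and i = i and \<kappa> = "c i", OF H1(1) ne1 c(1)[of i] l])
    have fi: "fidx (SLG C) H2 H" by (rule G.fidx_trans[OF H2(1) H1(1) H H1(2) H2(3) H1(3)])
    have al: "trace_alt H2 j k" if "k \<in> insert i X" for k
    proof (cases "k = i")
      case True
      then show ?thesis using H2(4) by simp
    next
      case False
      then have "trace_alt H1 j k" using H1(4) that by simp
      then show ?thesis by (rule trace_alt_mono[OF _ H2(2)])
    qed
    show ?case by (rule exI[of _ H2], intro conjI ballI) (rule H2(1) subset_trans[OF H2(2) H1(2)] fi al, assumption?)+
  qed
  from this[OF finite_class.finite_UNIV] obtain H' where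
    H': "subgroup H' (SLG C)" "H' \<subseteq> H" "fidx (SLG C) H' H" "\<forall>i\<in>UNIV. trace_alt H' j i" by (elim exE conjE)
  show ?thesis by (rule that[OF H'(1-3)]) (use H'(4) in simp)
qed

text \<open>The span of the sorted words in the generators contains the identity and is stable under
  right multiplication by generators and their inverses, hence contains the whole group.\<close>

lemma span_of_generated:
  assumes R: "subring R" and S: "finite S" and N: "subgroup N (SLG C)" "N = generate (SLG C) S" "S \<subseteq> N"
    and tr: "\<And>g. g \<in> N \<Longrightarrow> trace (g j) \<in> R"
  obtains M where "finite M" "M \<subseteq> (\<lambda>g. g j) ` N" "(\<lambda>g. g j) ` N \<subseteq> rmod.rspan R scm M"
proof -
  interpret rmod R scm by (rule rmod_scm[OF R])
  let ?P = "(\<lambda>g. g j) ` N"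
  have P: "mgrp ?P" by (rule mgrp_proj[OF N(1)])
  obtain L where L: "set L = (\<lambda>g. g j) ` S" using finite_list[OF finite_imageI[OF S, of "\<lambda>g. g j"]] by blast
  define M where "M = sorted_words L"
  have PD: "mat 1 \<in> ?P" "\<And>x y. x \<in> ?P \<Longrightarrow> y \<in> ?P \<Longrightarrow> x ** y \<in> ?P" "\<And>x. x \<in> ?P \<Longrightarrow> det x = 1"
    using P by (auto simp: mgrp_def)
  have LP: "set L \<subseteq> ?P" using L N(3) by blast
  have MP: "M \<subseteq> ?P" unfolding M_def by (rule sorted_words_subset[OF PD(1,2) LP])
  have trP: "trace x \<in> R" if "x \<in> ?P" for x using that tr by blast
  have cl: "w ** g j \<in> rspan M" if "g \<in> S" "w \<in> rspan M" for g w
    unfolding M_def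
    by (rule sorted_words_closed[OF R PD(1,2) trP PD(3) LP]) (use that L in \<open>auto simp: M_def\<close>)
  have all: "\<forall>w\<in>rspan M. w ** g j \<in> rspan M" if "g \<in> generate (SLG C) S" for g
    using that
  proof (induction rule: generate.induct)
    case one
    then show ?case by (simp add: one_SLG)
  next
    case (incl h)
    then show ?case using cl by blast
  next
    case (inv h)
    have hN: "h \<in> N" using inv N(3) by blast
    have "inv\<^bsub>SLG C\<^esub> h = (\<lambda>i. sl2_inv (h i))" by (rule inv_SLG[OF subgroup.mem_carrier[OF N(1) hN]])
    moreover have "w ** sl2_inv (h j) \<in> rspan M" if w: "w \<in> rspan M" for w
    proof -
      \<comment> \<open>The inverse of a generator is its trace minus the generator, so no further
        letters are needed.\<close>
      have "w ** sl2_inv (h j) + w ** h j = scm (trace (h j)) w"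
        unfolding mat2_distrib(2)[symmetric] sl2_inv_eq by (simp add: scm_mult)
      then have "w ** sl2_inv (h j) = scm (trace (h j)) w - w ** h j" by (simp add: eq_diff_eq)
      then show ?thesis using rspan_diff[OF rspan_scale[OF tr[OF hN] w] cl[OF inv w]] by simp
    qed
    ultimately show ?case by simp
  next
    case (eng g h)
    then show ?case by (simp add: mult_SLG matrix_mul_assoc)
  qed
  have one: "mat 1 \<in> rspan M" unfolding M_def by (rule rspan_base[OF one_sorted_words])
  have "?P \<subseteq> rspan M"
  proof
    fix x assume "x \<in> ?P"
    then obtain g where g: "g \<in> N" "x = g j" by blast
    have "mat 1 ** g j \<in> rspan M" using all[of g] g(1) N(2) one by blast
    then show "x \<in> rspan M" using g(2) by simp
  qed
  then show ?thesis using that[of M] MP finite_sorted_words unfolding M_def by blast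
qed

lemma (in arith) places_of_trace_field:
  assumes HU: "H \<subseteq> units" and alt: "\<And>i. trace_alt H j i"
    and F: "F = gen_field (trace ` (\<lambda>g. g j) ` H)"
  shows "number_field F" "\<And>g. g \<in> H \<Longrightarrow> algebraic_int (trace (g j))"
    "embedding F \<tau> \<Longrightarrow> (\<forall>x\<in>F. \<tau> x = x) \<or> (\<forall>x\<in>F. \<tau> x = cnj x)
        \<or> (\<forall>p\<in>(\<lambda>g. g j) ` H. Im (\<tau> (trace p)) = 0 \<and> \<bar>Re (\<tau> (trace p))\<bar> \<le> 2)"
proof -
  interpret p: emb K "\<phi> j" by (rule emb_i)
  let ?T = "trace ` (\<lambda>g. g j) ` H"
  have unit: "\<exists>x\<in>Ord. nrd a b x = 1 \<and> (\<forall>i. g i = rho x i)" if "g \<in> H" for g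
    using that HU by (auto simp: units_def)
  have tr: "2 * x$0 \<in> K \<and> (\<forall>i. trace (rho x i) = \<phi> i (2 * x$0))" if x: "x \<in> Ord" for x
  proof -
    have x0: "x$0 \<in> K" using ord_quat[OF x] by (simp add: quat_alg_def)
    show ?thesis unfolding rho_trace mult_2 using subfieldD(3)[OF sf x0 x0] emb.emb_add[OF emb_i x0 x0] by simp
  qed
  show "algebraic_int (trace (g j))" if g: "g \<in> H" for g
  proof -
    obtain x where x: "x \<in> Ord" "nrd a b x = 1" "\<forall>i. g i = rho x i" using unit[OF g] by blast
    show ?thesis using rho_trace_integral[OF x(1,2)] x(3) by simp
  qed
  have TK: "?T \<subseteq> \<phi> j ` K"
  proof clarify
    fix g assume "g \<in> H"
    then obtain x where x: "x \<in> Ord" "\<forall>i. g i = rho x i" using unit by blast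
    then have "trace (g j) = \<phi> j (2 * x$0)" "2 * x$0 \<in> K" using tr[OF x(1)] by simp_all
    then show "trace (g j) \<in> \<phi> j ` K" by blast
  qed
  have FK: "F \<subseteq> \<phi> j ` K" unfolding F by (rule gen_field_least[OF p.subfield_image TK])
  have Fsub: "subfield F" unfolding F by (rule subfield_gen_field)
  note nfK = p.number_field_image[OF nf]
  show "number_field F" by (rule number_field_subset[OF Fsub FK nfK])
  assume \<tau>: "embedding F \<tau>"
  obtain \<tau>' where \<tau>': "embedding (\<phi> j ` K) \<tau>'" "\<And>x. x \<in> F \<Longrightarrow> \<tau>' x = \<tau> x"
    using extend_embedding[OF Fsub FK nfK \<tau>] by blast
  have comp: "embedding K (\<tau>' \<circ> \<phi> j)" by (rule embedding_comp[OF p.emb \<tau>'(1)])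
  have TF: "trace (g j) \<in> F" if "g \<in> H" for g using gen_field_base[of ?T] that unfolding F by blast
  have key: "\<exists>x\<in>Ord. nrd a b x = 1 \<and> 2 * x$0 \<in> K \<and> \<tau> (trace (g j)) = (\<tau>' \<circ> \<phi> j) (2 * x$0) \<and> (\<forall>i. trace (g i) = \<phi> i (2 * x$0))"
    if g: "g \<in> H" for g
  proof -
    obtain x where x: "x \<in> Ord" "nrd a b x = 1" "\<forall>i. g i = rho x i" using unit[OF g] by blast
    have "trace (g i) = \<phi> i (2 * x$0)" for i using tr[OF x(1)] x(3) by simp
    then show ?thesis using x(1,2) tr[OF x(1)] \<tau>'(2)[OF TF[OF g]] by (intro bexI[of _ x]) auto
  qed
  have idc: "\<forall>x\<in>F. \<tau> x = x" if "\<forall>g\<in>H. \<tau> (trace (g j)) = trace (g j)"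
    using embeddings_agree_on_gen_field[OF \<tau>[unfolded F] embedding_id] that unfolding F by blast
  have cnjc: "\<forall>x\<in>F. \<tau> x = cnj x" if "\<forall>g\<in>H. \<tau> (trace (g j)) = cnj (trace (g j))"
    using embeddings_agree_on_gen_field[OF \<tau>[unfolded F] embedding_cnj[OF embedding_id]] that
    unfolding F comp_def by blast
  show "(\<forall>x\<in>F. \<tau> x = x) \<or> (\<forall>x\<in>F. \<tau> x = cnj x)
        \<or> (\<forall>p\<in>(\<lambda>g. g j) ` H. Im (\<tau> (trace p)) = 0 \<and> \<bar>Re (\<tau> (trace p))\<bar> \<le> 2)"
    using comp
  proof (cases rule: embedding_cases)
    case (1 i)
    have e: "\<tau> (trace (g j)) = trace (g i)" if g: "g \<in> H" for g
    proof -
      obtain x :: "complex^4" where x: "2 * x$0 \<in> K" "\<tau> (trace (g j)) = (\<tau>' \<circ> \<phi> j) (2 * x$0)"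
        "\<forall>i. trace (g i) = \<phi> i (2 * x$0)" using key[OF g] by blast
      show ?thesis using 1 x unfolding same_emb_def by simp
    qed
    show ?thesis using alt[of i] idc cnjc e unfolding trace_alt_def by auto
  next
    case (2 i)
    have e: "\<tau> (trace (g j)) = cnj (trace (g i))" if g: "g \<in> H" for g
    proof -
      obtain x :: "complex^4" where x: "2 * x$0 \<in> K" "\<tau> (trace (g j)) = (\<tau>' \<circ> \<phi> j) (2 * x$0)"
        "\<forall>i. trace (g i) = \<phi> i (2 * x$0)" using key[OF g] by blast
      show ?thesis using 2 x unfolding same_emb_def by simp
    qed
    show ?thesis using alt[of i] idc cnjc e unfolding trace_alt_def by auto
  next
    case 3
    have "Im (\<tau> (trace (g j))) = 0 \<and> \<bar>Re (\<tau> (trace (g j)))\<bar> \<le> 2" if g: "g \<in> H" for g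
    proof -
      obtain x where x: "x \<in> Ord" "nrd a b x = 1" "\<tau> (trace (g j)) = (\<tau>' \<circ> \<phi> j) (2 * x$0)"
        using key[OF g] by blast
      show ?thesis unfolding x(3) by (rule 3[OF x(2,1)])
    qed
    then show ?thesis by blast
  qed
qed

lemma proportional_imp_arithmetic:
  fixes C :: "'n::finite set"
  assumes \<Delta>: "irr_arithmetic C \<Delta>" and \<Gamma>: "Gsubgroup C \<Gamma>" "\<Gamma> \<subseteq> \<Delta>" "fin_gen (SLG C) \<Gamma>"
    and ne: "nonelementary ((\<lambda>g. g j) ` \<Gamma>)"
    and c: "\<And>i. c i \<ge> 0" "\<And>g i. g \<in> \<Gamma> \<Longrightarrow> tlen (g i) = c i * tlen (g j)"
  obtains \<Lambda> where "arith_fuchsian_or_kleinian \<Lambda>" "(\<lambda>g. g j) ` \<Gamma> \<subseteq> \<Lambda>"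
proof -
  obtain K a b Ord \<phi> I J where A: "arith_data C K a b Ord \<phi> I J" "commensurable (SLG C) \<Delta> (Gamma_star C a b Ord \<phi> I J)"
    and D: "Gsubgroup C \<Delta>" using \<Delta> unfolding irr_arithmetic_def by blast
  interpret A: arith C K a b Ord \<phi> I J using A(1) by (rule arith.intro)
  interpret G: group "SLG C" by (rule group_SLG)
  have sub: "subgroup \<Gamma> (SLG C)" using \<Gamma>(1) by (simp add: Gsubgroup_def)
  define H0 where "H0 = \<Gamma> \<inter> A.units"
  have H0: "subgroup H0 (SLG C)" "H0 \<subseteq> \<Gamma>" "H0 \<subseteq> A.units"
    unfolding H0_def using G.subgroups_Inter_pair[OF sub A.subgroup_units] by auto
  have fi0: "fidx (SLG C) H0 \<Gamma>" unfolding H0_def by (rule A.fidx_units[OF D A(2) \<Gamma>(1,2)])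
  have ne0: "nonelementary ((\<lambda>g. g j) ` H0)" by (rule nonelementary_fidx[OF H0(1) sub fi0 ne])
  have c0: "tlen (g i) = c i * tlen (g j)" if "g \<in> H0" for g i using that H0(2) c(2) by blast
  obtain H1 where H1: "subgroup H1 (SLG C)" "H1 \<subseteq> H0" "fidx (SLG C) H1 H0" "\<forall>i. trace_alt H1 j i"
    by (rule trace_alternatives[where H = H0 and j = j and c = c, OF H0(1) ne0 c(1) c0])
  have fi1: "fidx (SLG C) H1 \<Gamma>" by (rule G.fidx_trans[OF H1(1) H0(1) sub H0(2) H1(3) fi0])
  have H1\<Gamma>: "H1 \<subseteq> \<Gamma>" using H1(2) H0(2) by blast
  \<comment> \<open>A normal subgroup is taken so that all of \<open>\<Gamma>\<close> normalizes the
    order spanned by the projection of \<open>N\<close>.\<close>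
  obtain N where N: "subgroup N (SLG C)" "N \<subseteq> H1" "fidx (SLG C) N \<Gamma>"
    "\<And>k n. k \<in> \<Gamma> \<Longrightarrow> n \<in> N \<Longrightarrow> k \<otimes>\<^bsub>SLG C\<^esub> n \<otimes>\<^bsub>SLG C\<^esub> inv\<^bsub>SLG C\<^esub> k \<in> N"
    using G.normal_core[OF H1(1) sub H1\<Gamma> fi1] by blast
  have N\<Gamma>: "N \<subseteq> \<Gamma>" using N(2) H1\<Gamma> by blast
  obtain S0 where S0: "finite S0" "S0 \<subseteq> carrier (SLG C)" "generate (SLG C) S0 = \<Gamma>"
    using \<Gamma>(3) unfolding fin_gen_def by blast
  \<comment> \<open>Finite generation descends to \<open>N\<close>, which yields the finite spanning
    set \<open>M\<close> of the order.\<close>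
  obtain S where S: "finite S" "S \<subseteq> N" "N = generate (SLG C) S"
    using G.fidx_fin_gen[OF S0(1,2) N(1)] S0(3) N\<Gamma> N(3) by blast
  define P where "P = (\<lambda>g. g j) ` N"
  define F where "F = gen_field (trace ` P)"
  define R where "R = {x \<in> F. algebraic_int x}"
  have NU: "N \<subseteq> A.units" using N(2) H1(2) H0(3) by blast
  have alt: "trace_alt N j i" for i by (rule trace_alt_mono[OF spec[OF H1(4)] N(2)])
  note pl = A.places_of_trace_field[where H = N and j = j, OF NU alt F_def[unfolded P_def]]
  have Rs: "subring R" using subfield_subring[OF subfield_gen_field] subring_algebraic_int
    unfolding R_def F_def subring_def by auto
  have trR: "trace (g j) \<in> R" if "g \<in> N" for g
    using pl(2)[OF that] gen_field_base[of "trace ` P"] that unfolding R_def F_def P_def by blast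
  obtain M where M: "finite M" "M \<subseteq> P" "P \<subseteq> rmod.rspan R scm M"
    unfolding P_def by (rule span_of_generated[OF Rs S(1) N(1) S(3,2)]) (erule trR, assumption)
  interpret T: trace_group P M F R
  proof
    show "mgrp P" unfolding P_def by (rule mgrp_proj[OF N(1)])
    show "nonelementary P" unfolding P_def by (rule nonelementary_fidx[OF N(1) sub N(3) ne])
    show "algebraic_int (trace p)" if "p \<in> P" for p using that pl(2) unfolding P_def by blast
    show "number_field F" by (rule pl(1))
  qed (use M F_def R_def pl(3) in \<open>auto simp: P_def\<close>)
  obtain T where T: "finite T" "T \<subseteq> \<Gamma>" "\<And>k. k \<in> \<Gamma> \<Longrightarrow> \<exists>h\<in>N. \<exists>t\<in>T. k = h \<otimes>\<^bsub>SLG C\<^esub> t"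
    using N(3) unfolding fidx_def by blast
  show ?thesis
  proof (rule T.normalizer_in_arithmetic[of "(\<lambda>g. g j) ` \<Gamma>" "(\<lambda>g. g j) ` T"])
    show "mgrp ((\<lambda>g. g j) ` \<Gamma>)" by (rule mgrp_proj[OF sub])
    show "P \<subseteq> (\<lambda>g. g j) ` \<Gamma>" using N\<Gamma> by (auto simp: P_def)
    show "finite ((\<lambda>g. g j) ` T)" "(\<lambda>g. g j) ` T \<subseteq> (\<lambda>g. g j) ` \<Gamma>" using T by auto
  next
    fix e p assume "e \<in> (\<lambda>g. g j) ` \<Gamma>" "p \<in> P"
    then obtain k n where kn: "k \<in> \<Gamma>" "n \<in> N" "e = k j" "p = n j" unfolding P_def by blast
    have "(\<lambda>i. k i ** n i ** sl2_inv (k i)) \<in> N"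
      using N(4)[OF kn(1,2)] inv_SLG[OF subgroup.mem_carrier[OF sub kn(1)]] by (simp add: mult_SLG)
    then show "e ** p ** sl2_inv e \<in> P" unfolding P_def kn(3,4) by (rule image_eqI[rotated]) simp
  next
    fix e assume "e \<in> (\<lambda>g. g j) ` \<Gamma>"
    then obtain k where k: "k \<in> \<Gamma>" "e = k j" by blast
    obtain h t where ht: "h \<in> N" "t \<in> T" "k = h \<otimes>\<^bsub>SLG C\<^esub> t" using T(3)[OF k(1)] by blast
    have "e = h j ** t j" unfolding k(2) ht(3) by (simp add: mult_SLG)
    then show "\<exists>p\<in>P. \<exists>t\<in>(\<lambda>g. g j) ` T. e = p ** t" using ht(1,2) unfolding P_def by blast
  qed (rule that)
qed

theorem theoremT:
  fixes C :: "'n::finite set" and \<Delta> \<Gamma> :: "('n \<Rightarrow> mat2) set" and j :: 'n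
  assumes "CARD('n) \<ge> 2"
    and "irr_arithmetic C \<Delta>"
    and "Gsubgroup C \<Gamma>" and "\<Gamma> \<subseteq> \<Delta>" and "fin_gen (SLG C) \<Gamma>"
    and "nonelementary ((\<lambda>g. g j) ` \<Gamma>)"
  shows "single_proj_point (limit_cone \<Gamma>) \<longleftrightarrow>
           (\<exists>\<Lambda>. arith_fuchsian_or_kleinian \<Lambda> \<and> (\<lambda>g. g j) ` \<Gamma> \<subseteq> \<Lambda>)"
proof -
  have sub: "subgroup \<Gamma> (SLG C)" using assms(3) by (simp add: Gsubgroup_def)
  obtain g0 where g0: "g0 \<in> \<Gamma>" "tlen (g0 j) > 0"
    using nonelementary_loxodromic[OF assms(6) mgrp_proj[OF sub]] by blast
  show ?thesis unfolding single_proj_point_iff[OF sub assms(6)]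
  proof
    assume "\<exists>c. c j = 1 \<and> (\<forall>i. c i \<ge> 0) \<and> (\<forall>g\<in>\<Gamma>. \<forall>i. tlen (g i) = c i * tlen (g j))"
    then obtain c :: "'n \<Rightarrow> real" where c: "\<And>i. c i \<ge> 0" "\<And>g i. g \<in> \<Gamma> \<Longrightarrow> tlen (g i) = c i * tlen (g j)" by blast
    obtain \<Lambda> where "arith_fuchsian_or_kleinian \<Lambda>" "(\<lambda>g. g j) ` \<Gamma> \<subseteq> \<Lambda>"
      by (rule proportional_imp_arithmetic[where j = j and c = c, OF assms(2-6) c])
    then show "\<exists>\<Lambda>. arith_fuchsian_or_kleinian \<Lambda> \<and> (\<lambda>g. g j) ` \<Gamma> \<subseteq> \<Lambda>" by blast
  next
    assume "\<exists>\<Lambda>. arith_fuchsian_or_kleinian \<Lambda> \<and> (\<lambda>g. g j) ` \<Gamma> \<subseteq> \<Lambda>"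
    then obtain \<Lambda> where \<Lambda>: "arith_fuchsian_or_kleinian \<Lambda>" "(\<lambda>g. g j) ` \<Gamma> \<subseteq> \<Lambda>" by blast
    obtain c where c: "\<And>i. c i = 0 \<or> c i = 1" "\<And>g i. g \<in> \<Gamma> \<Longrightarrow> tlen (g i) = c i * tlen (g j)"
      using arithmetic_imp_proportional[OF assms(2-4) \<Lambda>] by blast
    have "c j = 1" using c(2)[OF g0(1), of j] g0(2) by simp
    moreover have "c i \<ge> 0" for i using c(1)[of i] by auto
    ultimately show "\<exists>c. c j = 1 \<and> (\<forall>i. c i \<ge> 0) \<and> (\<forall>g\<in>\<Gamma>. \<forall>i. tlen (g i) = c i * tlen (g j))"
      using c(2) by blast
  qed
qed

end
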